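(* The Fefferman conformal class of metrics $[g_F]$ associated with a point equivalence class of second order ODEs $y''=Q(x,y,y')$ has the following properties. (1) Each $g_F$ has signature $(++--)$. (2) The Weyl tensor of each $g_F$ has both the self-dual and the anti-self-dual parts of Petrov type N (possibly vanishing). The self-dual part $C^+$ is proportional to $\mathcal R$ and the anti-self-dual part $C^-$ is proportional to $\bar{\mathcal R}$. (3) $g_F$ satisfies the Baston–Mason conditions (i) and (ii) of the context if and only if the corresponding point equivalence class of equations satisfies either $\mathcal R=0$ or $\bar{\mathcal R}=0$.
   Context: All considerations are local and concern nonsingular points. Here $i$ is a fixed nonzero REAL constant, and bars do not denote complex conjugation. $Q=Q(x,y,p)$ is a smooth real function on the first jet space $J^1$ with coordinates $(x,y,p)$. Fefferman metrics: on the 4-dimensional space with coordinates $(x,y,p,\phi)$, the Fefferman metrics associated with $y''=Q(x,y,y')$ are $$g_F=2\rho^2\Big[(dp-Q\,dx)\,dx-(dy-p\,dx)\Big(\tfrac23 i\,d\phi+\tfrac23 Q_p\,dx+\tfrac16 Q_{pp}(dy-p\,dx)\Big)\Big],$$ where $\rho\neq 0$ is an arbitrary function; they form a conformal class $[g_F]$ that depends only on the point equivalence class of the ODE. Products of 1-forms are symmetrized tensor products. Put $D=\partial_x+p\partial_y+Q\partial_p$ and $$w_1=D^2Q_{pp}-4DQ_{py}-DQ_{pp}\,Q_p+4Q_pQ_{py}-3Q_{pp}Q_y+6Q_{yy},\qquad w_2=Q_{pppp}.$$ The invariants $\mathcal R,\bar{\mathcal R}$ are $$\mathcal R=-\frac{e^{2i\phi}}{6i^2\rho^4}w_1,\qquad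 \bar{\mathcal R}=-\frac{e^{-2i\phi}}{6i^2\rho^4}w_2,$$ so $\mathcal R=0$ iff $w_1=0$, and $\bar{\mathcal R}=0$ iff $w_2=0$; these vanishing conditions are point invariant. Orientation: it is chosen so that the null 2-form $dx\wedge(dy-p\,dx)$ is self-dual (then $(dp-Q\,dx)\wedge(dy-p\,dx)$ is anti-self-dual). $C^\pm$ denote the self-dual/anti-self-dual parts of the Weyl tensor. Baston–Mason conditions: let $\tilde\omega$ be the Cartan normal conformal connection of $g_F$, $\tilde\Omega=d\tilde\omega+\tilde\omega\wedge\tilde\omega$ its curvature, $*$ the Hodge star of $g_F$, and $\tilde\Omega^\pm=\frac12\tilde\Omega^\pm_{\mu\nu}\theta^\mu\wedge\theta^\nu$ the self-dual/anti-self-dual parts of $\tilde\Omega$ in a coframe $\theta^\mu$. The conditions are (i) $d{*\tilde\Omega}+\tilde\omega\wedge{*\tilde\Omega}-{*\tilde\Omega}\wedge\tilde\omega=0$ (equivalently, the Bach tensor of $g_F$ vanishes); (ii) $[\tilde\Omega^+_{\mu\nu},\tilde\Omega^-_{\rho\sigma}]=0$ for all $\mu,\nu,\rho,\sigma$. *)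

theory Defs
  imports "HOL-Analysis.Analysis"
begin

section \<open>Partial derivatives and smoothness\<close>

definition pd :: "'n::finite \<Rightarrow> (real^'n \<Rightarrow> 'b::real_normed_vector) \<Rightarrow> real^'n \<Rightarrow> 'b" where
  "pd k f m = frechet_derivative f (at m) (axis k 1)"

primrec Ck_on :: "(real^'n::finite) set \<Rightarrow> nat \<Rightarrow> (real^'n \<Rightarrow> 'b::real_normed_vector) \<Rightarrow> bool" where
  "Ck_on S 0 f \<longleftrightarrow> continuous_on S f"
| "Ck_on S (Suc r) f \<longleftrightarrow> (\<forall>m\<in>S. f differentiable (at m)) \<and> (\<forall>k. Ck_on S r (pd k f))"

text \<open>Only used on open sets.\<close>
definition smooth_on :: "(real^'n::finite) set \<Rightarrow> (real^'n \<Rightarrow> 'b::real_normed_vector) \<Rightarrow> bool" where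
  "smooth_on S f \<longleftrightarrow> (\<forall>r. Ck_on S r f)"


section \<open>Pseudo-Riemannian geometry in dimension four\<close>

text \<open>
  A metric is a field of symmetric 4 by 4 matrices \<^term>\<open>g :: real^4 \<Rightarrow> real^4^4\<close> of
  coordinate components; \<open>G\<close> denotes the value of such a field at a point.  The index type
  \<^typ>\<open>4\<close> has the elements \<open>1, 2, 3, 4\<close> (and \<open>4 = 0\<close>).  One-forms are
  covectors \<^typ>\<open>real^4\<close>; a two-form \<open>F = 1/2 F a b dx^a \<and> dx^b\<close>, possibly
  with values in a vector space, is the antisymmetric family \<open>F a b\<close>.
\<close>

definition has_signature_2_2 :: "real^4^4 \<Rightarrow> bool" where
  "has_signature_2_2 G \<longleftrightarrow> (\<exists>B :: real^4^4. invertible B \<and>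
     transpose B ** G ** B = (\<chi> a b. if a = b then (if a = 1 \<or> a = 2 then 1 else - 1) else 0))"

text \<open>\<open>christoffel g m a b c\<close> is \<open>\<Gamma>\<^sup>a\<^sub>b\<^sub>c\<close>.\<close>
definition christoffel :: "(real^4 \<Rightarrow> real^4^4) \<Rightarrow> real^4 \<Rightarrow> 4 \<Rightarrow> 4 \<Rightarrow> 4 \<Rightarrow> real" where
  "christoffel g m a b c = (1/2) * (\<Sum>d\<in>UNIV. matrix_inv (g m) $ a $ d *
     (pd b (\<lambda>m. g m $ d $ c) m + pd c (\<lambda>m. g m $ b $ d) m - pd d (\<lambda>m. g m $ b $ c) m))"

text \<open>\<open>riemann g m a b c d\<close> is \<open>R\<^sup>a\<^sub>b\<^sub>c\<^sub>d\<close>, with \<open>c d\<close> the two-form indices.\<close>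
definition riemann :: "(real^4 \<Rightarrow> real^4^4) \<Rightarrow> real^4 \<Rightarrow> 4 \<Rightarrow> 4 \<Rightarrow> 4 \<Rightarrow> 4 \<Rightarrow> real" where
  "riemann g m a b c d =
     pd c (\<lambda>m. christoffel g m a d b) m - pd d (\<lambda>m. christoffel g m a c b) m
     + (\<Sum>e\<in>UNIV. christoffel g m a c e * christoffel g m e d b
                - christoffel g m a d e * christoffel g m e c b)"

definition ricci :: "(real^4 \<Rightarrow> real^4^4) \<Rightarrow> real^4 \<Rightarrow> 4 \<Rightarrow> 4 \<Rightarrow> real" where
  "ricci g m b d = (\<Sum>a\<in>UNIV. riemann g m a b a d)"

definition scalar_curv :: "(real^4 \<Rightarrow> real^4^4) \<Rightarrow> real^4 \<Rightarrow> real" where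
  "scalar_curv g m = (\<Sum>a\<in>UNIV. \<Sum>b\<in>UNIV. matrix_inv (g m) $ a $ b * ricci g m a b)"

text \<open>The Weyl tensor \<open>C\<^sub>a\<^sub>b\<^sub>c\<^sub>d\<close> with all indices lowered.\<close>
definition weyl :: "(real^4 \<Rightarrow> real^4^4) \<Rightarrow> real^4 \<Rightarrow> 4 \<Rightarrow> 4 \<Rightarrow> 4 \<Rightarrow> 4 \<Rightarrow> real" where
  "weyl g m a b c d =
     (\<Sum>e\<in>UNIV. g m $ a $ e * riemann g m e b c d)
     - (1/2) * (g m $ a $ c * ricci g m b d - g m $ a $ d * ricci g m b c
              - g m $ b $ c * ricci g m a d + g m $ b $ d * ricci g m a c)
     + (scalar_curv g m / 6) * (g m $ a $ c * g m $ b $ d - g m $ a $ d * g m $ b $ c)"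

subsection \<open>Hodge star and (anti-)self-dual parts\<close>

text \<open>The permutation symbol, as a generalized Kronecker delta.\<close>
definition perm_symbol :: "4 \<Rightarrow> 4 \<Rightarrow> 4 \<Rightarrow> 4 \<Rightarrow> real" where
  "perm_symbol a b c d = det (\<chi> r. (axis (if r = 1 then a else if r = 2 then b
                                       else if r = 3 then c else d) 1 :: real^4))"

text \<open>
  An orientation is a sign \<open>s\<close>: the coordinate frame is positively oriented for
  \<open>s = 1\<close> and negatively oriented for \<open>s = - 1\<close>.
\<close>
definition star :: "real \<Rightarrow> real^4^4 \<Rightarrow> (4 \<Rightarrow> 4 \<Rightarrow> 'b::real_vector) \<Rightarrow> 4 \<Rightarrow> 4 \<Rightarrow> 'b" where
  "star s G F a b = (1/2) *\<^sub>R (\<Sum>c\<in>UNIV. \<Sum>d\<in>UNIV. \<Sum>e\<in>UNIV. \<Sum>f\<in>UNIV.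
     (s * sqrt \<bar>det G\<bar> * perm_symbol a b c d * matrix_inv G $ c $ e * matrix_inv G $ d $ f) *\<^sub>R F e f)"

definition sd_part :: "real \<Rightarrow> real^4^4 \<Rightarrow> (4 \<Rightarrow> 4 \<Rightarrow> 'b::real_vector) \<Rightarrow> 4 \<Rightarrow> 4 \<Rightarrow> 'b" where
  "sd_part s G F a b = (1/2) *\<^sub>R (F a b + star s G F a b)"

definition asd_part :: "real \<Rightarrow> real^4^4 \<Rightarrow> (4 \<Rightarrow> 4 \<Rightarrow> 'b::real_vector) \<Rightarrow> 4 \<Rightarrow> 4 \<Rightarrow> 'b" where
  "asd_part s G F a b = (1/2) *\<^sub>R (F a b - star s G F a b)"

definition two_forms :: "(4 \<Rightarrow> 4 \<Rightarrow> real) set" where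
  "two_forms = {F. \<forall>a b. F b a = - F a b}"

definition sd_forms :: "real \<Rightarrow> real^4^4 \<Rightarrow> (4 \<Rightarrow> 4 \<Rightarrow> real) set" where
  "sd_forms s G = {F \<in> two_forms. star s G F = F}"

definition asd_forms :: "real \<Rightarrow> real^4^4 \<Rightarrow> (4 \<Rightarrow> 4 \<Rightarrow> real) set" where
  "asd_forms s G = {F \<in> two_forms. star s G F = (\<lambda>a b. - F a b)}"

definition wedge :: "real^4 \<Rightarrow> real^4 \<Rightarrow> 4 \<Rightarrow> 4 \<Rightarrow> real" where
  "wedge \<alpha> \<beta> a b = \<alpha> $ a * \<beta> $ b - \<beta> $ a * \<alpha> $ b"

definition weyl_sd :: "real \<Rightarrow> (real^4 \<Rightarrow> real^4^4) \<Rightarrow> real^4 \<Rightarrow> 4 \<Rightarrow> 4 \<Rightarrow> 4 \<Rightarrow> 4 \<Rightarrow> real" where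
  "weyl_sd s g m a b = sd_part s (g m) (weyl g m a b)"

definition weyl_asd :: "real \<Rightarrow> (real^4 \<Rightarrow> real^4^4) \<Rightarrow> real^4 \<Rightarrow> 4 \<Rightarrow> 4 \<Rightarrow> 4 \<Rightarrow> 4 \<Rightarrow> real" where
  "weyl_asd s g m a b = asd_part s (g m) (weyl g m a b)"

subsection \<open>Petrov type N\<close>

text \<open>
  The Petrov type of \<open>C\<^sup>\<plusminus>\<close> is the Jordan type of the trace-free endomorphism
  \<open>F a b \<mapsto> 1/2 W a b c d F^(c d)\<close> which it induces on the three-dimensional space of
  self-dual (anti-self-dual) two-forms.  Type N is the nilpotent type with Jordan blocks of
  sizes 2 and 1, i.e. nilpotency index exactly two; the zero endomorphism is type O.
\<close>
definition weyl_endo :: "real^4^4 \<Rightarrow> (4 \<Rightarrow> 4 \<Rightarrow> 4 \<Rightarrow> 4 \<Rightarrow> real) \<Rightarrow> (4 \<Rightarrow> 4 \<Rightarrow> real) \<Rightarrow> 4 \<Rightarrow> 4 \<Rightarrow> real" where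
  "weyl_endo G W F a b = (1/2) * (\<Sum>c\<in>UNIV. \<Sum>d\<in>UNIV. \<Sum>e\<in>UNIV. \<Sum>f\<in>UNIV.
     W a b c d * matrix_inv G $ c $ e * matrix_inv G $ d $ f * F e f)"

definition petrov_type_N_on ::
  "(4 \<Rightarrow> 4 \<Rightarrow> real) set \<Rightarrow> real^4^4 \<Rightarrow> (4 \<Rightarrow> 4 \<Rightarrow> 4 \<Rightarrow> 4 \<Rightarrow> real) \<Rightarrow> bool" where
  "petrov_type_N_on V G W \<longleftrightarrow>
     (\<exists>F\<in>V. weyl_endo G W F \<noteq> (\<lambda>a b. 0)) \<and>
     (\<forall>F\<in>V. weyl_endo G W (weyl_endo G W F) = (\<lambda>a b. 0))"

text \<open>
  Proportionality \<open>W = f T\<close> of a tensor field to a function: the factor \<open>T\<close> is a smooth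
  tensor field without zeros, so that \<open>W\<close> vanishes exactly where \<open>f\<close> does.
\<close>
definition proportional_on ::
  "(real^4) set \<Rightarrow> (real^4 \<Rightarrow> 4 \<Rightarrow> 4 \<Rightarrow> 4 \<Rightarrow> 4 \<Rightarrow> real) \<Rightarrow> (real^4 \<Rightarrow> real) \<Rightarrow> bool" where
  "proportional_on M W f \<longleftrightarrow> (\<exists>T :: real^4 \<Rightarrow> 4 \<Rightarrow> 4 \<Rightarrow> 4 \<Rightarrow> 4 \<Rightarrow> real.
     (\<forall>a b c d. smooth_on M (\<lambda>m. T m a b c d)) \<and>
     (\<forall>m\<in>M. T m \<noteq> (\<lambda>a b c d. 0)) \<and>
     (\<forall>m\<in>M. \<forall>a b c d. W m a b c d = f m * T m a b c d))"

subsection \<open>Cartan normal conformal connection\<close>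

text \<open>
  A coframe is a matrix field \<open>\<theta>\<close> whose rows \<open>\<theta> m $ \<mu>\<close> are the one-forms
  \<open>\<theta>\<^sup>\<mu>\<close>.  It is adapted to \<open>g\<close> if \<open>g = \<eta>\<^sub>\<mu>\<^sub>\<nu> \<theta>\<^sup>\<mu> \<theta>\<^sup>\<nu>\<close> with constant
  symmetric \<open>\<eta>\<close> (orthonormal and null coframes are instances).
  The Fefferman metrics below have a global one: \<open>\<rho>\<close> times \<open>dx\<close>, \<open>dp - Q dx\<close>, \<open>dy - p dx\<close>
  and \<open>2/3 i d\<phi> + 2/3 Q\<^sub>p dx + 1/6 Q\<^sub>p\<^sub>p (dy - p dx)\<close>.
\<close>
definition adapted_coframe ::
  "(real^4) set \<Rightarrow> (real^4 \<Rightarrow> real^4^4) \<Rightarrow> real^4^4 \<Rightarrow> (real^4 \<Rightarrow> real^4^4) \<Rightarrow> bool" where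
  "adapted_coframe M g \<eta> \<theta> \<longleftrightarrow> smooth_on M \<theta> \<and> transpose \<eta> = \<eta> \<and>
     (\<forall>m\<in>M. invertible (\<theta> m) \<and> g m = transpose (\<theta> m) ** \<eta> ** \<theta> m)"

text \<open>
  The dual frame: column \<open>\<nu>\<close> of \<^term>\<open>matrix_inv (\<theta> m)\<close> is the vector field \<open>e\<^sub>\<nu>\<close>.
  The Levi-Civita connection forms are \<open>\<Gamma>\<^sup>\<mu>\<^sub>\<nu> = \<theta>\<^sup>\<mu>(\<nabla> e\<^sub>\<nu>)\<close>;
  \<open>lc_form g \<theta> m c \<mu> \<nu>\<close> is the \<open>dx\<^sup>c\<close>-component.
\<close>
definition lc_form :: "(real^4 \<Rightarrow> real^4^4) \<Rightarrow> (real^4 \<Rightarrow> real^4^4) \<Rightarrow> real^4 \<Rightarrow> 4 \<Rightarrow> 4 \<Rightarrow> 4 \<Rightarrow> real" where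
  "lc_form g \<theta> m c \<mu> \<nu> = (\<Sum>a\<in>UNIV. \<theta> m $ \<mu> $ a *
     (pd c (\<lambda>m. matrix_inv (\<theta> m) $ a $ \<nu>) m
      + (\<Sum>b\<in>UNIV. christoffel g m a c b * matrix_inv (\<theta> m) $ b $ \<nu>)))"

text \<open>
  The tensor \<open>P\<^sub>a\<^sub>b = R g\<^sub>a\<^sub>b / 12 - R\<^sub>a\<^sub>b / 2\<close>.  This is minus the Schouten tensor in the other
  common convention; the sign is the one for which the normal connection below has the
  Weyl tensor as the middle block of its curvature.
\<close>
definition schouten :: "(real^4 \<Rightarrow> real^4^4) \<Rightarrow> real^4 \<Rightarrow> 4 \<Rightarrow> 4 \<Rightarrow> real" where
  "schouten g m a b = scalar_curv g m / 12 * g m $ a $ b - (1/2) * ricci g m a b"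

text \<open>Index set of the 1 + 4 + 1 block decomposition.\<close>
type_synonym six = "unit + 4 + unit"

text \<open>
  The normal conformal connection in the gauge given by \<open>g\<close> and \<open>\<theta>\<close>, as the matrix of one-forms
  \<open>(0, P\<^sub>\<nu>, 0; \<theta>\<^sup>\<mu>, \<Gamma>\<^sup>\<mu>\<^sub>\<nu>, P\<^sup>\<mu>; 0, \<theta>\<^sub>\<nu>, 0)\<close>
  with \<open>P\<^sub>\<nu> = P\<^sub>\<nu>\<^sub>\<mu> \<theta>\<^sup>\<mu>\<close>, where \<open>\<eta>\<close> moves the frame indices.  It takes values in the
  Lie algebra of the quadratic form \<open>\<eta>\<^sub>\<mu>\<^sub>\<nu> X\<^sup>\<mu> X\<^sup>\<nu> - 2 X\<^sup>0 X\<^sup>5\<close>, which is \<open>so(3,3)\<close> for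
  metrics of signature \<open>(2,2)\<close>.  \<open>conf_conn g \<eta> \<theta> m c\<close> is the \<open>dx\<^sup>c\<close>-component.
\<close>
definition P_form :: "(real^4 \<Rightarrow> real^4^4) \<Rightarrow> (real^4 \<Rightarrow> real^4^4) \<Rightarrow> real^4 \<Rightarrow> 4 \<Rightarrow> 4 \<Rightarrow> real" where
  "P_form g \<theta> m c \<nu> = (\<Sum>b\<in>UNIV. matrix_inv (\<theta> m) $ b $ \<nu> * schouten g m b c)"

definition conf_conn ::
  "(real^4 \<Rightarrow> real^4^4) \<Rightarrow> real^4^4 \<Rightarrow> (real^4 \<Rightarrow> real^4^4) \<Rightarrow> real^4 \<Rightarrow> 4 \<Rightarrow> real^six^six" where
  "conf_conn g \<eta> \<theta> m c = (\<chi> A B. case (A, B) of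
       (Inl _, Inr (Inl \<nu>)) \<Rightarrow> P_form g \<theta> m c \<nu>
     | (Inr (Inl \<mu>), Inl _) \<Rightarrow> \<theta> m $ \<mu> $ c
     | (Inr (Inl \<mu>), Inr (Inl \<nu>)) \<Rightarrow> lc_form g \<theta> m c \<mu> \<nu>
     | (Inr (Inl \<mu>), Inr (Inr _)) \<Rightarrow> (\<Sum>\<nu>\<in>UNIV. matrix_inv \<eta> $ \<mu> $ \<nu> * P_form g \<theta> m c \<nu>)
     | (Inr (Inr _), Inr (Inl \<nu>)) \<Rightarrow> (\<Sum>\<mu>\<in>UNIV. \<eta> $ \<nu> $ \<mu> * \<theta> m $ \<mu> $ c)
     | _ \<Rightarrow> 0)"

text \<open>\<open>\<Omega> = d\<omega> + \<omega> \<and> \<omega>\<close>, coefficients \<open>\<Omega>\<^sub>a\<^sub>b\<close> in \<open>\<Omega> = 1/2 \<Omega>\<^sub>a\<^sub>b dx\<^sup>a \<and> dx\<^sup>b\<close>.\<close>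
definition curvature_form ::
  "(real^4 \<Rightarrow> 4 \<Rightarrow> real^'n^'n) \<Rightarrow> real^4 \<Rightarrow> 4 \<Rightarrow> 4 \<Rightarrow> real^'n::finite^'n" where
  "curvature_form \<omega> m a b = pd a (\<lambda>m. \<omega> m b) m - pd b (\<lambda>m. \<omega> m a) m
     + (\<omega> m a ** \<omega> m b - \<omega> m b ** \<omega> m a)"

text \<open>Coefficients of the three-form \<open>d\<Phi> + \<omega> \<and> \<Phi> - \<Phi> \<and> \<omega>\<close> for a matrix-valued two-form \<open>\<Phi>\<close>.\<close>
definition cov_ext_deriv ::
  "(real^4 \<Rightarrow> 4 \<Rightarrow> real^'n^'n) \<Rightarrow> (real^4 \<Rightarrow> 4 \<Rightarrow> 4 \<Rightarrow> real^'n^'n) \<Rightarrow>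
   real^4 \<Rightarrow> 4 \<Rightarrow> 4 \<Rightarrow> 4 \<Rightarrow> real^'n::finite^'n" where
  "cov_ext_deriv \<omega> \<Phi> m a b c =
     (pd a (\<lambda>m. \<Phi> m b c) m + pd b (\<lambda>m. \<Phi> m c a) m + pd c (\<lambda>m. \<Phi> m a b) m)
     + (\<omega> m a ** \<Phi> m b c + \<omega> m b ** \<Phi> m c a + \<omega> m c ** \<Phi> m a b)
     - (\<Phi> m a b ** \<omega> m c + \<Phi> m b c ** \<omega> m a + \<Phi> m c a ** \<omega> m b)"

subsection \<open>Baston--Mason conditions\<close>

text \<open>
  Form indices refer to the coordinate coframe \<open>dx\<^sup>a\<close>; the second condition is tensorial in
  them, hence the same in every coframe.
\<close>
definition baston_mason_on ::
  "(real^4) set \<Rightarrow> real \<Rightarrow> (real^4 \<Rightarrow> real^4^4) \<Rightarrow> real^4^4 \<Rightarrow> (real^4 \<Rightarrow> real^4^4) \<Rightarrow> bool" where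
  "baston_mason_on M s g \<eta> \<theta> \<longleftrightarrow>
     (let \<omega> = conf_conn g \<eta> \<theta>; \<Omega> = curvature_form \<omega> in
      (\<forall>m\<in>M. \<forall>a b c. cov_ext_deriv \<omega> (\<lambda>m. star s (g m) (\<Omega> m)) m a b c = 0) \<and>
      (\<forall>m\<in>M. \<forall>a b c d.
         sd_part s (g m) (\<Omega> m) a b ** asd_part s (g m) (\<Omega> m) c d
         - asd_part s (g m) (\<Omega> m) c d ** sd_part s (g m) (\<Omega> m) a b = 0))"


section \<open>Second order ODEs and their Fefferman metrics\<close>

text \<open>
  Coordinates \<open>(x, y, p)\<close> on the jet space are the components \<open>1, 2, 3\<close> of \<^typ>\<open>real^3\<close>;
  coordinates \<open>(x, y, p, \<phi>)\<close> are the components \<open>1, 2, 3, 4\<close> of \<^typ>\<open>real^4\<close>.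
\<close>
definition jet :: "real^4 \<Rightarrow> real^3" where
  "jet m = vector [m $ 1, m $ 2, m $ 3]"

definition total_D :: "(real^3 \<Rightarrow> real) \<Rightarrow> (real^3 \<Rightarrow> real) \<Rightarrow> real^3 \<Rightarrow> real" where
  "total_D Q f u = pd 1 f u + u $ 3 * pd 2 f u + Q u * pd 3 f u"

definition w1 :: "(real^3 \<Rightarrow> real) \<Rightarrow> real^3 \<Rightarrow> real" where
  "w1 Q u = (let Qy = pd 2 Q; Qp = pd 3 Q; Qyy = pd 2 Qy; Qpy = pd 2 Qp; Qpp = pd 3 Qp in
     total_D Q (total_D Q Qpp) u - 4 * total_D Q Qpy u - total_D Q Qpp u * Qp u
     + 4 * Qp u * Qpy u - 3 * Qpp u * Qy u + 6 * Qyy u)"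

definition w2 :: "(real^3 \<Rightarrow> real) \<Rightarrow> real^3 \<Rightarrow> real" where
  "w2 Q = pd 3 (pd 3 (pd 3 (pd 3 Q)))"

text \<open>
  In the following, \<open>i\<close> is the fixed nonzero real constant of the construction and \<open>\<rho>\<close> the
  conformal factor, a function of all four coordinates.
\<close>
definition inv_R :: "real \<Rightarrow> (real^4 \<Rightarrow> real) \<Rightarrow> (real^3 \<Rightarrow> real) \<Rightarrow> real^4 \<Rightarrow> real" where
  "inv_R i \<rho> Q m = - (exp (2 * i * m $ 4) / (6 * i^2 * \<rho> m ^ 4)) * w1 Q (jet m)"

definition inv_R_bar :: "real \<Rightarrow> (real^4 \<Rightarrow> real) \<Rightarrow> (real^3 \<Rightarrow> real) \<Rightarrow> real^4 \<Rightarrow> real" where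
  "inv_R_bar i \<rho> Q m = - (exp (- (2 * i * m $ 4)) / (6 * i^2 * \<rho> m ^ 4)) * w2 Q (jet m)"

abbreviation "form_dx \<equiv> (axis 1 1 :: real^4)"
abbreviation "form_dy \<equiv> (axis 2 1 :: real^4)"
abbreviation "form_dp \<equiv> (axis 3 1 :: real^4)"
abbreviation "form_dphi \<equiv> (axis 4 1 :: real^4)"

definition contact_form :: "real^4 \<Rightarrow> real^4" where
  "contact_form m = form_dy - m $ 3 *\<^sub>R form_dx"

definition sym_prod :: "real^4 \<Rightarrow> real^4 \<Rightarrow> real^4^4" where
  "sym_prod \<alpha> \<beta> = (\<chi> a b. (\<alpha> $ a * \<beta> $ b + \<beta> $ a * \<alpha> $ b) / 2)"

definition fefferman_metric ::
  "real \<Rightarrow> (real^4 \<Rightarrow> real) \<Rightarrow> (real^3 \<Rightarrow> real) \<Rightarrow> real^4 \<Rightarrow> real^4^4" where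
  "fefferman_metric i \<rho> Q m =
     (let u = jet m; Qp = pd 3 Q; Qpp = pd 3 Qp in
      (2 * (\<rho> m)^2) *\<^sub>R
        (sym_prod (form_dp - Q u *\<^sub>R form_dx) form_dx
         - sym_prod (contact_form m)
             ((2/3 * i) *\<^sub>R form_dphi + (2/3 * Qp u) *\<^sub>R form_dx
              + (1/6 * Qpp u) *\<^sub>R contact_form m)))"

text \<open>
  A point is nonsingular for a function if, near the point, the function either vanishes
  identically or has no zeros.  For a continuous function such points form a dense open set.
\<close>
definition nonsingular_pt :: "(real^4 \<Rightarrow> real) \<Rightarrow> real^4 \<Rightarrow> bool" where
  "nonsingular_pt f m \<longleftrightarrow> (\<forall>\<^sub>F n in nhds m. f n = 0) \<or> (\<forall>\<^sub>F n in nhds m. f n \<noteq> 0)"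

end

theory Submission
  imports Defs
begin

text \<open>
  In the coframe \<open>\<theta>\<^sup>1 = dx\<close>, \<open>\<theta>\<^sup>2 = dp - Q dx\<close>, \<open>\<theta>\<^sup>3 = dy - p dx\<close>,
  \<open>\<theta>\<^sup>4 = 2/3 i d\<phi> + 2/3 Q\<^sub>p dx + 1/6 Q\<^sub>p\<^sub>p \<theta>\<^sup>3\<close> the Fefferman metric is
  \<open>2 \<rho>\<^sup>2 (\<theta>\<^sup>1 \<theta>\<^sup>2 - \<theta>\<^sup>3 \<theta>\<^sup>4)\<close>.  For \<open>\<rho> = 1\<close> the normal conformal connection \<open>\<omega>\<close> in
  this coframe is explicit, with entries polynomial in \<open>p\<close> and the derivatives of \<open>Q\<close>, and a
  direct computation (\<open>curvature_\<omega>\<close>) gives its curvature as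
  \<open>N\<^sub>1 \<theta>\<^sup>1 \<and> \<theta>\<^sup>3 + N\<^sub>2 \<theta>\<^sup>2 \<and> \<theta>\<^sup>3\<close>.  The matrix \<open>N\<^sub>1\<close> is linear in \<open>w\<^sub>1\<close> and its
  \<open>p\<close>-derivative, \<open>N\<^sub>2\<close> is linear in \<open>w\<^sub>2\<close> and its first derivatives, and
  \<open>[N\<^sub>1, N\<^sub>2]\<close> is \<open>w\<^sub>1 w\<^sub>2\<close> times a constant nonzero matrix (\<open>N_commutator\<close>).

  No Christoffel symbol of the rescaled metric is ever computed.  Instead, the normal connection is
  recognized by its uniqueness: a connection that preserves the quadratic form and has the
  soldering form as first column is torsion free and metric, hence Levi-Civita in its middle block,
  as soon as the first column of its curvature vanishes; and then the trace condition on the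
  curvature forces the remaining entries to be the tensor \<open>P\<close>.  All these properties are
  transported by gauge transformations.  An explicit gauge transformation \<open>K\<close>, depending on
  \<open>\<rho>\<close> and \<open>d\<rho>\<close>, carries \<open>\<omega>\<close> to the normal connection of the Fefferman metric in the
  coordinate coframe (\<open>coord_conn_gauge\<close>), and a second one to the gauge of an arbitrary adapted
  coframe (\<open>conf_conn_gauge\<close>).

  The middle block of the curvature is the Weyl tensor, which is therefore
  \<open>\<rho>\<^sup>2/6\<close> times the sum of \<open>w\<^sub>1\<close> times the square of \<open>\<theta>\<^sup>1 \<and> \<theta>\<^sup>3\<close> and \<open>w\<^sub>2\<close> times
  the square of \<open>\<theta>\<^sup>2 \<and> \<theta>\<^sup>3\<close> (\<open>weyl_eq\<close>).  The first two-form is null and self-dual, the second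
  null and anti-self-dual, whence type N and the proportionality to the two invariants.

  For the Baston--Mason conditions only \<open>\<omega>\<close> matters.  The commutator condition says
  \<open>w\<^sub>1 w\<^sub>2 = 0\<close>.  Conversely, where \<open>w\<^sub>1\<close> or \<open>w\<^sub>2\<close> vanishes on an open set the Hodge dual of
  the curvature is minus or plus the curvature, so that the Yang-Mills equation is the Bianchi
  identity; if \<open>w\<^sub>1 w\<^sub>2 = 0\<close>, such points are dense, and continuity gives the equation everywhere
  (\<open>bach_flat\<close>).  Finally \<open>w\<^sub>1 w\<^sub>2 = 0\<close> translates into the alternative at the nonsingular points.
\<close>

section \<open>Partial derivatives\<close>

lemma pd_eqI: "(f has_derivative D) (at m) \<Longrightarrow> pd k f m = D (axis k 1)"
  unfolding pd_def by (metis frechet_derivative_at)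

lemma pd_has_derivative:
  "f differentiable (at m) \<Longrightarrow> (f has_derivative frechet_derivative f (at m)) (at m)"
  by (simp flip: frechet_derivative_works)

lemma pd_cong:
  assumes "open S" "m \<in> S" "\<And>x. x \<in> S \<Longrightarrow> f x = g x"
  shows "pd k f m = pd k g m"
proof -
  have "(f has_derivative D) (at m) \<longleftrightarrow> (g has_derivative D) (at m)" for D
    using assms by (metis has_derivative_transform_within_open)
  then show ?thesis
    unfolding pd_def frechet_derivative_def by simp
qed

lemma differentiable_cong:
  assumes "open S" "m \<in> S" "\<And>x. x \<in> S \<Longrightarrow> f x = g x" "f differentiable (at m)"
  shows "g differentiable (at m)"
  using assms by (metis differentiable_def has_derivative_transform_within_open)

lemma pd_const: "pd k (\<lambda>m. c) m = 0"
  by (rule pd_eqI[where D = "\<lambda>h. 0", simplified]) simp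

lemma pd_add:
  "f differentiable (at m) \<Longrightarrow> g differentiable (at m) \<Longrightarrow>
   pd k (\<lambda>m. f m + g m) m = pd k f m + pd k g m"
  by (rule pd_eqI[THEN trans, OF has_derivative_add[OF pd_has_derivative pd_has_derivative]])
     (simp_all add: pd_def)

lemma pd_diff:
  "f differentiable (at m) \<Longrightarrow> g differentiable (at m) \<Longrightarrow>
   pd k (\<lambda>m. f m - g m) m = pd k f m - pd k g m"
  by (rule pd_eqI[THEN trans, OF has_derivative_diff[OF pd_has_derivative pd_has_derivative]])
     (simp_all add: pd_def)

lemma pd_minus:
  "f differentiable (at m) \<Longrightarrow> pd k (\<lambda>m. - f m) m = - pd k f m"
  by (rule pd_eqI[THEN trans, OF has_derivative_minus[OF pd_has_derivative]])
     (simp_all add: pd_def)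

lemma pd_bilinear:
  assumes "bounded_bilinear B" "f differentiable (at m)" "g differentiable (at m)"
  shows "pd k (\<lambda>m. B (f m) (g m)) m = B (pd k f m) (g m) + B (f m) (pd k g m)"
  using pd_eqI[OF bounded_bilinear.FDERIV[OF assms(1) pd_has_derivative[OF assms(2)] pd_has_derivative[OF assms(3)]]]
  by (simp add: pd_def add.commute)

lemma differentiable_bilinear:
  assumes "bounded_bilinear B" "f differentiable (at m)" "g differentiable (at m)"
  shows "(\<lambda>m. B (f m) (g m)) differentiable (at m)"
  using bounded_bilinear.FDERIV[OF assms(1) pd_has_derivative[OF assms(2)] pd_has_derivative[OF assms(3)]]
  by (auto simp: differentiable_def)

lemma pd_linear:
  assumes "bounded_linear L" "f differentiable (at m)"
  shows "pd k (\<lambda>m. L (f m)) m = L (pd k f m)"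
  using pd_eqI[OF bounded_linear.has_derivative[OF assms(1) pd_has_derivative[OF assms(2)]]]
  by (simp add: pd_def)

lemma differentiable_linear:
  assumes "bounded_linear L" "f differentiable (at m)"
  shows "(\<lambda>m. L (f m)) differentiable (at m)"
  using bounded_linear.has_derivative[OF assms(1) pd_has_derivative[OF assms(2)]]
  by (auto simp: differentiable_def)

lemmas pd_mult = pd_bilinear[OF bounded_bilinear_mult]

lemma bounded_linear_axis: "bounded_linear (axis i :: 'b::real_normed_vector \<Rightarrow> 'b^'n::finite)"
proof (rule bounded_linear_intro[where K = 1])
  fix x y :: 'b and r :: real
  show "axis i (x + y) = (axis i x + axis i y :: 'b^'n)" by (vector axis_def)
  show "axis i (r *\<^sub>R x) = (r *\<^sub>R axis i x :: 'b^'n)" by (vector axis_def)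
  show "norm (axis i x :: 'b^'n) \<le> norm x * 1" by (simp add: norm_vec_def L2_set_def axis_def if_distrib[of norm] if_distrib[of "\<lambda>x. x ^ 2"] cong: if_cong)
qed

lemma vec_as_sum_axis: "v = (\<Sum>i\<in>UNIV. axis i (v $ i))" for v :: "'b::real_normed_vector^'n::finite"
  by (simp add: vec_eq_iff axis_def if_distrib cong: if_cong)

lemma differentiable_componentwise_vec:
  fixes f :: "'a::real_normed_vector \<Rightarrow> 'b::real_normed_vector^'n::finite"
  assumes "\<And>i. (\<lambda>m. f m $ i) differentiable (at m)"
  shows "f differentiable (at m)"
proof -
  have "(\<lambda>m. \<Sum>i\<in>UNIV. axis i (f m $ i)) differentiable (at m)"
    by (intro differentiable_sum ballI differentiable_linear[OF bounded_linear_axis] assms) simp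
  then show ?thesis by (simp flip: vec_as_sum_axis)
qed

lemma differentiable_vec_nth:
  "f differentiable (at m) \<Longrightarrow> (\<lambda>m. f m $ i) differentiable (at m)"
  by (rule differentiable_linear[OF bounded_linear_vec_nth])

lemma pd_vec_nth: "f differentiable (at m) \<Longrightarrow> pd k f m $ i = pd k (\<lambda>m. f m $ i) m"
  using pd_linear[OF bounded_linear_vec_nth] by metis

lemma pd_coord: "pd k (\<lambda>m. m $ j) m = (if k = j then 1 else 0)"
  using pd_eqI[OF bounded_linear_imp_has_derivative[OF bounded_linear_vec_nth], of k j m]
  by (auto simp: axis_def)

lemma differentiable_coord: "(\<lambda>m. m $ j) differentiable (at m)"
  by (metis bounded_linear_imp_differentiable bounded_linear_vec_nth)

lemma pd_inverse:
  fixes f :: "real^'n \<Rightarrow> real"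
  assumes "f differentiable (at m)" "f m \<noteq> 0"
  shows "pd k (\<lambda>m. inverse (f m)) m = - (pd k f m * (inverse (f m) * inverse (f m)))"
  using pd_eqI[OF Deriv.has_derivative_inverse[OF assms(2) pd_has_derivative[OF assms(1)]]]
  by (simp add: pd_def)

lemma differentiable_inverse_real:
  fixes f :: "real^'n \<Rightarrow> real"
  assumes "f differentiable (at m)" "f m \<noteq> 0"
  shows "(\<lambda>m. inverse (f m)) differentiable (at m)"
  using Deriv.has_derivative_inverse[OF assms(2) pd_has_derivative[OF assms(1)]]
  by (auto simp: differentiable_def)

section \<open>Smooth functions\<close>

lemma Ck_on_cong:
  assumes "open S" "\<And>x. x \<in> S \<Longrightarrow> f x = g x" "Ck_on S r f"
  shows "Ck_on S r g"
  using assms(2,3)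
proof (induction r arbitrary: f g)
  case 0
  then show ?case by (simp cong: continuous_on_cong)
next
  case (Suc r)
  have "Ck_on S r (pd k g)" for k
    using Suc.IH[of "pd k f" "pd k g"] Suc.prems pd_cong[OF assms(1)] by (metis Ck_on.simps(2))
  moreover have "g differentiable (at m)" if "m \<in> S" for m
    using Suc.prems differentiable_cong[OF assms(1) that] that by auto
  ultimately show ?case by simp
qed

lemma Ck_on_SucD: "Ck_on S (Suc r) f \<Longrightarrow> Ck_on S r f"
proof (induction r arbitrary: f)
  case 0
  then show ?case
    by (auto intro!: continuous_at_imp_continuous_on differentiable_imp_continuous_within)
next
  case (Suc r)
  then show ?case by (metis Ck_on.simps(2))
qed

lemma Ck_on_const:
  fixes S :: "(real^'n::finite) set" and c :: "'b::real_normed_vector"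
  shows "Ck_on S r (\<lambda>m. c)"
proof (induction r arbitrary: c)
  case (Suc r)
  have "pd k (\<lambda>m :: real^'n. c) = (\<lambda>m. 0)" for k by (rule ext) (rule pd_const)
  then show ?case using Suc by simp
qed simp

lemma Ck_on_add:
  assumes "open S"
  shows "Ck_on S r f \<Longrightarrow> Ck_on S r g \<Longrightarrow> Ck_on S r (\<lambda>m. f m + g m)"
proof (induction r arbitrary: f g)
  case (Suc r)
  have "Ck_on S r (pd k (\<lambda>m. f m + g m))" for k
    by (rule Ck_on_cong[OF assms _ Suc.IH[of "pd k f" "pd k g"]])
       (use Suc.prems in \<open>auto simp: pd_add\<close>)
  then show ?case using Suc.prems by (simp add: differentiable_add)
qed (simp add: continuous_on_add)

lemma Ck_on_linear:
  assumes "open S" "bounded_linear L"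
  shows "Ck_on S r f \<Longrightarrow> Ck_on S r (\<lambda>m. L (f m))"
proof (induction r arbitrary: f)
  case 0
  then show ?case by (simp add: bounded_linear.continuous_on[OF assms(2), of S f])
next
  case (Suc r)
  have "Ck_on S r (pd k (\<lambda>m. L (f m)))" for k
    by (rule Ck_on_cong[OF assms(1) _ Suc.IH[of "pd k f"]])
       (use Suc.prems in \<open>auto simp: pd_linear[OF assms(2)]\<close>)
  then show ?case using Suc.prems by (simp add: differentiable_linear[OF assms(2)])
qed

lemma Ck_on_bilinear:
  assumes "open S" "bounded_bilinear B"
  shows "Ck_on S r f \<Longrightarrow> Ck_on S r g \<Longrightarrow> Ck_on S r (\<lambda>m. B (f m) (g m))"
proof (induction r arbitrary: f g)
  case 0
  then show ?case by (simp add: bounded_bilinear.continuous_on[OF assms(2), of S f g])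
next
  case (Suc r)
  have "Ck_on S r (\<lambda>m. B (pd k f m) (g m) + B (f m) (pd k g m))" for k
    using Suc.prems Suc.prems[THEN Ck_on_SucD]
    by (intro Ck_on_add[OF assms(1) Suc.IH Suc.IH]) simp_all
  then have "Ck_on S r (pd k (\<lambda>m. B (f m) (g m)))" for k
    by (rule Ck_on_cong[OF assms(1), rotated])
       (use Suc.prems in \<open>simp add: pd_bilinear[OF assms(2)]\<close>)
  then show ?case using Suc.prems by (simp add: differentiable_bilinear[OF assms(2)])
qed

lemma Ck_on_inverse:
  fixes f :: "real^'n::finite \<Rightarrow> real"
  assumes "open S" "\<And>m. m \<in> S \<Longrightarrow> f m \<noteq> 0"
  shows "Ck_on S r f \<Longrightarrow> Ck_on S r (\<lambda>m. inverse (f m))"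
proof (induction r)
  case 0
  then show ?case using assms by (simp add: continuous_on_inverse)
next
  case (Suc r)
  have "Ck_on S r (\<lambda>m. (-1) * (pd k f m * (inverse (f m) * inverse (f m))))" for k
    using Suc.prems Ck_on_SucD[OF Suc.prems]
    by (intro Ck_on_bilinear[OF assms(1) bounded_bilinear_mult] Ck_on_const Suc.IH) auto
  then have "Ck_on S r (pd k (\<lambda>m. inverse (f m)))" for k
    by (rule Ck_on_cong[OF assms(1), rotated]) (use Suc.prems assms in \<open>auto simp: pd_inverse\<close>)
  then show ?case using Suc.prems assms by (simp add: differentiable_inverse_real)
qed

lemma Ck_on_exp:
  fixes f :: "real^'n::finite \<Rightarrow> real"
  assumes "open S"
  shows "Ck_on S r f \<Longrightarrow> Ck_on S r (\<lambda>m. exp (f m))"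
proof (induction r)
  case 0
  then show ?case by (simp add: continuous_on_exp)
next
  case (Suc r)
  have D: "((\<lambda>m. exp (f m)) has_derivative (\<lambda>h. exp (f m) * frechet_derivative f (at m) h)) (at m)"
    if "m \<in> S" for m
    using Suc.prems that by (auto intro!: derivative_eq_intros pd_has_derivative)
  have "Ck_on S r (\<lambda>m. exp (f m) * pd k f m)" for k
    using Suc.prems Ck_on_SucD[OF Suc.prems]
    by (intro Ck_on_bilinear[OF assms(1) bounded_bilinear_mult] Suc.IH) auto
  then have "Ck_on S r (pd k (\<lambda>m. exp (f m)))" for k
    by (rule Ck_on_cong[OF assms(1), rotated]) (use pd_eqI[OF D] in \<open>auto simp: pd_def\<close>)
  then show ?case using D by (auto simp: differentiable_def)
qed

lemma smooth_onI_pd: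
  "(\<And>m. m \<in> S \<Longrightarrow> f differentiable (at m)) \<Longrightarrow> (\<And>k. smooth_on S (pd k f)) \<Longrightarrow> smooth_on S f"
  unfolding smooth_on_def by (metis Ck_on.simps(2) Ck_on_SucD)

lemma smooth_on_pd: "smooth_on S f \<Longrightarrow> smooth_on S (pd k f)"
  unfolding smooth_on_def by (metis Ck_on.simps(2))

lemma smooth_on_differentiable: "smooth_on S f \<Longrightarrow> m \<in> S \<Longrightarrow> f differentiable (at m)"
  unfolding smooth_on_def by (metis Ck_on.simps(2))

lemma smooth_on_continuous_on: "smooth_on S f \<Longrightarrow> continuous_on S f"
  unfolding smooth_on_def by (metis Ck_on.simps(1))

lemma smooth_on_cong:
  "open S \<Longrightarrow> (\<And>x. x \<in> S \<Longrightarrow> f x = g x) \<Longrightarrow> smooth_on S f \<Longrightarrow> smooth_on S g"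
  unfolding smooth_on_def using Ck_on_cong by blast

lemma smooth_on_const: "smooth_on S (\<lambda>m. c)"
  by (simp add: smooth_on_def Ck_on_const)

lemma smooth_on_add:
  "open S \<Longrightarrow> smooth_on S f \<Longrightarrow> smooth_on S g \<Longrightarrow> smooth_on S (\<lambda>m. f m + g m)"
  by (simp add: smooth_on_def Ck_on_add)

lemma smooth_on_linear:
  "open S \<Longrightarrow> bounded_linear L \<Longrightarrow> smooth_on S f \<Longrightarrow> smooth_on S (\<lambda>m. L (f m))"
  by (simp add: smooth_on_def Ck_on_linear)

lemma smooth_on_bilinear:
  "open S \<Longrightarrow> bounded_bilinear B \<Longrightarrow> smooth_on S f \<Longrightarrow> smooth_on S g \<Longrightarrow> smooth_on S (\<lambda>m. B (f m) (g m))"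
  by (simp add: smooth_on_def Ck_on_bilinear)

lemma smooth_on_inverse:
  fixes f :: "real^'n::finite \<Rightarrow> real"
  shows "open S \<Longrightarrow> (\<And>m. m \<in> S \<Longrightarrow> f m \<noteq> 0) \<Longrightarrow> smooth_on S f \<Longrightarrow> smooth_on S (\<lambda>m. inverse (f m))"
  by (simp add: smooth_on_def Ck_on_inverse)

lemma smooth_on_exp:
  fixes f :: "real^'n::finite \<Rightarrow> real"
  shows "open S \<Longrightarrow> smooth_on S f \<Longrightarrow> smooth_on S (\<lambda>m. exp (f m))"
  by (simp add: smooth_on_def Ck_on_exp)

lemma smooth_on_minus: "open S \<Longrightarrow> smooth_on S f \<Longrightarrow> smooth_on S (\<lambda>m. - f m)"
  by (rule smooth_on_linear[OF _ bounded_linear_minus[OF bounded_linear_ident]])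

lemma smooth_on_diff:
  "open S \<Longrightarrow> smooth_on S f \<Longrightarrow> smooth_on S g \<Longrightarrow> smooth_on S (\<lambda>m. f m - g m)"
  using smooth_on_add[OF _ _ smooth_on_minus, of S f g] by simp

lemma smooth_on_mult:
  fixes f g :: "real^'n::finite \<Rightarrow> real"
  shows "open S \<Longrightarrow> smooth_on S f \<Longrightarrow> smooth_on S g \<Longrightarrow> smooth_on S (\<lambda>m. f m * g m)"
  by (rule smooth_on_bilinear[OF _ bounded_bilinear_mult])

lemma smooth_on_scaleR:
  "open S \<Longrightarrow> smooth_on S f \<Longrightarrow> smooth_on S g \<Longrightarrow> smooth_on S (\<lambda>m. f m *\<^sub>R g m)"
  by (rule smooth_on_bilinear[OF _ bounded_bilinear_scaleR])

lemma smooth_on_divide: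
  fixes f g :: "real^'n::finite \<Rightarrow> real"
  shows "open S \<Longrightarrow> smooth_on S f \<Longrightarrow> smooth_on S g \<Longrightarrow> (\<And>m. m \<in> S \<Longrightarrow> g m \<noteq> 0) \<Longrightarrow>
    smooth_on S (\<lambda>m. f m / g m)"
  unfolding divide_inverse by (intro smooth_on_mult smooth_on_inverse)

lemma smooth_on_power:
  fixes f :: "real^'n::finite \<Rightarrow> real"
  shows "open S \<Longrightarrow> smooth_on S f \<Longrightarrow> smooth_on S (\<lambda>m. f m ^ n)"
  by (induction n) (simp_all add: smooth_on_const smooth_on_mult)

lemma smooth_on_sum:
  "open S \<Longrightarrow> (\<And>i. i \<in> I \<Longrightarrow> smooth_on S (f i)) \<Longrightarrow> smooth_on S (\<lambda>m. \<Sum>i\<in>I. f i m)"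
  by (induction I rule: infinite_finite_induct) (simp_all add: smooth_on_const smooth_on_add)

lemma smooth_on_prod:
  fixes f :: "'i \<Rightarrow> real^'n::finite \<Rightarrow> real"
  shows "open S \<Longrightarrow> (\<And>i. i \<in> I \<Longrightarrow> smooth_on S (f i)) \<Longrightarrow> smooth_on S (\<lambda>m. \<Prod>i\<in>I. f i m)"
  by (induction I rule: infinite_finite_induct) (simp_all add: smooth_on_const smooth_on_mult)

lemma smooth_on_vec_nth: "open S \<Longrightarrow> smooth_on S f \<Longrightarrow> smooth_on S (\<lambda>m. f m $ i)"
  by (rule smooth_on_linear[OF _ bounded_linear_vec_nth])

lemma smooth_on_componentwise:
  fixes f :: "real^'k::finite \<Rightarrow> 'b::real_normed_vector^'n::finite"
  assumes "open S" "\<And>i. smooth_on S (\<lambda>m. f m $ i)"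
  shows "smooth_on S f"
proof -
  have "smooth_on S (\<lambda>m. \<Sum>i\<in>UNIV. axis i (f m $ i))"
    by (intro smooth_on_sum assms smooth_on_linear[OF assms(1) bounded_linear_axis])
  then show ?thesis by (simp flip: vec_as_sum_axis)
qed

lemma smooth_on_coord: "smooth_on S (\<lambda>m. m $ j)"
proof (rule smooth_onI_pd)
  have "pd k (\<lambda>m. m $ j) = (\<lambda>m. if k = j then 1 else 0)" for k
    using pd_coord by blast
  then show "smooth_on S (pd k (\<lambda>m. m $ j))" for k by (simp add: smooth_on_const)
qed (rule differentiable_coord)

lemma bounded_bilinear_matrix_mult:
  "bounded_bilinear ((**) :: real^'n^'m \<Rightarrow> real^'k^'n \<Rightarrow> real^'k^'m)"
  by (rule bilinear_conv_bounded_bilinear[THEN iffD1])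
     (auto simp: bilinear_def linear_iff vec_eq_iff matrix_matrix_mult_def
        algebra_simps sum.distrib sum_distrib_left)

lemma smooth_on_matrix_mult:
  fixes A :: "real^'n::finite \<Rightarrow> real^'i::finite^'j::finite" and B :: "real^'n \<Rightarrow> real^'k::finite^'i"
  shows "open S \<Longrightarrow> smooth_on S A \<Longrightarrow> smooth_on S B \<Longrightarrow> smooth_on S (\<lambda>m. A m ** B m)"
  by (rule smooth_on_bilinear[OF _ bounded_bilinear_matrix_mult])


lemma invertible_imp_det_nonzero: "invertible A \<Longrightarrow> det A \<noteq> 0" for A :: "real^'n^'n"
  using invertible_det_nz by blast

lemma
  fixes A :: "'a::semiring_1^'n^'m"
  assumes "invertible A"
  shows matrix_inv_right: "A ** matrix_inv A = mat 1" and matrix_inv_left: "matrix_inv A ** A = mat 1"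
  using someI_ex[OF assms[unfolded invertible_def]] by (simp_all add: matrix_inv_def)

lemma matrix_inv_unique:
  fixes A B :: "real^'n::finite^'n"
  assumes "A ** B = mat 1"
  shows "invertible A" "matrix_inv A = B"
proof -
  have "B ** A = mat 1" using assms matrix_left_right_inverse by blast
  then show i: "invertible A" using assms invertible_def by blast
  show "matrix_inv A = B"
    using assms matrix_inv_left[OF i] by (metis matrix_mul_assoc matrix_mul_lid matrix_mul_rid)
qed

text \<open>Cramer's rule exhibits the entries of the inverse as rational functions of the matrix.\<close>
lemma matrix_inv_cramer:
  fixes A :: "real^'n::finite^'n"
  assumes "invertible A"
  shows "matrix_inv A $ k $ l =
    det (\<chi> i j. if j = k then (axis l 1 :: real^'n) $ i else A $ i $ j) * inverse (det A)"
proof -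
  have "A *v (matrix_inv A *v axis l 1) = axis l 1"
    using matrix_inv_right[OF assms] by (simp add: matrix_vector_mul_assoc)
  then have "matrix_inv A *v axis l 1 =
      (\<chi> k. det (\<chi> i j. if j = k then (axis l 1 :: real^'n) $ i else A $ i $ j) / det A)"
    using cramer[OF invertible_imp_det_nonzero[OF assms]] by blast
  moreover have "(matrix_inv A *v axis l 1) $ k = matrix_inv A $ k $ l"
    by (simp add: matrix_vector_mult_basis column_def)
  ultimately show ?thesis by (simp add: divide_inverse)
qed

lemma smooth_on_det:
  fixes A :: "real^'k::finite \<Rightarrow> real^'n::finite^'n"
  assumes "open S" "\<And>i j. smooth_on S (\<lambda>m. A m $ i $ j)"
  shows "smooth_on S (\<lambda>m. det (A m))"
  unfolding det_def
  by (intro smooth_on_sum smooth_on_mult smooth_on_const smooth_on_prod assms)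

lemma smooth_on_matrix_inv:
  fixes A :: "real^'k::finite \<Rightarrow> real^'n::finite^'n"
  assumes "open S" "smooth_on S A" "\<And>m. m \<in> S \<Longrightarrow> invertible (A m)"
  shows "smooth_on S (\<lambda>m. matrix_inv (A m))"
proof (intro smooth_on_componentwise assms)
  fix k l
  have A: "smooth_on S (\<lambda>m. A m $ i $ j)" for i j
    by (intro smooth_on_vec_nth assms)
  have "smooth_on S (\<lambda>m. det (\<chi> i j. if j = k then (axis l 1 :: real^'n) $ i else A m $ i $ j)
      * inverse (det (A m)))"
  proof (intro smooth_on_mult smooth_on_inverse smooth_on_det assms(1) invertible_imp_det_nonzero assms(3) A)
    show "smooth_on S (\<lambda>m. (\<chi> i j. if j = k then (axis l 1 :: real^'n) $ i else A m $ i $ j) $ i $ j)" for i j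
      by (cases "j = k") (simp_all add: smooth_on_const A)
  qed
  then show "smooth_on S (\<lambda>m. matrix_inv (A m) $ k $ l)"
    by (rule smooth_on_cong[OF assms(1), rotated]) (simp add: matrix_inv_cramer assms(3))
qed

section \<open>Symmetry of second derivatives\<close>

lemma pd_along_line:
  fixes f :: "real^'n::finite \<Rightarrow> real"
  assumes "f differentiable (at (x + s *\<^sub>R axis a 1))"
  shows "((\<lambda>s. f (x + s *\<^sub>R axis a 1)) has_real_derivative pd a f (x + s *\<^sub>R axis a 1)) (at s)"
proof -
  let ?y = "x + s *\<^sub>R axis a 1"
  have "((\<lambda>s. f (x + s *\<^sub>R axis a 1)) has_derivative
      (\<lambda>h. frechet_derivative f (at ?y) (h *\<^sub>R axis a 1))) (at s)"
    by (rule has_derivative_compose[of "\<lambda>s. x + s *\<^sub>R axis a 1", OF _ pd_has_derivative[OF assms]])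
       (auto intro!: derivative_eq_intros)
  moreover have "frechet_derivative f (at ?y) (h *\<^sub>R axis a 1) = pd a f ?y * h" for h
    using linear_cmul[OF linear_frechet_derivative[OF assms]] by (simp add: pd_def)
  ultimately show ?thesis by (simp add: has_field_derivative_def)
qed

text \<open>
  The second difference quotient is a value of either mixed derivative arbitrarily close to
  the base point, by the mean value theorem in one variable and then in the other.
\<close>
lemma second_difference_mvt:
  fixes f :: "real^'n::finite \<Rightarrow> real" and a b :: 'n
  assumes h: "h > 0" and ball: "ball x (3 * h) \<subseteq> S" and C: "Ck_on S 2 f"
  defines "u \<equiv> axis a 1 :: real^'n" and "v \<equiv> axis b 1 :: real^'n"
  shows "\<exists>y\<in>ball x (3 * h). f (x + h *\<^sub>R u + h *\<^sub>R v) - f (x + h *\<^sub>R u) - f (x + h *\<^sub>R v) + f x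
            = h\<^sup>2 * pd b (pd a f) y"
proof -
  have near: "x + s *\<^sub>R u + t *\<^sub>R v \<in> ball x (3 * h)" if "\<bar>s\<bar> \<le> h" "\<bar>t\<bar> \<le> h" for s t
  proof -
    have "norm (s *\<^sub>R u + t *\<^sub>R v) \<le> \<bar>s\<bar> + \<bar>t\<bar>"
      by (rule order_trans[OF norm_triangle_ineq]) (simp add: u_def v_def)
    then have "norm (s *\<^sub>R u + t *\<^sub>R v) < 3 * h" using that h by linarith
    moreover have "dist x (x + s *\<^sub>R u + t *\<^sub>R v) = norm (s *\<^sub>R u + t *\<^sub>R v)"
      unfolding add.assoc dist_norm by (subst norm_minus_commute) simp
    ultimately show ?thesis by simp
  qed
  have diff: "g differentiable (at y)" if "g = f \<or> g = pd a f" "y \<in> ball x (3 * h)" for g y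
    using C that ball by (auto simp: numeral_2_eq_2)
  let ?F = "\<lambda>s. f (x + h *\<^sub>R v + s *\<^sub>R u) - f (x + s *\<^sub>R u)"
  let ?F' = "\<lambda>s. pd a f (x + h *\<^sub>R v + s *\<^sub>R u) - pd a f (x + s *\<^sub>R u)"
  have F: "(?F has_real_derivative ?F' s) (at s)" if "0 \<le> s" "s \<le> h" for s
    unfolding u_def using near[of s h] near[of s 0] that h
    by (intro DERIV_diff pd_along_line diff) (auto simp: u_def algebra_simps)
  obtain \<xi> where \<xi>: "0 < \<xi>" "\<xi> < h" "?F h - ?F 0 = (h - 0) * ?F' \<xi>"
    using MVT2[OF h F] by auto
  let ?G = "\<lambda>t. pd a f (x + \<xi> *\<^sub>R u + t *\<^sub>R v)"
  have G: "(?G has_real_derivative pd b (pd a f) (x + \<xi> *\<^sub>R u + t *\<^sub>R v)) (at t)"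
    if "0 \<le> t" "t \<le> h" for t
    unfolding v_def using near[of \<xi> t] that \<xi>
    by (intro pd_along_line diff) (auto simp: v_def)
  obtain \<zeta> where \<zeta>: "0 < \<zeta>" "\<zeta> < h"
      "?G h - ?G 0 = (h - 0) * pd b (pd a f) (x + \<xi> *\<^sub>R u + \<zeta> *\<^sub>R v)"
    using MVT2[OF h G] by auto
  show ?thesis
  proof (rule bexI)
    show "x + \<xi> *\<^sub>R u + \<zeta> *\<^sub>R v \<in> ball x (3 * h)"
      using near[of \<xi> \<zeta>] \<xi> \<zeta> by simp
    have "?F' \<xi> = ?G h - ?G 0" by (simp add: algebra_simps)
    then have "?F h - ?F 0 = h * (h * pd b (pd a f) (x + \<xi> *\<^sub>R u + \<zeta> *\<^sub>R v))"
      using \<xi>(3) \<zeta>(3) by simp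
    then show "f (x + h *\<^sub>R u + h *\<^sub>R v) - f (x + h *\<^sub>R u) - f (x + h *\<^sub>R v) + f x
        = h\<^sup>2 * pd b (pd a f) (x + \<xi> *\<^sub>R u + \<zeta> *\<^sub>R v)"
      by (simp add: power2_eq_square algebra_simps)
  qed
qed

lemma pd_commute_real:
  fixes f :: "real^'n::finite \<Rightarrow> real"
  assumes S: "open S" "x \<in> S" and C: "Ck_on S 2 f"
  shows "pd a (pd b f) x = pd b (pd a f) x"
proof (rule ccontr)
  assume ne: "pd a (pd b f) x \<noteq> pd b (pd a f) x"
  define e where "e = \<bar>pd a (pd b f) x - pd b (pd a f) x\<bar> / 2"
  have e: "e > 0" using ne by (simp add: e_def)
  have cont: "isCont (pd k (pd l f)) x" for k l
    using C S by (auto simp: numeral_2_eq_2 continuous_on_eq_continuous_at)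
  obtain d1 where d1: "d1 > 0" "\<And>y. dist y x < d1 \<Longrightarrow> \<bar>pd a (pd b f) y - pd a (pd b f) x\<bar> < e"
    using cont[of a b] e unfolding continuous_at_eps_delta dist_real_def by blast
  obtain d2 where d2: "d2 > 0" "\<And>y. dist y x < d2 \<Longrightarrow> \<bar>pd b (pd a f) y - pd b (pd a f) x\<bar> < e"
    using cont[of b a] e unfolding continuous_at_eps_delta dist_real_def by blast
  obtain d3 where d3: "d3 > 0" "ball x d3 \<subseteq> S"
    using S by (meson openE)
  define h where "h = min d1 (min d2 d3) / 3"
  have h: "h > 0" "3 * h \<le> d1" "3 * h \<le> d2" "3 * h \<le> d3" using d1 d2 d3 by (auto simp: h_def)
  then have b: "ball x (3 * h) \<subseteq> S" using d3 by (meson subset_ball subset_trans)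
  obtain y where y: "y \<in> ball x (3 * h)" "f (x + h *\<^sub>R axis a 1 + h *\<^sub>R axis b 1) - f (x + h *\<^sub>R axis a 1)
      - f (x + h *\<^sub>R axis b 1) + f x = h\<^sup>2 * pd b (pd a f) y"
    using second_difference_mvt[OF h(1) b C] by blast
  obtain z where z: "z \<in> ball x (3 * h)" "f (x + h *\<^sub>R axis b 1 + h *\<^sub>R axis a 1) - f (x + h *\<^sub>R axis b 1)
      - f (x + h *\<^sub>R axis a 1) + f x = h\<^sup>2 * pd a (pd b f) z"
    using second_difference_mvt[OF h(1) b C] by blast
  have swap: "x + h *\<^sub>R axis b 1 + h *\<^sub>R axis a 1 = x + h *\<^sub>R axis a 1 + h *\<^sub>R axis b 1"
    by (simp add: algebra_simps)
  have "h\<^sup>2 * pd b (pd a f) y = h\<^sup>2 * pd a (pd b f) z"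
    using y(2) z(2) unfolding swap by linarith
  then have eq: "pd b (pd a f) y = pd a (pd b f) z" using h(1) by simp
  have "\<bar>pd b (pd a f) y - pd b (pd a f) x\<bar> < e" "\<bar>pd a (pd b f) z - pd a (pd b f) x\<bar> < e"
    using d1 d2 y(1) z(1) h by (auto simp: dist_commute)
  then show False using eq e_def by (auto simp: abs_if split: if_splits)
qed

lemma smooth_on_pd_commute_real:
  fixes f :: "real^'n::finite \<Rightarrow> real"
  shows "open S \<Longrightarrow> smooth_on S f \<Longrightarrow> x \<in> S \<Longrightarrow> pd a (pd b f) x = pd b (pd a f) x"
  by (rule pd_commute_real) (auto simp: smooth_on_def)

lemma smooth_on_pd_commute:
  fixes f :: "real^'n::finite \<Rightarrow> real^'i::finite^'j::finite"
  assumes S: "open S" and f: "smooth_on S f" and x: "x \<in> S"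
  shows "pd a (pd b f) x = pd b (pd a f) x"
proof -
  have *: "pd a (pd b f) x $ k $ l = pd a (pd b (\<lambda>m. f m $ k $ l)) x" for a b k l
  proof -
    have "pd a (pd b f) x $ k $ l = pd a (\<lambda>m. pd b f m $ k $ l) x"
      using smooth_on_differentiable[OF smooth_on_pd[OF f] x, of b]
      by (simp add: pd_vec_nth differentiable_vec_nth)
    also have "\<dots> = pd a (pd b (\<lambda>m. f m $ k $ l)) x"
      by (rule pd_cong[OF S x])
         (use smooth_on_differentiable[OF f] in \<open>simp add: pd_vec_nth differentiable_vec_nth\<close>)
    finally show ?thesis .
  qed
  show ?thesis
    by (simp add: vec_eq_iff *)
       (metis smooth_on_pd_commute_real[OF S _ x] smooth_on_vec_nth[OF S] f)
qed

section \<open>Functions on the jet space\<close>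

lemma bounded_linear_jet: "bounded_linear jet"
proof -
  have "linear jet"
    by (auto simp: linear_iff jet_def vec_eq_iff forall_3)
  then show ?thesis by (simp add: linear_conv_bounded_linear)
qed

lemma jet_nth: "jet m $ 1 = m $ 1" "jet m $ 2 = m $ 2" "jet m $ 3 = m $ 3"
  by (simp_all add: jet_def)

lemma jet_axis:
  "jet (axis 1 1) = axis 1 1" "jet (axis 2 1) = axis 2 1"
  "jet (axis 3 1) = axis 3 1" "jet (axis 4 1) = 0"
  by (auto simp: vec_eq_iff forall_3 jet_nth axis_def)

lemma open_jet_image: "open M \<Longrightarrow> open (jet ` M)"
proof (rule open_surjective_linear_image)
  show "linear jet" using bounded_linear_jet by (simp add: bounded_linear.linear)
  have "jet (vector [u $ 1, u $ 2, u $ 3, 0]) = u" for u :: "real^3"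
    by (simp add: vec_eq_iff forall_3 jet_nth vector_def)
  then show "surj jet" by (metis surj_def)
qed simp

lemma
  assumes "F differentiable (at (jet m))"
  shows differentiable_jet: "(\<lambda>m. F (jet m)) differentiable (at m)"
    and pd_jet: "pd 1 (\<lambda>m. F (jet m)) m = pd 1 F (jet m)" "pd 2 (\<lambda>m. F (jet m)) m = pd 2 F (jet m)"
      "pd 3 (\<lambda>m. F (jet m)) m = pd 3 F (jet m)" "pd 4 (\<lambda>m. F (jet m)) m = 0"
proof -
  have D: "((\<lambda>m. F (jet m)) has_derivative (\<lambda>h. frechet_derivative F (at (jet m)) (jet h))) (at m)"
    by (rule has_derivative_compose[OF bounded_linear_imp_has_derivative[OF bounded_linear_jet]
          pd_has_derivative[OF assms]])
  show "(\<lambda>m. F (jet m)) differentiable (at m)" using D by (auto simp: differentiable_def)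
  show "pd 1 (\<lambda>m. F (jet m)) m = pd 1 F (jet m)" "pd 2 (\<lambda>m. F (jet m)) m = pd 2 F (jet m)"
    "pd 3 (\<lambda>m. F (jet m)) m = pd 3 F (jet m)" "pd 4 (\<lambda>m. F (jet m)) m = 0"
    using pd_eqI[OF D] linear_0[OF linear_frechet_derivative[OF assms]]
    by (simp_all add: pd_def jet_axis)
qed

lemma Ck_on_jet:
  assumes "open M"
  shows "Ck_on (jet ` M) r F \<Longrightarrow> Ck_on M r (\<lambda>m. F (jet m))"
proof (induction r arbitrary: F)
  case 0
  then show ?case
    using continuous_on_compose2[OF _ linear_continuous_on[OF bounded_linear_jet], of "jet ` M" F M]
    by simp
next
  case (Suc r)
  have d: "F differentiable (at (jet m))" if "m \<in> M" for m using Suc.prems that by simp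
  have IH: "Ck_on M r (\<lambda>m. pd k F (jet m))" for k using Suc by simp
  have "Ck_on M r (pd k (\<lambda>m. F (jet m)))" for k
  proof -
    consider "k = 1" | "k = 2" | "k = 3" | "k = 4" using exhaust_4 by blast
    then show ?thesis
    proof cases
      case 4
      show ?thesis
        by (rule Ck_on_cong[OF assms _ Ck_on_const[where c = 0]]) (simp add: 4 pd_jet d)
    qed (rule Ck_on_cong[OF assms _ IH], simp add: pd_jet d)+
  qed
  then show ?case using d by (simp add: differentiable_jet)
qed

lemma smooth_on_jet: "open M \<Longrightarrow> smooth_on (jet ` M) F \<Longrightarrow> smooth_on M (\<lambda>m. F (jet m))"
  by (simp add: smooth_on_def Ck_on_jet)

section \<open>Gauge transformations of matrix-valued connections\<close>

lemmas matrix_bilinear_simps =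
  bounded_bilinear.add_left[OF bounded_bilinear_matrix_mult]
  bounded_bilinear.add_right[OF bounded_bilinear_matrix_mult]
  bounded_bilinear.diff_left[OF bounded_bilinear_matrix_mult]
  bounded_bilinear.diff_right[OF bounded_bilinear_matrix_mult]
  bounded_bilinear.minus_left[OF bounded_bilinear_matrix_mult]
  bounded_bilinear.minus_right[OF bounded_bilinear_matrix_mult]
  bounded_bilinear.zero_left[OF bounded_bilinear_matrix_mult]
  bounded_bilinear.zero_right[OF bounded_bilinear_matrix_mult]
  bounded_bilinear.scaleR_left[OF bounded_bilinear_matrix_mult]
  bounded_bilinear.scaleR_right[OF bounded_bilinear_matrix_mult]

lemmas pd_matrix_mult = pd_bilinear[OF bounded_bilinear_matrix_mult]
lemmas differentiable_matrix_mult = differentiable_bilinear[OF bounded_bilinear_matrix_mult]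

text \<open>
  The connection \<open>\<omega>'\<close> is \<open>h \<omega> h\<^sup>-\<^sup>1 - dh h\<^sup>-\<^sup>1\<close>; multiplied by \<open>h\<close> from the right, so that no
  inverse is needed.
\<close>
definition gauge_related ::
  "(real^4) set \<Rightarrow> (real^4 \<Rightarrow> 4 \<Rightarrow> real^'n::finite^'n) \<Rightarrow> (real^4 \<Rightarrow> real^'n^'n) \<Rightarrow>
   (real^4 \<Rightarrow> 4 \<Rightarrow> real^'n^'n) \<Rightarrow> bool" where
  "gauge_related M \<omega>' h \<omega> \<longleftrightarrow> (\<forall>m\<in>M. \<forall>c. \<omega>' m c ** h m + pd c h m = h m ** \<omega> m c)"

lemma gauge_related_trans:
  assumes "gauge_related M \<omega>'' h' \<omega>'" "gauge_related M \<omega>' h \<omega>"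
    and "\<And>m. m \<in> M \<Longrightarrow> h differentiable (at m)" "\<And>m. m \<in> M \<Longrightarrow> h' differentiable (at m)"
  shows "gauge_related M \<omega>'' (\<lambda>m. h' m ** h m) \<omega>"
  unfolding gauge_related_def
proof (intro ballI allI)
  fix m c assume m: "m \<in> M"
  have 1: "\<omega>'' m c ** h' m + pd c h' m = h' m ** \<omega>' m c"
    and 2: "\<omega>' m c ** h m + pd c h m = h m ** \<omega> m c"
    using assms(1,2) m by (auto simp: gauge_related_def)
  have "\<omega>'' m c ** (h' m ** h m) + pd c (\<lambda>m. h' m ** h m) m
      = (\<omega>'' m c ** h' m + pd c h' m) ** h m + h' m ** pd c h m"
    using assms(3,4)[OF m] by (simp add: pd_matrix_mult matrix_mul_assoc matrix_bilinear_simps)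
  also have "\<dots> = h' m ** (\<omega>' m c ** h m + pd c h m)"
    unfolding 1 by (simp add: matrix_mul_assoc matrix_bilinear_simps)
  finally show "\<omega>'' m c ** (h' m ** h m) + pd c (\<lambda>m. h' m ** h m) m = h' m ** h m ** \<omega> m c"
    unfolding 2 by (simp add: matrix_mul_assoc)
qed

text \<open>Gauge transformations conjugate the curvature.\<close>
lemma curvature_form_gauge:
  assumes M: "open M" "m \<in> M" and rel: "gauge_related M \<omega>' h \<omega>" and h: "smooth_on M h"
    and d': "\<And>c. (\<lambda>m. \<omega>' m c) differentiable (at m)" and d: "\<And>c. (\<lambda>m. \<omega> m c) differentiable (at m)"
  shows "curvature_form \<omega>' m a b ** h m = h m ** curvature_form \<omega> m a b"
proof -
  have R: "\<omega>' m c ** h m = h m ** \<omega> m c - pd c h m" for c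
    using rel M(2) by (auto simp: gauge_related_def algebra_simps)
  have dh: "h differentiable (at m)" "pd c h differentiable (at m)" for c
    using h M(2) smooth_on_pd smooth_on_differentiable by blast+
  have E: "pd a (\<lambda>m. \<omega>' m b) m ** h m =
      pd a h m ** \<omega> m b + h m ** pd a (\<lambda>m. \<omega> m b) m - \<omega>' m b ** pd a h m - pd a (pd b h) m" for a b
  proof -
    have "pd a (\<lambda>m. \<omega>' m b ** h m + pd b h m) m = pd a (\<lambda>m. h m ** \<omega> m b) m"
      by (rule pd_cong[OF M]) (use rel in \<open>simp add: gauge_related_def\<close>)
    then show ?thesis
      using dh d d' by (simp add: pd_add pd_matrix_mult differentiable_matrix_mult algebra_simps)
  qed
  have Q: "\<omega>' m a ** \<omega>' m b ** h m = h m ** \<omega> m a ** \<omega> m b - pd a h m ** \<omega> m b - \<omega>' m a ** pd b h m" for a b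
  proof -
    have "\<omega>' m a ** \<omega>' m b ** h m = \<omega>' m a ** (h m ** \<omega> m b - pd b h m)"
      by (simp only: R flip: matrix_mul_assoc)
    also have "\<dots> = \<omega>' m a ** h m ** \<omega> m b - \<omega>' m a ** pd b h m"
      by (simp only: matrix_bilinear_simps matrix_mul_assoc)
    finally show ?thesis by (simp only: R matrix_bilinear_simps)
  qed
  have "pd a (pd b h) m = pd b (pd a h) m"
    by (rule smooth_on_pd_commute[OF M(1) h M(2)])
  then show ?thesis
    by (simp add: curvature_form_def matrix_bilinear_simps E Q matrix_mul_assoc)
qed

lemma cov_ext_deriv_gauge:
  assumes M: "open M" "m \<in> M" and rel: "gauge_related M \<omega>' h \<omega>" and h: "h differentiable (at m)"
    and \<Phi>: "\<And>m a b. m \<in> M \<Longrightarrow> \<Phi>' m a b ** h m = h m ** \<Phi> m a b"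
    and d': "\<And>a b. (\<lambda>m. \<Phi>' m a b) differentiable (at m)" and d: "\<And>a b. (\<lambda>m. \<Phi> m a b) differentiable (at m)"
  shows "cov_ext_deriv \<omega>' \<Phi>' m a b c ** h m = h m ** cov_ext_deriv \<omega> \<Phi> m a b c"
proof -
  have R: "\<omega>' m c ** h m = h m ** \<omega> m c - pd c h m" for c
    using rel M(2) by (auto simp: gauge_related_def algebra_simps)
  have E: "pd a (\<lambda>m. \<Phi>' m b c) m ** h m =
      pd a h m ** \<Phi> m b c + h m ** pd a (\<lambda>m. \<Phi> m b c) m - \<Phi>' m b c ** pd a h m" for a b c
  proof -
    have "pd a (\<lambda>m. \<Phi>' m b c ** h m) m = pd a (\<lambda>m. h m ** \<Phi> m b c) m"
      by (rule pd_cong[OF M]) (use \<Phi> in simp)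
    then show ?thesis using h d d' by (simp add: pd_matrix_mult algebra_simps)
  qed
  have 1: "\<omega>' m a ** \<Phi>' m b c ** h m = h m ** \<omega> m a ** \<Phi> m b c - pd a h m ** \<Phi> m b c" for a b c
    using \<Phi>[OF M(2)] R by (metis matrix_mul_assoc bounded_bilinear.diff_left[OF bounded_bilinear_matrix_mult])
  have 2: "\<Phi>' m b c ** \<omega>' m a ** h m = h m ** \<Phi> m b c ** \<omega> m a - \<Phi>' m b c ** pd a h m" for a b c
    using \<Phi>[OF M(2)] R by (metis matrix_mul_assoc bounded_bilinear.diff_right[OF bounded_bilinear_matrix_mult])
  show ?thesis
    by (simp add: cov_ext_deriv_def matrix_bilinear_simps E 1 2 matrix_mul_assoc)
qed

lemma bianchi_identity:
  assumes M: "open M" "m \<in> M" and \<omega>: "\<And>c. smooth_on M (\<lambda>m. \<omega> m c)"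
  shows "cov_ext_deriv \<omega> (curvature_form \<omega>) m a b c = 0"
proof -
  have d: "(\<lambda>m. \<omega> m c) differentiable (at m)" "pd a (\<lambda>m. \<omega> m c) differentiable (at m)" for a c
    using \<omega> M(2) smooth_on_pd smooth_on_differentiable by blast+
  have D: "pd a (\<lambda>m. curvature_form \<omega> m b c) m =
      pd a (pd b (\<lambda>m. \<omega> m c)) m - pd a (pd c (\<lambda>m. \<omega> m b)) m
      + (pd a (\<lambda>m. \<omega> m b) m ** \<omega> m c + \<omega> m b ** pd a (\<lambda>m. \<omega> m c) m
         - (pd a (\<lambda>m. \<omega> m c) m ** \<omega> m b + \<omega> m c ** pd a (\<lambda>m. \<omega> m b) m))" for a b c
    unfolding curvature_form_def
    using d by (simp add: pd_add pd_diff pd_matrix_mult differentiable_matrix_mult)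
  have C: "pd a (pd b (\<lambda>m. \<omega> m c)) m = pd b (pd a (\<lambda>m. \<omega> m c)) m" for a b c
    by (rule smooth_on_pd_commute[OF M(1) \<omega> M(2)])
  show ?thesis
    unfolding cov_ext_deriv_def D C[of b a] C[of c a] C[of c b]
    by (simp add: curvature_form_def matrix_bilinear_simps matrix_mul_assoc)
qed

lemma cov_ext_deriv_cong:
  assumes "open S" "m \<in> S" "\<And>m a b. m \<in> S \<Longrightarrow> \<Phi> m a b = \<Psi> m a b"
  shows "cov_ext_deriv \<omega> \<Phi> m a b c = cov_ext_deriv \<omega> \<Psi> m a b c"
proof -
  have "pd a (\<lambda>m. \<Phi> m b c) m = pd a (\<lambda>m. \<Psi> m b c) m" for a b c
    by (rule pd_cong[OF assms(1,2)]) (rule assms(3))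
  then show ?thesis using assms(2,3) by (simp add: cov_ext_deriv_def)
qed

lemma cov_ext_deriv_minus:
  assumes "\<And>a b. (\<lambda>m. \<Phi> m a b) differentiable (at m)"
  shows "cov_ext_deriv \<omega> (\<lambda>m a b. - \<Phi> m a b) m a b c = - cov_ext_deriv \<omega> \<Phi> m a b c"
  using assms by (simp add: cov_ext_deriv_def pd_minus matrix_bilinear_simps)

lemma star_linear:
  assumes "linear L"
  shows "star s G (\<lambda>a b. L (F a b)) a b = L (star s G F a b)"
  using assms by (simp add: star_def linear_scale linear_sum)

lemma star_add: "star s G (\<lambda>a b. F a b + H a b) a b = star s G F a b + star s G H a b"
  by (simp add: star_def scaleR_add_right sum.distrib)

section \<open>Block matrices of the 1 + 4 + 1 decomposition\<close>

text \<open>The matrix \<open>v r\<^sup>T\<close>.\<close>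
definition outer :: "real^4 \<Rightarrow> real^4 \<Rightarrow> real^4^4" where
  "outer v r = (\<chi> i j. v $ i * r $ j)"

text \<open>
  The matrix with rows of blocks \<open>(a, r, b)\<close>, \<open>(v, A, w)\<close>, \<open>(c, s, d)\<close>; the vectors \<open>r\<close> and \<open>s\<close>
  stand for rows, \<open>v\<close> and \<open>w\<close> for columns.
\<close>
definition blk ::
  "real \<Rightarrow> real^4 \<Rightarrow> real \<Rightarrow> real^4 \<Rightarrow> real^4^4 \<Rightarrow> real^4 \<Rightarrow> real \<Rightarrow> real^4 \<Rightarrow> real \<Rightarrow> real^six^six" where
  "blk a r b v A w c s d = (\<chi> X Y. case X of
       Inl _ \<Rightarrow> (case Y of Inl _ \<Rightarrow> a | Inr (Inl \<nu>) \<Rightarrow> r $ \<nu> | Inr (Inr _) \<Rightarrow> b)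
     | Inr (Inl \<mu>) \<Rightarrow> (case Y of Inl _ \<Rightarrow> v $ \<mu> | Inr (Inl \<nu>) \<Rightarrow> A $ \<mu> $ \<nu> | Inr (Inr _) \<Rightarrow> w $ \<mu>)
     | Inr (Inr _) \<Rightarrow> (case Y of Inl _ \<Rightarrow> c | Inr (Inl \<nu>) \<Rightarrow> s $ \<nu> | Inr (Inr _) \<Rightarrow> d))"

lemma blk_nth:
  "blk a r b v A w c s d $ Inl x $ Inl x' = a"
  "blk a r b v A w c s d $ Inl x $ Inr (Inl \<nu>) = r $ \<nu>"
  "blk a r b v A w c s d $ Inl x $ Inr (Inr y) = b"
  "blk a r b v A w c s d $ Inr (Inl \<mu>) $ Inl x' = v $ \<mu>"
  "blk a r b v A w c s d $ Inr (Inl \<mu>) $ Inr (Inl \<nu>) = A $ \<mu> $ \<nu>"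
  "blk a r b v A w c s d $ Inr (Inl \<mu>) $ Inr (Inr y) = w $ \<mu>"
  "blk a r b v A w c s d $ Inr (Inr z) $ Inl x' = c"
  "blk a r b v A w c s d $ Inr (Inr z) $ Inr (Inl \<nu>) = s $ \<nu>"
  "blk a r b v A w c s d $ Inr (Inr z) $ Inr (Inr y) = d"
  by (simp_all add: blk_def)

lemma six_cases:
  fixes X :: six
  obtains "X = Inl ()" | \<mu> where "X = Inr (Inl \<mu>)" | "X = Inr (Inr ())"
proof (cases X)
  case (Inr Y)
  then show ?thesis using that by (cases Y) auto
qed (use that in auto)

lemma all_six: "(\<forall>X::six. P X) \<longleftrightarrow> P (Inl ()) \<and> (\<forall>\<mu>. P (Inr (Inl \<mu>))) \<and> P (Inr (Inr ()))"
  by (metis six_cases)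

lemma sum_six: "(\<Sum>X\<in>(UNIV::six set). f X) = f (Inl ()) + (\<Sum>\<mu>\<in>UNIV. f (Inr (Inl \<mu>))) + f (Inr (Inr ()))"
proof -
  have U: "(UNIV::six set) = insert (Inl ()) (insert (Inr (Inr ())) ((\<lambda>\<mu>. Inr (Inl \<mu>)) ` UNIV))"
    by (auto intro: six_cases)
  show ?thesis
    unfolding U by (subst sum.insert, simp, force)+ (simp add: sum.reindex inj_on_def add_ac)
qed

lemma blk_eq_iff:
  "blk a r b v A w c s d = blk a' r' b' v' A' w' c' s' d' \<longleftrightarrow>
   a = a' \<and> r = r' \<and> b = b' \<and> v = v' \<and> A = A' \<and> w = w' \<and> c = c' \<and> s = s' \<and> d = d'"
  by (auto simp: vec_eq_iff all_six blk_nth)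

lemma blk_surj: "\<exists>a r b v A w c s d. X = blk a r b v A w c s d"
proof
  show "\<exists>r b v A w c s d. X = blk (X $ Inl () $ Inl ()) r b v A w c s d"
    by (rule exI[of _ "\<chi> \<nu>. X $ Inl () $ Inr (Inl \<nu>)"], rule exI[of _ "X $ Inl () $ Inr (Inr ())"],
        rule exI[of _ "\<chi> \<mu>. X $ Inr (Inl \<mu>) $ Inl ()"],
        rule exI[of _ "\<chi> \<mu> \<nu>. X $ Inr (Inl \<mu>) $ Inr (Inl \<nu>)"],
        rule exI[of _ "\<chi> \<mu>. X $ Inr (Inl \<mu>) $ Inr (Inr ())"],
        rule exI[of _ "X $ Inr (Inr ()) $ Inl ()"],
        rule exI[of _ "\<chi> \<nu>. X $ Inr (Inr ()) $ Inr (Inl \<nu>)"],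
        rule exI[of _ "X $ Inr (Inr ()) $ Inr (Inr ())"])
       (simp add: vec_eq_iff all_six blk_nth)
qed

lemma blk_mult:
  "blk a r b v A w c s d ** blk a' r' b' v' A' w' c' s' d' =
   blk (a * a' + r \<bullet> v' + b * c') (a *\<^sub>R r' + r v* A' + b *\<^sub>R s') (a * b' + r \<bullet> w' + b * d')
     (a' *\<^sub>R v + A *v v' + c' *\<^sub>R w) (outer v r' + A ** A' + outer w s') (b' *\<^sub>R v + A *v w' + d' *\<^sub>R w)
     (c * a' + s \<bullet> v' + d * c') (c *\<^sub>R r' + s v* A' + d *\<^sub>R s') (c * b' + s \<bullet> w' + d * d')"
  by (simp add: vec_eq_iff all_six blk_nth matrix_matrix_mult_def matrix_vector_mult_def
      vector_matrix_mult_def inner_vec_def outer_def sum_six mult_ac)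

lemma blk_add: "blk a r b v A w c s d + blk a' r' b' v' A' w' c' s' d' =
    blk (a + a') (r + r') (b + b') (v + v') (A + A') (w + w') (c + c') (s + s') (d + d')"
  by (simp add: vec_eq_iff all_six blk_nth)

lemma blk_scaleR: "k *\<^sub>R blk a r b v A w c s d =
    blk (k * a) (k *\<^sub>R r) (k * b) (k *\<^sub>R v) (k *\<^sub>R A) (k *\<^sub>R w) (k * c) (k *\<^sub>R s) (k * d)"
  by (simp add: vec_eq_iff all_six blk_nth)

lemma blk_zero: "blk 0 0 0 0 0 0 0 0 0 = 0"
  by (simp add: vec_eq_iff all_six blk_nth)

lemma blk_transpose: "transpose (blk a r b v A w c s d) = blk a v c r (transpose A) s b w d"
  by (simp add: vec_eq_iff all_six blk_nth transpose_def)

lemma blk_one: "blk 1 0 0 0 (mat 1) 0 0 0 1 = mat 1"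
  by (simp add: vec_eq_iff all_six blk_nth mat_def)

lemma smooth_on_blk:
  assumes "open S" "smooth_on S a" "smooth_on S r" "smooth_on S b" "smooth_on S v" "smooth_on S A"
    "smooth_on S w" "smooth_on S c" "smooth_on S s" "smooth_on S d"
  shows "smooth_on S (\<lambda>m. blk (a m) (r m) (b m) (v m) (A m) (w m) (c m) (s m) (d m))"
proof (intro smooth_on_componentwise assms(1))
  fix X Y
  show "smooth_on S (\<lambda>m. blk (a m) (r m) (b m) (v m) (A m) (w m) (c m) (s m) (d m) $ X $ Y)"
    by (cases X rule: six_cases; cases Y rule: six_cases; simp add: blk_nth)
       (intro assms smooth_on_vec_nth)+
qed

lemma pd_blk:
  assumes "a differentiable (at m)" "r differentiable (at m)" "b differentiable (at m)"
    "v differentiable (at m)" "A differentiable (at m)" "w differentiable (at m)"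
    "c differentiable (at m)" "s differentiable (at m)" "d differentiable (at m)"
  shows "pd k (\<lambda>m. blk (a m) (r m) (b m) (v m) (A m) (w m) (c m) (s m) (d m)) m =
    blk (pd k a m) (pd k r m) (pd k b m) (pd k v m) (pd k A m) (pd k w m) (pd k c m) (pd k s m) (pd k d m)"
    (is "pd k ?f m = _")
proof -
  have "(\<lambda>m. ?f m $ X $ Y) differentiable (at m)" for X Y
    by (cases X rule: six_cases; cases Y rule: six_cases; simp add: blk_nth)
       (intro assms differentiable_vec_nth)+
  then have D1: "(\<lambda>m. ?f m $ X) differentiable (at m)" for X
    by (rule differentiable_componentwise_vec)
  then have D: "?f differentiable (at m)"
    by (rule differentiable_componentwise_vec)
  show ?thesis
    using assms by (simp add: vec_eq_iff all_six blk_nth pd_vec_nth D D1 differentiable_vec_nth)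
qed

section \<open>The normal conformal connection in a coordinate gauge\<close>

lemma bounded_bilinear_matrix_vector:
  "bounded_bilinear ((*v) :: real^'n^'m \<Rightarrow> real^'n \<Rightarrow> real^'m)"
  by (rule bilinear_conv_bounded_bilinear[THEN iffD1])
     (auto simp: bilinear_def linear_iff vec_eq_iff matrix_vector_mult_def
        algebra_simps sum.distrib sum_distrib_left)

lemma bounded_linear_transpose: "bounded_linear (transpose :: real^'n^'m \<Rightarrow> real^'m^'n)"
  by (rule linear_conv_bounded_linear[THEN iffD1])
     (auto simp: linear_iff vec_eq_iff transpose_def)

lemmas smooth_on_matrix_vector = smooth_on_bilinear[OF _ bounded_bilinear_matrix_vector]
lemmas smooth_on_transpose = smooth_on_linear[OF _ bounded_linear_transpose]
lemmas smooth_on_inner = smooth_on_bilinear[OF _ bounded_bilinear_inner]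
lemmas differentiable_transpose = differentiable_linear[OF bounded_linear_transpose]
lemmas pd_transpose = pd_linear[OF bounded_linear_transpose]

lemma matrix_vector_axis: "A *v axis c 1 = column c A" for A :: "real^'n::finite^'m::finite"
  by (simp add: matrix_vector_mult_basis)

lemma matrix_vector_axis_nth: "(A *v axis c 1) $ k = A $ k $ c" for A :: "real^'n::finite^'m::finite"
  by (simp add: matrix_vector_mult_basis column_def)

text \<open>
  The normal conformal connection in the coordinate coframe; the middle block of the
  quadratic form is the variable matrix \<open>g m\<close>.
\<close>
definition coord_conn :: "(real^4 \<Rightarrow> real^4^4) \<Rightarrow> real^4 \<Rightarrow> 4 \<Rightarrow> real^six^six" where
  "coord_conn g m c =
     blk 0 (\<chi> b. schouten g m b c) 0 (axis c 1) (\<chi> a b. christoffel g m a c b)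
       (matrix_inv (g m) *v (\<chi> b. schouten g m b c)) 0 (g m $ c) 0"

text \<open>The Gram matrix of \<open>G\<^sub>\<mu>\<^sub>\<nu> X\<^sup>\<mu> X\<^sup>\<nu> - 2 X\<^sup>0 X\<^sup>5\<close>.\<close>
definition quad_form :: "real^4^4 \<Rightarrow> real^six^six" where
  "quad_form G = blk 0 0 (-1) 0 G 0 (-1) 0 0"

lemma conf_conn_blk:
  "conf_conn g \<eta> \<theta> m c = blk 0 (\<chi> \<nu>. P_form g \<theta> m c \<nu>) 0 (column c (\<theta> m))
     (\<chi> \<mu> \<nu>. lc_form g \<theta> m c \<mu> \<nu>) (matrix_inv \<eta> *v (\<chi> \<nu>. P_form g \<theta> m c \<nu>)) 0
     (\<eta> *v column c (\<theta> m)) 0"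
  by (simp add: vec_eq_iff all_six blk_nth conf_conn_def column_def matrix_vector_mult_def)

text \<open>The coframe itself is the gauge transformation between the two forms of the connection.\<close>
lemma conf_conn_gauge:
  assumes M: "open M" and ad: "adapted_coframe M g \<eta> \<theta>" and g: "\<And>m. m \<in> M \<Longrightarrow> invertible (g m)"
  shows "gauge_related M (conf_conn g \<eta> \<theta>) (\<lambda>m. blk 1 0 0 0 (\<theta> m) 0 0 0 1) (coord_conn g)"
  unfolding gauge_related_def
proof (intro ballI allI)
  fix m c assume m: "m \<in> M"
  define E where "E = (\<lambda>m. matrix_inv (\<theta> m))"
  have sm: "smooth_on M \<theta>" and \<eta>: "transpose \<eta> = \<eta>"
    and inv: "\<And>m. m \<in> M \<Longrightarrow> invertible (\<theta> m)" and gm: "\<And>m. m \<in> M \<Longrightarrow> g m = transpose (\<theta> m) ** \<eta> ** \<theta> m"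
    using ad by (auto simp: adapted_coframe_def)
  have E: "E m ** \<theta> m = mat 1" "\<theta> m ** E m = mat 1" if "m \<in> M" for m
    using matrix_inv_left[OF inv[OF that]] matrix_inv_right[OF inv[OF that]] by (simp_all add: E_def)
  have Et: "transpose (\<theta> m) ** transpose (E m) = mat 1" "transpose (E m) ** transpose (\<theta> m) = mat 1"
    using E[OF m] by (simp_all flip: matrix_transpose_mul)
  have d\<theta>: "\<theta> differentiable (at m)" and dE: "E differentiable (at m)"
    using smooth_on_differentiable[OF sm m] smooth_on_differentiable[OF smooth_on_matrix_inv[OF M sm inv] m]
    by (simp_all add: E_def)
  define Gi where "Gi = matrix_inv (g m)"
  have Gi: "g m ** Gi = mat 1" "Gi ** g m = mat 1"
    using g[OF m] by (simp_all add: Gi_def matrix_inv_left matrix_inv_right)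
  have "\<eta> ** (\<theta> m ** Gi ** transpose (\<theta> m)) = (transpose (E m) ** transpose (\<theta> m)) ** \<eta> ** (\<theta> m ** Gi ** transpose (\<theta> m))"
    by (simp add: Et)
  also have "\<dots> = transpose (E m) ** (g m ** Gi) ** transpose (\<theta> m)"
    by (simp add: gm[OF m] matrix_mul_assoc)
  finally have "\<eta> ** (\<theta> m ** Gi ** transpose (\<theta> m)) = mat 1"
    by (simp add: Gi Et)
  then have \<eta>i: "matrix_inv \<eta> = \<theta> m ** Gi ** transpose (\<theta> m)"
    by (rule matrix_inv_unique)
  define P where "P = (\<chi> b. schouten g m b c)"
  have PE: "(\<chi> \<nu>. P_form g \<theta> m c \<nu>) = transpose (E m) *v P"
    by (simp add: vec_eq_iff P_form_def E_def P_def vector_matrix_mult_def mult.commute)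
  have 1: "(transpose (E m) *v P) v* \<theta> m = P"
    using E[OF m] by (simp add: vector_matrix_mul_assoc)
  have 2: "matrix_inv \<eta> *v (transpose (E m) *v P) = \<theta> m *v (Gi *v P)"
    unfolding \<eta>i matrix_vector_mul_assoc using Et(1)
    by (metis matrix_mul_assoc matrix_mul_rid)
  have 3: "(\<eta> *v column c (\<theta> m)) v* \<theta> m = g m $ c"
  proof -
    have "g m $ c = transpose (g m) *v axis c 1"
      by (simp add: vec_eq_iff matrix_vector_axis_nth transpose_def del: transpose_matrix_vector)
    also have "\<dots> = transpose (\<theta> m) *v (\<eta> *v (\<theta> m *v axis c 1))"
      by (simp add: gm[OF m] matrix_transpose_mul \<eta> matrix_vector_mul_assoc matrix_mul_assoc del: transpose_matrix_vector)
    finally show ?thesis by (simp add: matrix_vector_axis)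
  qed
  define \<Gamma> where "\<Gamma> = (\<chi> a b. christoffel g m a c b)"
  have L: "(\<chi> \<mu> \<nu>. lc_form g \<theta> m c \<mu> \<nu>) = \<theta> m ** (pd c E m + \<Gamma> ** E m)"
    by (simp add: vec_eq_iff lc_form_def matrix_matrix_mult_def \<Gamma>_def pd_vec_nth dE differentiable_vec_nth E_def[symmetric])
       (simp add: E_def)
  have "pd c E m ** \<theta> m + E m ** pd c \<theta> m = pd c (\<lambda>m. E m ** \<theta> m) m"
    by (simp add: pd_matrix_mult dE d\<theta>)
  also have "\<dots> = pd c (\<lambda>m. mat 1 :: real^4^4) m"
    by (rule pd_cong[OF M m]) (simp add: E)
  finally have "pd c E m ** \<theta> m = - (E m ** pd c \<theta> m)"
    by (simp add: pd_const eq_neg_iff_add_eq_0)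
  then have "\<theta> m ** pd c E m ** \<theta> m = - pd c \<theta> m"
    by (metis E(2)[OF m] matrix_mul_assoc matrix_mul_lid bounded_bilinear.minus_right[OF bounded_bilinear_matrix_mult])
  moreover have "\<theta> m ** (\<Gamma> ** E m) ** \<theta> m = \<theta> m ** \<Gamma>"
    by (simp add: E[OF m] flip: matrix_mul_assoc)
  ultimately have 4: "(\<chi> \<mu> \<nu>. lc_form g \<theta> m c \<mu> \<nu>) ** \<theta> m + pd c \<theta> m = \<theta> m ** \<Gamma>"
    unfolding L by (simp add: matrix_bilinear_simps)
  have D: "pd c (\<lambda>m. blk 1 0 0 0 (\<theta> m) 0 0 0 1) m = blk 0 0 0 0 (pd c \<theta> m) 0 0 0 0"
    by (subst pd_blk) (simp_all add: d\<theta> pd_const)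
  show "conf_conn g \<eta> \<theta> m c ** blk 1 0 0 0 (\<theta> m) 0 0 0 1 + pd c (\<lambda>m. blk 1 0 0 0 (\<theta> m) 0 0 0 1) m =
      blk 1 0 0 0 (\<theta> m) 0 0 0 1 ** coord_conn g m c"
    unfolding D conf_conn_blk coord_conn_def blk_mult blk_add blk_eq_iff
    using 4 1 2 3 unfolding PE P_def[symmetric] \<Gamma>_def[symmetric] Gi_def[symmetric]
    by (simp add: matrix_vector_axis outer_def zero_vec_def[symmetric] flip: zero_vec_def)
qed

text \<open>The Levi-Civita connection is the only torsion-free metric one.\<close>
lemma christoffel_unique:
  assumes inv: "Gi ** g m = mat 1" "matrix_inv (g m) = Gi"
    and sym: "\<And>a b. g m $ a $ b = g m $ b $ a"
    and torsion: "\<And>a b c. \<Gamma> a b c = \<Gamma> a c b"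
    and metric: "\<And>a b c. pd c (\<lambda>m. g m $ a $ b) m = (\<Sum>e\<in>UNIV. \<Gamma> e c a * g m $ e $ b + \<Gamma> e c b * g m $ a $ e)"
  shows "christoffel g m a b c = \<Gamma> a b c"
proof -
  have "pd b (\<lambda>m. g m $ d $ c) m + pd c (\<lambda>m. g m $ b $ d) m - pd d (\<lambda>m. g m $ b $ c) m
      = 2 * (\<Sum>e\<in>UNIV. g m $ d $ e * \<Gamma> e b c)" for d
  proof -
    have "pd b (\<lambda>m. g m $ d $ c) m + pd c (\<lambda>m. g m $ b $ d) m - pd d (\<lambda>m. g m $ b $ c) m =
      (\<Sum>e\<in>UNIV. (\<Gamma> e b d * g m $ e $ c + \<Gamma> e b c * g m $ d $ e)
        + (\<Gamma> e c b * g m $ e $ d + \<Gamma> e c d * g m $ b $ e)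
        - (\<Gamma> e d b * g m $ e $ c + \<Gamma> e d c * g m $ b $ e))"
      by (simp add: metric sum.distrib sum_subtractf)
    also have "\<dots> = (\<Sum>e\<in>UNIV. 2 * (g m $ d $ e * \<Gamma> e b c))"
    proof (rule sum.cong[OF refl])
      fix e
      show "(\<Gamma> e b d * g m $ e $ c + \<Gamma> e b c * g m $ d $ e)
        + (\<Gamma> e c b * g m $ e $ d + \<Gamma> e c d * g m $ b $ e)
        - (\<Gamma> e d b * g m $ e $ c + \<Gamma> e d c * g m $ b $ e) = 2 * (g m $ d $ e * \<Gamma> e b c)"
        using torsion[of e c b] torsion[of e d b] torsion[of e d c] sym[of e d] by simp
    qed
    finally show ?thesis by (simp add: sum_distrib_left)
  qed
  then have "christoffel g m a b c = (\<Sum>d\<in>UNIV. \<Sum>e\<in>UNIV. Gi $ a $ d * g m $ d $ e * \<Gamma> e b c)"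
    by (simp add: christoffel_def inv(2) sum_distrib_left mult_ac)
  also have "\<dots> = (\<Sum>e\<in>UNIV. (Gi ** g m) $ a $ e * \<Gamma> e b c)"
    by (subst sum.swap) (simp add: matrix_matrix_mult_def sum_distrib_right)
  also have "\<dots> = \<Gamma> a b c"
    by (simp add: inv mat_def if_distrib[of "\<lambda>x. x * _"] cong: if_cong)
  finally show ?thesis .
qed

lemmas matrix_vector_simps =
  bounded_bilinear.add_left[OF bounded_bilinear_matrix_vector]
  bounded_bilinear.add_right[OF bounded_bilinear_matrix_vector]
  bounded_bilinear.diff_left[OF bounded_bilinear_matrix_vector]
  bounded_bilinear.diff_right[OF bounded_bilinear_matrix_vector]
  bounded_bilinear.minus_left[OF bounded_bilinear_matrix_vector]
  bounded_bilinear.minus_right[OF bounded_bilinear_matrix_vector]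
  bounded_bilinear.zero_left[OF bounded_bilinear_matrix_vector]
  bounded_bilinear.zero_right[OF bounded_bilinear_matrix_vector]
  bounded_bilinear.scaleR_left[OF bounded_bilinear_matrix_vector]
  bounded_bilinear.scaleR_right[OF bounded_bilinear_matrix_vector]

text \<open>Row vectors times matrices are rewritten to matrices times column vectors.\<close>
lemma vector_matrix_transpose: "v v* A = transpose A *v v" for A :: "real^'n::finite^'m::finite"
  by simp

lemmas column_vector_simps =
  vector_matrix_transpose matrix_vector_simps matrix_vector_mul_assoc[symmetric]

lemma curvature_form_nth:
  assumes "\<And>c. (\<lambda>m. \<psi> m c) differentiable (at m)"
  shows "curvature_form \<psi> m a b $ X $ X' =
    pd a (\<lambda>m. \<psi> m b $ X $ X') m - pd b (\<lambda>m. \<psi> m a $ X $ X') m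
    + ((\<psi> m a ** \<psi> m b) $ X $ X' - (\<psi> m b ** \<psi> m a) $ X $ X')"
  using assms by (simp add: curvature_form_def pd_vec_nth differentiable_vec_nth)

section \<open>Conformal rescaling of a normal connection\<close>

text \<open>
  A normal conformal connection \<open>\<omega>\<close>, given in an adapted coframe \<open>\<theta>\<close> (with dual frame
  \<open>E\<close>) for a metric \<open>\<eta>\<^sub>\<mu>\<^sub>\<nu> \<theta>\<^sup>\<mu> \<theta>\<^sup>\<nu>\<close>, together with a conformal factor \<open>\<rho>\<close>.  It is
  described by its properties only: it preserves the quadratic form, its curvature has neither a
  torsion part nor (after contraction) a trace.  That \<open>\<Gamma>\<close> and \<open>P\<close> are the Levi-Civita connection and
  the tensor \<open>schouten\<close> of a metric is not assumed; for the rescaled metric it is a consequence.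
\<close>
locale normal_connection =
  fixes M :: "(real^4) set" and \<theta> E :: "real^4 \<Rightarrow> real^4^4" and \<eta> :: "real^4^4"
    and \<rho> :: "real^4 \<Rightarrow> real"
    and P :: "real^4 \<Rightarrow> 4 \<Rightarrow> real^4" and \<Gamma> :: "real^4 \<Rightarrow> 4 \<Rightarrow> real^4^4"
    and Y Z :: "real^4 \<Rightarrow> 4 \<Rightarrow> 4 \<Rightarrow> real^4" and W :: "real^4 \<Rightarrow> 4 \<Rightarrow> 4 \<Rightarrow> real^4^4"
    and \<omega> :: "real^4 \<Rightarrow> 4 \<Rightarrow> real^six^six"
  assumes M: "open M"
    and \<omega>_eq: "\<And>m c. \<omega> m c =
      blk 0 (P m c) 0 (\<theta> m *v axis c 1) (\<Gamma> m c) (\<eta> *v P m c) 0 (\<eta> *v (\<theta> m *v axis c 1)) 0"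
    and \<theta>_smooth: "smooth_on M \<theta>" and E_smooth: "smooth_on M E"
    and E_\<theta>: "\<And>m. m \<in> M \<Longrightarrow> E m ** \<theta> m = mat 1"
    and \<eta>_sym: "transpose \<eta> = \<eta>" and \<eta>_sq: "\<eta> ** \<eta> = mat 1"
    and \<omega>_smooth: "\<And>c. smooth_on M (\<lambda>m. \<omega> m c)"
    and \<rho>_smooth: "smooth_on M \<rho>" and \<rho>_nz: "\<And>m. m \<in> M \<Longrightarrow> \<rho> m \<noteq> 0"
    and \<Gamma>_so: "\<And>m c. m \<in> M \<Longrightarrow> transpose (\<Gamma> m c) ** \<eta> + \<eta> ** \<Gamma> m c = 0"
    and curv: "\<And>m a b. m \<in> M \<Longrightarrow> curvature_form \<omega> m a b = blk 0 (Y m a b) 0 0 (W m a b) (Z m a b) 0 0 0"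
    and trace_free: "\<And>m b d. m \<in> M \<Longrightarrow> (\<Sum>a\<in>UNIV. (E m ** W m a d ** \<theta> m) $ a $ b) = 0"
begin

text \<open>The rescaled metric, its inverse, and the logarithmic derivative of the factor.\<close>
definition g :: "real^4 \<Rightarrow> real^4^4" where
  "g m = (\<rho> m)\<^sup>2 *\<^sub>R (transpose (\<theta> m) ** \<eta> ** \<theta> m)"

definition ginv :: "real^4 \<Rightarrow> real^4^4" where
  "ginv m = inverse ((\<rho> m)\<^sup>2) *\<^sub>R (E m ** \<eta> ** transpose (E m))"

definition \<Upsilon> :: "real^4 \<Rightarrow> real^4" where
  "\<Upsilon> m = inverse (\<rho> m) *\<^sub>R (\<chi> a. pd a \<rho> m)"

text \<open>
  The gauge transformation to the metric \<open>g\<close> in the coordinate coframe.  The middle entry of its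
  first row is forced by the vanishing of the upper left entry of the transformed connection, and the
  last column by compatibility with the quadratic forms.
\<close>
definition K :: "real^4 \<Rightarrow> real^six^six" where
  "K m = blk (inverse (\<rho> m)) (- inverse (\<rho> m) *\<^sub>R (transpose (E m) *v \<Upsilon> m))
      (\<rho> m / 2 * (\<Upsilon> m \<bullet> (ginv m *v \<Upsilon> m)))
      0 (inverse (\<rho> m) *\<^sub>R E m) (- \<rho> m *\<^sub>R (ginv m *v \<Upsilon> m)) 0 0 (\<rho> m)"

text \<open>The inverse of \<open>K\<close>, since \<open>K\<close> is an isometry of quadratic forms.\<close>
definition Kinv :: "real^4 \<Rightarrow> real^six^six" where
  "Kinv m = quad_form \<eta> ** transpose (K m) ** quad_form (g m)"

text \<open>The transformed connection.\<close>
definition \<omega>' :: "real^4 \<Rightarrow> 4 \<Rightarrow> real^six^six" where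
  "\<omega>' m c = (K m ** \<omega> m c - pd c K m) ** Kinv m"

lemma \<theta>_E: "m \<in> M \<Longrightarrow> \<theta> m ** E m = mat 1"
  using E_\<theta> matrix_left_right_inverse by blast

lemma E_\<theta>_transpose:
  assumes "m \<in> M"
  shows "transpose (E m) ** transpose (\<theta> m) = mat 1" "transpose (\<theta> m) ** transpose (E m) = mat 1"
  using E_\<theta>[OF assms] \<theta>_E[OF assms] by (simp_all flip: matrix_transpose_mul)

lemma g_sym: "transpose (g m) = g m"
  by (simp add: g_def transpose_scalar matrix_transpose_mul \<eta>_sym matrix_mul_assoc)

lemma g_nth_sym: "g m $ a $ b = g m $ b $ a"
  using arg_cong[OF g_sym, of "\<lambda>A. A $ b $ a" m] by (simp add: transpose_def)

lemma ginv_sym: "transpose (ginv m) = ginv m"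
  by (simp add: ginv_def transpose_scalar matrix_transpose_mul \<eta>_sym matrix_mul_assoc)

lemma g_ginv:
  assumes "m \<in> M" shows "g m ** ginv m = mat 1"
proof -
  have "transpose (\<theta> m) ** \<eta> ** \<theta> m ** (E m ** \<eta> ** transpose (E m))
      = transpose (\<theta> m) ** (\<eta> ** (\<theta> m ** E m) ** \<eta>) ** transpose (E m)"
    by (simp add: matrix_mul_assoc)
  also have "\<dots> = mat 1"
    by (simp add: \<theta>_E[OF assms] \<eta>_sq E_\<theta>_transpose[OF assms])
  finally show ?thesis
    using \<rho>_nz[OF assms] by (simp add: g_def ginv_def matrix_bilinear_simps)
qed

lemma ginv_g: "m \<in> M \<Longrightarrow> ginv m ** g m = mat 1"
  using g_ginv matrix_left_right_inverse by blast

lemma g_invertible: "m \<in> M \<Longrightarrow> invertible (g m)" and matrix_inv_g: "m \<in> M \<Longrightarrow> matrix_inv (g m) = ginv m"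
  using matrix_inv_unique g_ginv by blast+

lemma g_smooth: "smooth_on M g"
proof -
  have "smooth_on M (\<lambda>m. (\<rho> m)\<^sup>2 *\<^sub>R (transpose (\<theta> m) ** \<eta> ** \<theta> m))"
    by (intro smooth_on_scaleR smooth_on_power smooth_on_matrix_mult smooth_on_transpose smooth_on_const M \<theta>_smooth \<rho>_smooth)
  then show ?thesis by (simp add: g_def[abs_def])
qed

lemma ginv_smooth: "smooth_on M ginv"
proof -
  have "smooth_on M (\<lambda>m. inverse ((\<rho> m)\<^sup>2) *\<^sub>R (E m ** \<eta> ** transpose (E m)))"
    by (intro smooth_on_scaleR smooth_on_inverse smooth_on_power smooth_on_matrix_mult
        smooth_on_transpose smooth_on_const M E_smooth \<rho>_smooth) (simp add: \<rho>_nz)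
  then show ?thesis by (simp add: ginv_def[abs_def])
qed

lemma \<Upsilon>_smooth: "smooth_on M \<Upsilon>"
proof -
  have "smooth_on M (\<lambda>m. inverse (\<rho> m) *\<^sub>R (\<chi> a. pd a \<rho> m))"
    by (intro smooth_on_scaleR smooth_on_inverse M \<rho>_smooth \<rho>_nz smooth_on_componentwise)
       (simp_all add: smooth_on_pd[OF \<rho>_smooth])
  then show ?thesis by (simp add: \<Upsilon>_def[abs_def])
qed

lemma K_smooth: "smooth_on M K"
proof -
  have m: "smooth_on M (\<lambda>m. - inverse (\<rho> m))" "smooth_on M (\<lambda>m. - \<rho> m)" "smooth_on M (\<lambda>m. inverse (\<rho> m))"
    by (intro smooth_on_minus smooth_on_inverse M \<rho>_smooth \<rho>_nz; assumption)+
  have "smooth_on M (\<lambda>m. ginv m *v \<Upsilon> m)" "smooth_on M (\<lambda>m. transpose (E m) *v \<Upsilon> m)"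
    using M ginv_smooth \<Upsilon>_smooth E_smooth
    by (intro smooth_on_matrix_vector smooth_on_transpose; simp)+
  then have "smooth_on M (\<lambda>m. blk (inverse (\<rho> m)) (- inverse (\<rho> m) *\<^sub>R (transpose (E m) *v \<Upsilon> m))
      (\<rho> m / 2 * (\<Upsilon> m \<bullet> (ginv m *v \<Upsilon> m)))
      0 (inverse (\<rho> m) *\<^sub>R E m) (- \<rho> m *\<^sub>R (ginv m *v \<Upsilon> m)) 0 0 (\<rho> m))"
    by (intro smooth_on_blk smooth_on_scaleR smooth_on_mult smooth_on_divide smooth_on_inner m M
        \<rho>_smooth smooth_on_const \<Upsilon>_smooth E_smooth) simp_all
  then show ?thesis by (simp add: K_def[abs_def])
qed

lemma quad_form_smooth: "smooth_on M (\<lambda>m. quad_form (g m))"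
  unfolding quad_form_def by (intro smooth_on_blk smooth_on_const M g_smooth)

lemma Kinv_smooth: "smooth_on M Kinv"
proof -
  have "smooth_on M (\<lambda>m. quad_form \<eta> ** transpose (K m) ** quad_form (g m))"
    by (intro smooth_on_matrix_mult smooth_on_const smooth_on_transpose K_smooth quad_form_smooth M)
  then show ?thesis by (simp add: Kinv_def[abs_def])
qed

lemma \<omega>'_smooth: "smooth_on M (\<lambda>m. \<omega>' m c)"
  unfolding \<omega>'_def
  by (intro smooth_on_matrix_mult smooth_on_diff K_smooth Kinv_smooth \<omega>_smooth M
      smooth_on_pd[of M K])

lemma quad_form_sq: "quad_form \<eta> ** quad_form \<eta> = mat 1"
  by (simp add: quad_form_def blk_mult \<eta>_sq outer_def flip: blk_one zero_vec_def)

lemma K_isometry: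
  assumes m: "m \<in> M"
  shows "transpose (K m) ** quad_form (g m) ** K m = quad_form \<eta>"
proof -
  have 1: "inverse (\<rho> m) *\<^sub>R inverse (\<rho> m) *\<^sub>R (transpose (E m) ** g m ** E m) = \<eta>"
  proof -
    have "transpose (E m) ** (transpose (\<theta> m) ** \<eta> ** \<theta> m) ** E m
        = (transpose (E m) ** transpose (\<theta> m)) ** \<eta> ** (\<theta> m ** E m)"
      by (simp add: matrix_mul_assoc)
    also have "\<dots> = \<eta>" by (simp add: E_\<theta>_transpose \<theta>_E m)
    finally show ?thesis
      using \<rho>_nz[OF m] by (simp add: g_def matrix_bilinear_simps power2_eq_square field_simps)
  qed
  have 2: "g m *v (ginv m *v \<Upsilon> m) = \<Upsilon> m" "(ginv m *v \<Upsilon> m) v* g m = \<Upsilon> m"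
    using g_ginv[OF m] g_sym[of m] by (simp_all add: matrix_vector_mul_assoc flip: transpose_matrix_vector)
  have 3: "\<Upsilon> m \<bullet> (ginv m *v \<Upsilon> m) = (ginv m *v \<Upsilon> m) \<bullet> \<Upsilon> m"
    by (rule inner_commute)
  show ?thesis
    unfolding K_def quad_form_def blk_transpose blk_mult blk_eq_iff
    using \<rho>_nz[OF m] 1 2
    by (simp add: outer_def matrix_bilinear_simps transpose_scalar g_sym column_vector_simps
          del: transpose_matrix_vector flip: zero_vec_def)
qed

lemma Kinv_K: "m \<in> M \<Longrightarrow> Kinv m ** K m = mat 1"
  using K_isometry[of m] quad_form_sq by (simp add: Kinv_def flip: matrix_mul_assoc)

lemma K_Kinv: "m \<in> M \<Longrightarrow> K m ** Kinv m = mat 1"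
  using Kinv_K matrix_left_right_inverse by blast

lemma \<omega>'_K: "m \<in> M \<Longrightarrow> \<omega>' m c ** K m = K m ** \<omega> m c - pd c K m"
  by (simp add: \<omega>'_def Kinv_K flip: matrix_mul_assoc)

lemma \<omega>'_gauge: "gauge_related M \<omega>' K \<omega>"
  by (simp add: gauge_related_def \<omega>'_K)

lemma \<omega>_so:
  assumes "m \<in> M"
  shows "transpose (\<omega> m c) ** quad_form \<eta> + quad_form \<eta> ** \<omega> m c = 0"
proof -
  have "\<eta> *v (\<eta> *v v) = v" for v by (simp add: matrix_vector_mul_assoc \<eta>_sq)
  then show ?thesis
    using \<Gamma>_so[OF assms, of c]
    by (simp add: \<omega>_eq quad_form_def blk_transpose blk_mult blk_add column_vector_simps \<eta>_sym outer_def
          del: transpose_matrix_vector flip: blk_zero zero_vec_def)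
qed

text \<open>
  The transformed connection preserves the quadratic form of the variable metric.  Together with the
  first column this determines its whole shape.
\<close>
lemma \<omega>'_compatible:
  assumes m: "m \<in> M"
  shows "transpose (\<omega>' m c) ** quad_form (g m) + quad_form (g m) ** \<omega>' m c = pd c (\<lambda>m. quad_form (g m)) m"
    (is "?A = ?J'")
proof -
  let ?J = "quad_form (g m)" and ?K' = "pd c K m"
  have d: "K differentiable (at m)" "(\<lambda>m. quad_form (g m)) differentiable (at m)"
    using smooth_on_differentiable[OF _ m] K_smooth quad_form_smooth by blast+
  have "pd c (\<lambda>m. transpose (K m) ** quad_form (g m) ** K m) m = pd c (\<lambda>m. quad_form \<eta>) m"
    by (rule pd_cong[OF M m]) (rule K_isometry)
  then have "transpose ?K' ** ?J ** K m + transpose (K m) ** ?J' ** K m + transpose (K m) ** ?J ** ?K' = 0"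
    using d by (simp add: pd_const pd_matrix_mult pd_transpose differentiable_transpose
        differentiable_matrix_mult matrix_bilinear_simps)
  then have J': "transpose (K m) ** ?J' ** K m = - (transpose ?K' ** ?J ** K m) - transpose (K m) ** ?J ** ?K'"
    by (simp add: algebra_simps eq_neg_iff_add_eq_0)
  have so: "transpose (\<omega> m c) ** (transpose (K m) ** ?J ** K m) + transpose (K m) ** ?J ** K m ** \<omega> m c = 0"
    using \<omega>_so[OF m] by (simp add: K_isometry[OF m])
  have "transpose (K m) ** ?A ** K m = transpose (\<omega>' m c ** K m) ** ?J ** K m + transpose (K m) ** ?J ** (\<omega>' m c ** K m)"
    by (simp add: matrix_transpose_mul matrix_bilinear_simps matrix_mul_assoc)
  also have "\<dots> = transpose (K m) ** ?J' ** K m"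
    unfolding J' \<omega>'_K[OF m] using so
    by (simp add: matrix_transpose_mul matrix_bilinear_simps matrix_mul_assoc linear_diff[OF bounded_linear.linear[OF bounded_linear_transpose]])
  finally have "transpose (Kinv m) ** (transpose (K m) ** ?A ** K m) ** Kinv m =
      transpose (Kinv m) ** (transpose (K m) ** ?J' ** K m) ** Kinv m" by simp
  moreover have "transpose (Kinv m) ** (transpose (K m) ** X ** K m) ** Kinv m = X" for X
  proof -
    have "transpose (Kinv m) ** (transpose (K m) ** X ** K m) ** Kinv m =
        transpose (K m ** Kinv m) ** X ** (K m ** Kinv m)"
      by (simp only: matrix_transpose_mul matrix_mul_assoc)
    then show ?thesis by (simp add: K_Kinv[OF m])
  qed
  ultimately show ?thesis by simp
qed

text \<open>The blocks of the transformed connection that compatibility does not determine.\<close>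
definition P' :: "real^4 \<Rightarrow> 4 \<Rightarrow> real^4" where
  "P' m c = (\<chi> \<nu>. \<omega>' m c $ Inl () $ Inr (Inl \<nu>))"

definition \<Gamma>' :: "real^4 \<Rightarrow> 4 \<Rightarrow> real^4^4" where
  "\<Gamma>' m c = (\<chi> \<mu> \<nu>. \<omega>' m c $ Inr (Inl \<mu>) $ Inr (Inl \<nu>))"

lemma pd_inverse_\<rho>:
  assumes "m \<in> M"
  shows "pd c (\<lambda>m. inverse (\<rho> m)) m = - inverse (\<rho> m) * \<Upsilon> m $ c"
  using pd_inverse[OF smooth_on_differentiable[OF \<rho>_smooth assms] \<rho>_nz[OF assms]]
  by (simp add: \<Upsilon>_def)

lemma \<omega>'_first_column:
  assumes m: "m \<in> M"
  shows "\<omega>' m c $ X $ Inl () = (case X of Inr (Inl \<mu>) \<Rightarrow> axis c 1 $ \<mu> | _ \<Rightarrow> 0)"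
proof -
  have K': "pd c K m $ X $ Inl () = (case X of Inl _ \<Rightarrow> - inverse (\<rho> m) * \<Upsilon> m $ c | _ \<Rightarrow> 0)" for X
  proof -
    have "pd c K m $ X $ Inl () = pd c (\<lambda>m. K m $ X $ Inl ()) m"
      using smooth_on_differentiable[OF K_smooth m] by (simp add: pd_vec_nth differentiable_vec_nth)
    then show ?thesis
      by (cases X rule: six_cases) (simp_all add: K_def blk_nth pd_const pd_inverse_\<rho>[OF m])
  qed
  have "inverse (\<rho> m) * \<omega>' m c $ X $ Inl () = (\<omega>' m c ** K m) $ X $ Inl ()"
    by (simp add: matrix_matrix_mult_def sum_six K_def blk_nth)
  also have "\<dots> = (K m ** \<omega> m c) $ X $ Inl () - pd c K m $ X $ Inl ()"
    by (simp add: \<omega>'_K[OF m])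
  also have "(K m ** \<omega> m c) $ X $ Inl () = (case X of Inl _ \<Rightarrow> - inverse (\<rho> m) * \<Upsilon> m $ c
      | Inr (Inl \<mu>) \<Rightarrow> inverse (\<rho> m) * axis c 1 $ \<mu> | _ \<Rightarrow> 0)"
  proof -
    have 1: "E m *v (\<theta> m *v axis c 1) = axis c 1"
      by (simp add: matrix_vector_mul_assoc E_\<theta>[OF m])
    have 2: "(transpose (E m) *v \<Upsilon> m) \<bullet> (\<theta> m *v axis c 1) = \<Upsilon> m $ c"
      by (simp add: dot_lmul_matrix 1 inner_axis)
    show ?thesis
      unfolding K_def \<omega>_eq blk_mult
      by (cases X rule: six_cases)
         (simp_all add: blk_nth 1 2 matrix_vector_simps del: transpose_matrix_vector)
  qed
  finally have "inverse (\<rho> m) * \<omega>' m c $ X $ Inl () =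
      inverse (\<rho> m) * (case X of Inr (Inl \<mu>) \<Rightarrow> axis c 1 $ \<mu> | _ \<Rightarrow> 0)"
    unfolding K' by (cases X rule: six_cases) simp_all
  then show ?thesis using \<rho>_nz[OF m] by simp
qed

lemma \<omega>'_shape:
  assumes m: "m \<in> M"
  shows "\<omega>' m c = blk 0 (P' m c) 0 (axis c 1) (\<Gamma>' m c) (ginv m *v P' m c) 0 (g m $ c) 0"
    and "transpose (\<Gamma>' m c) ** g m + g m ** \<Gamma>' m c = pd c g m"
proof -
  obtain a r b v A w c' s d where B: "\<omega>' m c = blk a r b v A w c' s d"
    using blk_surj by blast
  have col: "a = 0" "v = axis c 1" "c' = 0"
    using \<omega>'_first_column[OF m, of c] unfolding B
    by (auto simp: vec_eq_iff blk_nth all_six dest: spec split: sum.splits)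
       (metis blk_nth(1,4,7) old.sum.simps(5,6))+
  have d: "g differentiable (at m)" using smooth_on_differentiable[OF g_smooth m] .
  have "pd c (\<lambda>m. quad_form (g m)) m = blk 0 0 0 0 (pd c g m) 0 0 0 0"
    unfolding quad_form_def by (subst pd_blk) (simp_all add: d pd_const)
  then have "blk a v c' r (transpose A) s b w d ** quad_form (g m) + quad_form (g m) ** blk a r b v A w c' s d
      = blk 0 0 0 0 (pd c g m) 0 0 0 0"
    using \<omega>'_compatible[OF m, of c] unfolding B blk_transpose by simp
  then have *: "b = 0" "d = 0" "s = g m *v axis c 1" "r = g m *v w" "transpose A ** g m + g m ** A = pd c g m"
    unfolding quad_form_def blk_mult blk_add blk_eq_iff
    by (simp_all add: col outer_def column_vector_simps g_sym del: transpose_matrix_vector flip: zero_vec_def)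
  have w: "w = ginv m *v r"
    by (simp add: * matrix_vector_mul_assoc ginv_g[OF m])
  have s: "s = g m $ c"
    by (simp add: * vec_eq_iff matrix_vector_axis_nth g_nth_sym[of m _ c])
  have PG: "P' m c = r" "\<Gamma>' m c = A"
    by (simp_all add: P'_def \<Gamma>'_def B blk_nth vec_eq_iff)
  show "\<omega>' m c = blk 0 (P' m c) 0 (axis c 1) (\<Gamma>' m c) (ginv m *v P' m c) 0 (g m $ c) 0"
    unfolding PG B using col * w s by simp
  show "transpose (\<Gamma>' m c) ** g m + g m ** \<Gamma>' m c = pd c g m"
    unfolding PG by (rule *)
qed


lemma curvature_\<omega>':
  assumes m: "m \<in> M"
  shows "curvature_form \<omega>' m a b ** K m = K m ** curvature_form \<omega> m a b"
  using smooth_on_differentiable[OF \<omega>'_smooth m] smooth_on_differentiable[OF \<omega>_smooth m]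
  by (intro curvature_form_gauge[OF M m \<omega>'_gauge K_smooth])

lemma curvature_\<omega>'_blocks:
  assumes m: "m \<in> M"
  shows "curvature_form \<omega>' m a b $ Inr (Inl e) $ Inl () = 0"
    and "curvature_form \<omega>' m a b $ Inr (Inl e) $ Inr (Inl f) = (E m ** W m a b ** \<theta> m) $ e $ f"
proof -
  obtain a0 r b0 v A w c' s d where B: "curvature_form \<omega>' m a b = blk a0 r b0 v A w c' s d"
    using blk_surj by blast
  have *: "a0 = 0" "v = 0" "c' = 0" "inverse (\<rho> m) *\<^sub>R (A ** E m) = inverse (\<rho> m) *\<^sub>R (E m ** W m a b)"
    using curvature_\<omega>'[OF m, of a b] \<rho>_nz[OF m]
    unfolding B K_def curv[OF m] blk_mult blk_eq_iff
    by (auto simp: outer_def matrix_bilinear_simps simp flip: zero_vec_def)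
  then have "A ** E m = E m ** W m a b" using \<rho>_nz[OF m] by simp
  then have "A ** (E m ** \<theta> m) = E m ** W m a b ** \<theta> m"
    by (simp add: matrix_mul_assoc)
  then have "A = E m ** W m a b ** \<theta> m" by (simp add: E_\<theta>[OF m])
  with * show "curvature_form \<omega>' m a b $ Inr (Inl e) $ Inl () = 0"
    "curvature_form \<omega>' m a b $ Inr (Inl e) $ Inr (Inl f) = (E m ** W m a b ** \<theta> m) $ e $ f"
    by (simp_all add: B blk_nth)
qed

lemma \<omega>'_differentiable: "m \<in> M \<Longrightarrow> (\<lambda>m. \<omega>' m c) differentiable (at m)"
  using \<omega>'_smooth smooth_on_differentiable by blast

text \<open>The first column of the curvature is the torsion.\<close>
lemma \<Gamma>'_torsion_free:
  assumes m: "m \<in> M"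
  shows "\<Gamma>' m a $ e $ b = \<Gamma>' m b $ e $ a"
proof -
  have "pd a (\<lambda>m. \<omega>' m b $ Inr (Inl e) $ Inl ()) m = 0" for a b
  proof -
    have "pd a (\<lambda>m. \<omega>' m b $ Inr (Inl e) $ Inl ()) m = pd a (\<lambda>m. axis b 1 $ e) m"
      by (rule pd_cong[OF M m]) (simp add: \<omega>'_first_column)
    then show ?thesis by (simp add: pd_const)
  qed
  moreover have "(\<omega>' m a ** \<omega>' m b) $ Inr (Inl e) $ Inl () = \<Gamma>' m a $ e $ b" for a b
    by (simp add: \<omega>'_shape[OF m] blk_mult blk_nth matrix_vector_axis_nth)
  ultimately show ?thesis
    using curvature_form_nth[OF \<omega>'_differentiable[OF m], where a = a and b = b and X = "Inr (Inl e)" and X' = "Inl ()"]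
      curvature_\<omega>'_blocks(1)[OF m, of a b e] by simp
qed

lemma christoffel_g:
  assumes m: "m \<in> M"
  shows "christoffel g m a c b = \<Gamma>' m c $ a $ b"
proof (rule christoffel_unique[where Gi = "ginv m" and \<Gamma> = "\<lambda>a c b. \<Gamma>' m c $ a $ b"])
  fix a b c
  have "pd c (\<lambda>m. g m $ a $ b) m = pd c g m $ a $ b"
    using smooth_on_differentiable[OF g_smooth m] by (simp add: pd_vec_nth differentiable_vec_nth)
  also have "\<dots> = (transpose (\<Gamma>' m c) ** g m + g m ** \<Gamma>' m c) $ a $ b"
    by (simp add: \<omega>'_shape(2)[OF m])
  finally show "pd c (\<lambda>m. g m $ a $ b) m = (\<Sum>e\<in>UNIV. \<Gamma>' m c $ e $ a * g m $ e $ b + \<Gamma>' m c $ e $ b * g m $ a $ e)"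
    by (simp add: matrix_matrix_mult_def transpose_def sum.distrib mult.commute)
qed (simp_all add: ginv_g matrix_inv_g m g_nth_sym[of m a b for a b] \<Gamma>'_torsion_free[OF m])

lemma curvature_\<omega>'_riemann:
  assumes m: "m \<in> M"
  shows "(E m ** W m a b ** \<theta> m) $ e $ f = riemann g m e f a b
    + (axis a 1 $ e * P' m b $ f + (ginv m *v P' m a) $ e * g m $ b $ f)
    - (axis b 1 $ e * P' m a $ f + (ginv m *v P' m b) $ e * g m $ a $ f)"
proof -
  have "pd a (\<lambda>m. \<omega>' m b $ Inr (Inl e) $ Inr (Inl f)) m = pd a (\<lambda>m. christoffel g m e b f) m" for a b
    by (rule pd_cong[OF M m]) (simp add: christoffel_g \<Gamma>'_def)
  moreover have "(\<omega>' m a ** \<omega>' m b) $ Inr (Inl e) $ Inr (Inl f) =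
      axis a 1 $ e * P' m b $ f + (\<Sum>k\<in>UNIV. christoffel g m e a k * christoffel g m k b f)
      + (ginv m *v P' m a) $ e * g m $ b $ f" for a b
    by (simp add: \<omega>'_shape(1)[OF m] blk_nth sum_six matrix_matrix_mult_def christoffel_g[OF m])
  ultimately show ?thesis
    unfolding curvature_\<omega>'_blocks(2)[OF m, symmetric] curvature_form_nth[OF \<omega>'_differentiable[OF m]] riemann_def
    by (simp add: sum_subtractf)
qed

text \<open>The trace of the middle block of the curvature is a linear equation for \<open>P'\<close>.\<close>
lemma schouten_g:
  assumes m: "m \<in> M"
  shows "schouten g m f b = P' m b $ f"
proof -
  define t where "t = (\<Sum>a\<in>UNIV. (ginv m *v P' m a) $ a)"
  have gP: "(\<Sum>a\<in>UNIV. (ginv m *v P' m b) $ a * g m $ a $ f) = P' m b $ f" for b f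
  proof -
    have "(\<Sum>a\<in>UNIV. (ginv m *v P' m b) $ a * g m $ a $ f) = (g m *v (ginv m *v P' m b)) $ f"
      by (simp add: matrix_vector_mult_def[of "g m"] g_nth_sym[of m f] mult.commute)
    then show ?thesis by (simp add: matrix_vector_mul_assoc g_ginv[OF m])
  qed
  have ax: "(\<Sum>a\<in>(UNIV::4 set). axis a 1 $ a * x) = 4 * x" "(\<Sum>a\<in>UNIV. axis b 1 $ a * h a) = h b"
    for x :: real and b :: 4 and h :: "4 \<Rightarrow> real"
    by (simp_all add: axis_def if_distrib[of "\<lambda>x. x * _"] cong: if_cong)
  have ric: "ricci g m f b = - 2 * P' m b $ f - t * g m $ b $ f" for f b
  proof -
    have "0 = (\<Sum>a\<in>UNIV. (E m ** W m a b ** \<theta> m) $ a $ f)"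
      using trace_free[OF m] by simp
    also have "\<dots> = ricci g m f b + (4 * P' m b $ f + t * g m $ b $ f) - (P' m b $ f + P' m b $ f)"
      unfolding curvature_\<omega>'_riemann[OF m] sum_subtractf sum.distrib ax gP
      by (simp add: ricci_def t_def sum_distrib_right ax)
    finally show ?thesis by simp
  qed
  have 1: "(\<Sum>a\<in>UNIV. \<Sum>b\<in>UNIV. ginv m $ a $ b * P' m b $ a) = t"
  proof -
    have "ginv m $ a $ b = ginv m $ b $ a" for a b
      using arg_cong[OF ginv_sym, of "\<lambda>A. A $ b $ a" m] by (simp add: transpose_def)
    then show ?thesis
      unfolding t_def by (subst sum.swap) (simp add: matrix_vector_mult_def)
  qed
  have 2: "(\<Sum>a\<in>UNIV. \<Sum>b\<in>UNIV. ginv m $ a $ b * g m $ b $ a) = 4"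
  proof -
    have "(\<Sum>a\<in>UNIV. \<Sum>b\<in>UNIV. ginv m $ a $ b * g m $ b $ a) = (\<Sum>a\<in>UNIV. (ginv m ** g m) $ a $ a)"
      by (simp add: matrix_matrix_mult_def)
    then show ?thesis by (simp add: ginv_g[OF m] mat_def)
  qed
  have "scalar_curv g m = (\<Sum>a\<in>UNIV. \<Sum>b\<in>UNIV.
      - 2 * (ginv m $ a $ b * P' m b $ a) - t * (ginv m $ a $ b * g m $ b $ a))"
    unfolding scalar_curv_def matrix_inv_g[OF m] ric
    by (intro sum.cong refl) (simp add: algebra_simps)
  also have "\<dots> = - 2 * t - t * 4"
    unfolding sum_subtractf sum_distrib_left[symmetric] 1 2 ..
  finally show ?thesis
    by (simp add: schouten_def ric g_nth_sym[of m f b] field_simps)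
qed

lemma coord_conn_g: "m \<in> M \<Longrightarrow> coord_conn g m c = \<omega>' m c"
  unfolding coord_conn_def \<omega>'_shape(1) blk_eq_iff
  by (simp add: vec_eq_iff schouten_g matrix_inv_g christoffel_g)

lemma coord_conn_gauge: "gauge_related M (coord_conn g) K \<omega>"
  using \<omega>'_gauge by (simp add: gauge_related_def coord_conn_g)

text \<open>The middle block of the curvature is the Weyl tensor.\<close>
lemma weyl_g:
  assumes m: "m \<in> M"
  shows "weyl g m a b c d = (g m ** E m ** W m c d ** \<theta> m) $ a $ b"
proof -
  have S: "P' m b $ f = scalar_curv g m / 12 * g m $ f $ b - 1 / 2 * ricci g m f b" for f b
    using schouten_g[OF m, of f b] by (simp add: schouten_def)
  have gP: "(\<Sum>e\<in>UNIV. g m $ a $ e * (ginv m *v P' m b) $ e) = P' m b $ a" for b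
  proof -
    have "(\<Sum>e\<in>UNIV. g m $ a $ e * (ginv m *v P' m b) $ e) = (g m *v (ginv m *v P' m b)) $ a"
      by (simp add: matrix_vector_mult_def[of "g m"])
    then show ?thesis by (simp add: matrix_vector_mul_assoc g_ginv[OF m])
  qed
  have ax: "(\<Sum>e\<in>UNIV. g m $ a $ e * (axis c 1 $ e * x)) = g m $ a $ c * x" for c x
    by (simp add: axis_def if_distrib[of "\<lambda>x. x * _"] if_distrib[of "\<lambda>x. _ * x"] cong: if_cong)
  have "(g m ** E m ** W m c d ** \<theta> m) $ a $ b = (g m ** (E m ** W m c d ** \<theta> m)) $ a $ b"
    by (simp add: matrix_mul_assoc)
  also have "\<dots> = (\<Sum>e\<in>UNIV. g m $ a $ e * (E m ** W m c d ** \<theta> m) $ e $ b)"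
    by (simp add: matrix_matrix_mult_def)
  also have "\<dots> = (\<Sum>e\<in>UNIV. g m $ a $ e * riemann g m e b c d
      + (g m $ a $ e * (axis c 1 $ e * P' m d $ b) + g m $ a $ e * (ginv m *v P' m c) $ e * g m $ d $ b)
      - (g m $ a $ e * (axis d 1 $ e * P' m c $ b) + g m $ a $ e * (ginv m *v P' m d) $ e * g m $ c $ b))"
    unfolding curvature_\<omega>'_riemann[OF m] by (simp add: algebra_simps)
  also have "\<dots> = (\<Sum>e\<in>UNIV. g m $ a $ e * riemann g m e b c d)
      + (g m $ a $ c * P' m d $ b + P' m c $ a * g m $ d $ b)
      - (g m $ a $ d * P' m c $ b + P' m d $ a * g m $ c $ b)"
    unfolding sum_subtractf sum.distrib sum_distrib_right[symmetric] gP ax ..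
  also have "\<dots> = weyl g m a b c d"
    unfolding S weyl_def g_nth_sym[of m d b] g_nth_sym[of m c b] by (simp add: algebra_simps)
  finally show ?thesis ..
qed

end

section \<open>The normal connection of an ordinary differential equation\<close>

text \<open>Vectors of length four, and, with vectors as entries, matrices given by their rows.\<close>
definition row4 :: "'a \<Rightarrow> 'a \<Rightarrow> 'a \<Rightarrow> 'a \<Rightarrow> 'a^4" where
  "row4 a b c d = (\<chi> k. if k = 1 then a else if k = 2 then b else if k = 3 then c else d)"

lemma row4_nth: "row4 a b c d $ 1 = a" "row4 a b c d $ 2 = b" "row4 a b c d $ 3 = c" "row4 a b c d $ 4 = d"
  by (simp_all add: row4_def)

lemma smooth_on_row4:
  assumes "open S" "smooth_on S a" "smooth_on S b" "smooth_on S c" "smooth_on S d"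
  shows "smooth_on S (\<lambda>m. row4 (a m) (b m) (c m) (d m))"
proof (rule smooth_on_componentwise[OF assms(1)])
  fix k :: 4
  consider "k = 1" | "k = 2" | "k = 3" | "k = 4" using exhaust_4 by blast
  then show "smooth_on S (\<lambda>m. row4 (a m) (b m) (c m) (d m) $ k)"
    by cases (simp_all add: row4_nth assms)
qed

lemma antisym_4_cases:
  fixes a b :: 4
  assumes "\<And>a b. R a b \<Longrightarrow> R b a" "\<And>a. R a a" "R 3 4" "R 2 4" "R 1 4" "R 2 3" "R 1 3" "R 1 2"
  shows "R a b"
proof -
  have "\<forall>a b. R a b" using assms unfolding forall_4 by blast
  then show ?thesis by blast
qed

lemma smooth_on_pd_funpow: "smooth_on S F \<Longrightarrow> smooth_on S ((pd k ^^ n) F)"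
  by (induction n) (simp_all add: smooth_on_pd)

lemma pd_funpow_commute:
  fixes F :: "real^'n::finite \<Rightarrow> real"
  assumes S: "open S" and F: "smooth_on S F" and u: "u \<in> S"
  shows "pd k ((pd l ^^ n) F) u = (pd l ^^ n) (pd k F) u"
  using u
proof (induction n arbitrary: u)
  case (Suc n)
  have "pd k (pd l ((pd l ^^ n) F)) u = pd l (pd k ((pd l ^^ n) F)) u"
    by (rule smooth_on_pd_commute_real[OF S smooth_on_pd_funpow[OF F] Suc.prems])
  also have "\<dots> = pd l ((pd l ^^ n) (pd k F)) u"
    by (rule pd_cong[OF S Suc.prems Suc.IH])
  finally show ?case by simp
qed simp

lemma funpow_pd_cong:
  assumes S: "open S" and u: "u \<in> S" and "\<And>u. u \<in> S \<Longrightarrow> F u = G u"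
  shows "(pd l ^^ n) F u = (pd l ^^ n) G u"
  using u
proof (induction n arbitrary: u)
  case (Suc n)
  then show ?case using pd_cong[OF S, of u "(pd l ^^ n) F" "(pd l ^^ n) G"] by simp
qed (use assms in simp)

text \<open>The equation \<open>y'' = Q(x, y, y')\<close>, over the image of \<open>M\<close> in the jet space.\<close>
locale fefferman =
  fixes i :: real and M :: "(real^4) set" and Q :: "real^3 \<Rightarrow> real"
  assumes i_nz: "i \<noteq> 0" and M: "open M" and Q_smooth: "smooth_on (jet ` M) Q"
begin

text \<open>The derivative of \<open>Q\<close> of order \<open>a\<close> in \<open>x\<close>, \<open>b\<close> in \<open>y\<close> and \<open>c\<close> in \<open>p\<close>, as a function of \<open>(x, y, p, \<phi>)\<close>.\<close>
definition q :: "nat \<Rightarrow> nat \<Rightarrow> nat \<Rightarrow> real^4 \<Rightarrow> real" where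
  "q a b c m = (pd 1 ^^ a) ((pd 2 ^^ b) ((pd 3 ^^ c) Q)) (jet m)"

lemma U: "open (jet ` M)"
  by (rule open_jet_image[OF M])

lemma Q_derivs_smooth: "smooth_on (jet ` M) ((pd 1 ^^ a) ((pd 2 ^^ b) ((pd 3 ^^ c) Q)))"
  by (intro smooth_on_pd_funpow Q_smooth)

lemma q_smooth: "smooth_on M (\<lambda>m. q a b c m)"
  unfolding q_def by (rule smooth_on_jet[OF M Q_derivs_smooth])

lemma q_differentiable: "m \<in> M \<Longrightarrow> (\<lambda>m. q a b c m) differentiable (at m)"
  by (rule smooth_on_differentiable[OF q_smooth])

lemma pd_q:
  assumes m: "m \<in> M"
  shows "pd 1 (\<lambda>m. q a b c m) m = q (a + 1) b c m" "pd 2 (\<lambda>m. q a b c m) m = q a (b + 1) c m"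
    "pd 3 (\<lambda>m. q a b c m) m = q a b (c + 1) m" "pd 4 (\<lambda>m. q a b c m) m = 0"
proof -
  have u: "jet m \<in> jet ` M" using m by simp
  have d: "((pd 1 ^^ a) ((pd 2 ^^ b) ((pd 3 ^^ c) Q))) differentiable (at (jet m))"
    by (rule smooth_on_differentiable[OF Q_derivs_smooth u])
  show "pd 1 (\<lambda>m. q a b c m) m = q (a + 1) b c m" "pd 4 (\<lambda>m. q a b c m) m = 0"
    unfolding q_def by (simp_all add: pd_jet[OF d])
  show "pd 2 (\<lambda>m. q a b c m) m = q a (b + 1) c m"
    unfolding q_def
    by (simp add: pd_jet[OF d] pd_funpow_commute[OF U _ u] smooth_on_pd_funpow Q_smooth)
  have "(pd 1 ^^ a) (pd 3 ((pd 2 ^^ b) ((pd 3 ^^ c) Q))) (jet m) = (pd 1 ^^ a) ((pd 2 ^^ b) (pd 3 ((pd 3 ^^ c) Q))) (jet m)"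
    by (rule funpow_pd_cong[OF U u]) (simp add: pd_funpow_commute[OF U] smooth_on_pd_funpow Q_smooth)
  then show "pd 3 (\<lambda>m. q a b c m) m = q a b (c + 1) m"
    unfolding q_def
    by (simp add: pd_jet[OF d] pd_funpow_commute[OF U _ u] smooth_on_pd_funpow Q_smooth)
qed

lemma total_D_jet:
  assumes F: "smooth_on (jet ` M) F" and m: "m \<in> M"
  shows "total_D Q F (jet m) = pd 1 (\<lambda>m. F (jet m)) m + m $ 3 * pd 2 (\<lambda>m. F (jet m)) m + q 0 0 0 m * pd 3 (\<lambda>m. F (jet m)) m"
  using smooth_on_differentiable[OF F, of "jet m"] m
  by (simp add: total_D_def pd_jet jet_nth q_def)

lemma total_D_smooth: "smooth_on (jet ` M) F \<Longrightarrow> smooth_on (jet ` M) (total_D Q F)"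
  unfolding total_D_def[abs_def]
  by (intro smooth_on_add smooth_on_mult smooth_on_coord Q_smooth U smooth_on_pd[of _ F])

lemmas differentiable_simps =
  differentiable_add differentiable_diff differentiable_mult differentiable_minus differentiable_const
  differentiable_coord

lemma differentiable_divide_const:
  fixes f :: "real^'n::finite \<Rightarrow> real"
  shows "f differentiable (at m) \<Longrightarrow> (\<lambda>m. f m / c) differentiable (at m)"
  unfolding divide_inverse by (intro differentiable_mult differentiable_const)

lemma pd_divide_const:
  fixes f :: "real^'n::finite \<Rightarrow> real"
  shows "f differentiable (at m) \<Longrightarrow> pd k (\<lambda>m. f m / c) m = pd k f m / c"
  unfolding divide_inverse by (simp add: pd_mult pd_const differentiable_const)

lemmas pd_simps = pd_add pd_diff pd_mult pd_minus pd_const pd_coord pd_divide_const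
  pd_q q_differentiable differentiable_simps differentiable_divide_const

text \<open>\<open>D Q\<^sub>p\<^sub>p - 4 Q\<^sub>p\<^sub>y\<close>\<close>
definition A :: "real^4 \<Rightarrow> real" where
  "A m = q 1 0 2 m + m $ 3 * q 0 1 2 m + q 0 0 0 m * q 0 0 3 m - 4 * q 0 1 1 m"

text \<open>The expression \<open>w\<^sub>1\<close> written out in the derivatives of \<open>Q\<close>.\<close>
definition W1 :: "real^4 \<Rightarrow> real" where
  "W1 m = q 2 0 2 m + 2 * m $ 3 * q 1 1 2 m + q 1 0 0 m * q 0 0 3 m + 2 * q 0 0 0 m * q 1 0 3 m
     + m $ 3 * m $ 3 * q 0 2 2 m + m $ 3 * q 0 1 0 m * q 0 0 3 m + 2 * m $ 3 * q 0 0 0 m * q 0 1 3 m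
     + q 0 0 0 m * q 0 0 0 m * q 0 0 4 m - 3 * q 0 0 0 m * q 0 1 2 m
     - 4 * q 1 1 1 m - 4 * m $ 3 * q 0 2 1 m
     - q 0 0 1 m * q 1 0 2 m - m $ 3 * q 0 0 1 m * q 0 1 2 m
     + 4 * q 0 0 1 m * q 0 1 1 m - 3 * q 0 0 2 m * q 0 1 0 m + 6 * q 0 2 0 m"

lemma jet_q:
  assumes "m \<in> M"
  shows "Q (jet m) = q 0 0 0 m" "pd 2 Q (jet m) = q 0 1 0 m" "pd 3 Q (jet m) = q 0 0 1 m"
    "pd 3 (pd 3 Q) (jet m) = q 0 0 2 m" "pd 2 (pd 3 Q) (jet m) = q 0 1 1 m" "pd 2 (pd 2 Q) (jet m) = q 0 2 0 m"
    "w2 Q (jet m) = q 0 0 4 m"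
  by (simp_all add: q_def w2_def numeral_eq_Suc)

lemma W1_eq:
  assumes m: "m \<in> M"
  shows "w1 Q (jet m) = W1 m"
proof -
  have Qpp: "smooth_on (jet ` M) (pd 3 (pd 3 Q))" and Qpy: "smooth_on (jet ` M) (pd 2 (pd 3 Q))"
    by (intro smooth_on_pd Q_smooth)+
  have 1: "total_D Q (pd 3 (pd 3 Q)) (jet m) = q 1 0 2 m + m $ 3 * q 0 1 2 m + q 0 0 0 m * q 0 0 3 m" if "m \<in> M" for m
  proof -
    have "pd k (\<lambda>m. pd 3 (pd 3 Q) (jet m)) m = pd k (\<lambda>m. q 0 0 2 m) m" for k
      by (rule pd_cong[OF M that]) (simp add: jet_q)
    then show ?thesis using total_D_jet[OF Qpp that] by (simp add: pd_q that del: One_nat_def)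
  qed
  have 2: "total_D Q (pd 2 (pd 3 Q)) (jet m) = q 1 1 1 m + m $ 3 * q 0 2 1 m + q 0 0 0 m * q 0 1 2 m"
  proof -
    have "pd k (\<lambda>m. pd 2 (pd 3 Q) (jet m)) m = pd k (\<lambda>m. q 0 1 1 m) m" for k
      by (rule pd_cong[OF M m]) (simp add: jet_q)
    then show ?thesis using total_D_jet[OF Qpy m] by (simp add: pd_q m del: One_nat_def)
  qed
  have 3: "pd k (\<lambda>m. total_D Q (pd 3 (pd 3 Q)) (jet m)) m =
      pd k (\<lambda>m. q 1 0 2 m + m $ 3 * q 0 1 2 m + q 0 0 0 m * q 0 0 3 m) m" for k
    by (rule pd_cong[OF M m 1])
  show ?thesis
    unfolding w1_def Let_def total_D_jet[OF total_D_smooth[OF Qpp] m] 3 1[OF m] 2 jet_q[OF m] W1_def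
    by (simp add: pd_simps m del: One_nat_def) (simp add: algebra_simps)
qed

text \<open>
  The coframe \<open>dx\<close>, \<open>dp - Q dx\<close>, \<open>dy - p dx\<close>, \<open>2/3 i d\<phi> + 2/3 Q\<^sub>p dx + 1/6 Q\<^sub>p\<^sub>p (dy - p dx)\<close>, in
  the rows.
\<close>
definition \<theta> :: "real^4 \<Rightarrow> real^4^4" where
  "\<theta> m = row4 (row4 1 0 0 0) (row4 (- q 0 0 0 m) 0 1 0) (row4 (- m $ 3) 1 0 0)
     (row4 (2/3 * q 0 0 1 m - m $ 3 * q 0 0 2 m / 6) (q 0 0 2 m / 6) 0 (2/3 * i))"

text \<open>The dual frame, in the columns.\<close>
definition E :: "real^4 \<Rightarrow> real^4^4" where
  "E m = row4 (row4 1 0 0 0) (row4 (m $ 3) 0 1 0) (row4 (q 0 0 0 m) 1 0 0)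
     (row4 (- q 0 0 1 m / i) 0 (- q 0 0 2 m / (4 * i)) (3 / (2 * i)))"

text \<open>The quadratic form \<open>2 (\<theta>\<^sup>1 \<theta>\<^sup>2 - \<theta>\<^sup>3 \<theta>\<^sup>4)\<close>.\<close>
definition \<eta> :: "real^4^4" where
  "\<eta> = row4 (row4 0 1 0 0) (row4 1 0 0 0) (row4 0 0 0 (-1)) (row4 0 0 (-1) 0)"

text \<open>The frame components of the tensor \<open>P\<close> of the metric with \<open>\<rho> = 1\<close>.\<close>
definition Pmat :: "real^4 \<Rightarrow> real^4^4" where
  "Pmat m = row4 (row4 (q 0 1 0 m / 2) (q 0 0 2 m / 8) (- A m / 12) 0)
     (row4 (q 0 0 2 m / 8) 0 (q 0 0 3 m / 12) 0)
     (row4 (- A m / 12) (q 0 0 3 m / 12)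
        (q 0 0 2 m * q 0 0 2 m / 16 - q 0 0 1 m * q 0 0 3 m / 6
          - (q 1 0 3 m + m $ 3 * q 0 1 3 m + q 0 0 0 m * q 0 0 4 m) / 6 + q 0 1 2 m / 4) 0)
     (row4 0 0 0 (1/4))"

text \<open>The Levi-Civita connection forms of the metric with \<open>\<rho> = 1\<close> are \<open>\<Gamma> = \<Sum>\<^sub>\<mu> G\<^sub>\<mu> \<theta>\<^sup>\<mu>\<close>.\<close>
definition G1 :: "real^4 \<Rightarrow> real^4^4" where
  "G1 m = row4 (row4 (q 0 0 1 m) 0 (q 0 0 2 m / 4) (-1/2)) (row4 0 (- q 0 0 1 m) (- q 0 1 0 m) 0)
     (row4 0 (-1/2) 0 0) (row4 (- q 0 1 0 m) (q 0 0 2 m / 4) 0 0)"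

definition G2 :: "real^4 \<Rightarrow> real^4^4" where
  "G2 m = row4 (row4 0 0 0 0) (row4 0 0 (- q 0 0 2 m / 4) (1/2)) (row4 (1/2) 0 0 0)
     (row4 (- q 0 0 2 m / 4) 0 0 0)"

definition G3 :: "real^4 \<Rightarrow> real^4^4" where
  "G3 m = row4 (row4 (q 0 0 2 m / 4) 0 (q 0 0 3 m / 6) 0) (row4 0 (- q 0 0 2 m / 4) (A m / 6) 0)
     (row4 0 0 0 0) (row4 (A m / 6) (q 0 0 3 m / 6) 0 0)"

definition G4 :: "real^4^4" where
  "G4 = row4 (row4 (-1/2) 0 0 0) (row4 0 (1/2) 0 0) (row4 0 0 0 0) (row4 0 0 0 0)"

definition P :: "real^4 \<Rightarrow> 4 \<Rightarrow> real^4" where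
  "P m c = Pmat m *v (\<theta> m *v axis c 1)"

definition \<Gamma> :: "real^4 \<Rightarrow> 4 \<Rightarrow> real^4^4" where
  "\<Gamma> m c = \<theta> m $ 1 $ c *\<^sub>R G1 m + \<theta> m $ 2 $ c *\<^sub>R G2 m + \<theta> m $ 3 $ c *\<^sub>R G3 m + \<theta> m $ 4 $ c *\<^sub>R G4"

text \<open>The normal conformal connection of the metric with \<open>\<rho> = 1\<close>; the argument \<open>c\<close> is the \<open>dx\<^sup>c\<close>-component.\<close>
definition \<omega> :: "real^4 \<Rightarrow> 4 \<Rightarrow> real^six^six" where
  "\<omega> m c = blk 0 (P m c) 0 (\<theta> m *v axis c 1) (\<Gamma> m c) (\<eta> *v P m c) 0 (\<eta> *v (\<theta> m *v axis c 1)) 0"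

text \<open>
  The blocks of the matrices \<open>N\<^sub>1\<close> and \<open>N\<^sub>2\<close> for which the curvature of \<open>\<omega>\<close> is
  \<open>N\<^sub>1 \<theta>\<^sup>1 \<and> \<theta>\<^sup>3 + N\<^sub>2 \<theta>\<^sup>2 \<and> \<theta>\<^sup>3\<close>.  The middle blocks \<open>V\<close> form the Weyl tensor, the rows
  \<open>Y\<close> the Cotton tensor; \<open>w\<^sub>2\<close> is \<open>q 0 0 4\<close>.
\<close>
definition Y1 :: "real^4 \<Rightarrow> real^4" where
  "Y1 m = row4 (- W1 m / 12) 0 (- pd 3 W1 m / 6) 0"

definition V1 :: "real^4 \<Rightarrow> real^4^4" where
  "V1 m = row4 0 (row4 0 0 (W1 m / 6) 0) 0 (row4 (W1 m / 6) 0 0 0)"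

definition Y2 :: "real^4 \<Rightarrow> real^4" where
  "Y2 m = row4 0 (q 0 0 4 m / 12)
     (- (q 1 0 4 m + m $ 3 * q 0 1 4 m + q 0 0 0 m * q 0 0 5 m + 2 * q 0 0 1 m * q 0 0 4 m) / 6) 0"

definition V2 :: "real^4 \<Rightarrow> real^4^4" where
  "V2 m = row4 (row4 0 0 (q 0 0 4 m / 6) 0) 0 0 (row4 0 (q 0 0 4 m / 6) 0 0)"

definition N1 :: "real^4 \<Rightarrow> real^six^six" where
  "N1 m = blk 0 (Y1 m) 0 0 (V1 m) (\<eta> *v Y1 m) 0 0 0"

definition N2 :: "real^4 \<Rightarrow> real^six^six" where
  "N2 m = blk 0 (Y2 m) 0 0 (V2 m) (\<eta> *v Y2 m) 0 0 0"

lemma \<theta>_smooth: "smooth_on M \<theta>"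
  unfolding \<theta>_def[abs_def]
  by (intro smooth_on_row4 smooth_on_const smooth_on_minus smooth_on_diff smooth_on_mult smooth_on_divide
      smooth_on_coord q_smooth M) simp_all

lemma E_smooth: "smooth_on M E"
  unfolding E_def[abs_def]
  by (intro smooth_on_row4 smooth_on_const smooth_on_minus smooth_on_diff smooth_on_mult smooth_on_divide
      smooth_on_coord q_smooth M) (simp_all add: i_nz)

lemma E_\<theta>: "E m ** \<theta> m = mat 1"
  using i_nz by (simp add: vec_eq_iff forall_4 matrix_matrix_mult_def sum_4 E_def \<theta>_def row4_nth mat_def)
     (simp add: field_simps)

lemma \<eta>_sym: "transpose \<eta> = \<eta>" and \<eta>_sq: "\<eta> ** \<eta> = mat 1"
  by (simp_all add: vec_eq_iff forall_4 matrix_matrix_mult_def transpose_def sum_4 \<eta>_def row4_nth mat_def)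

lemma A_smooth: "smooth_on M A"
  unfolding A_def[abs_def]
  by (intro smooth_on_const smooth_on_add smooth_on_diff smooth_on_mult smooth_on_coord q_smooth M)

lemma W1_smooth: "smooth_on M W1"
  unfolding W1_def[abs_def]
  by (intro smooth_on_const smooth_on_add smooth_on_diff smooth_on_mult smooth_on_coord q_smooth M)

lemma \<omega>_smooth: "smooth_on M (\<lambda>m. \<omega> m c)"
proof -
  have \<theta>: "smooth_on M (\<lambda>m. \<theta> m $ k $ c)" for k by (intro smooth_on_vec_nth M \<theta>_smooth)
  have \<theta>c: "smooth_on M (\<lambda>m. \<theta> m *v axis c 1)"
    by (intro smooth_on_matrix_vector smooth_on_const M \<theta>_smooth)
  have A: "smooth_on M (\<lambda>m. - A m / k)" "smooth_on M (\<lambda>m. A m / k)" for k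
    unfolding divide_inverse by (intro smooth_on_mult smooth_on_minus smooth_on_const A_smooth M)+
  have PG: "smooth_on M Pmat" "smooth_on M G1" "smooth_on M G2" "smooth_on M G3"
    unfolding Pmat_def[abs_def] G1_def[abs_def] G2_def[abs_def] G3_def[abs_def]
    by (intro smooth_on_row4 smooth_on_const smooth_on_minus smooth_on_diff smooth_on_add A smooth_on_mult smooth_on_divide
      smooth_on_coord q_smooth M; simp)+
  show ?thesis
    unfolding \<omega>_def P_def \<Gamma>_def
    by (intro smooth_on_blk smooth_on_matrix_vector smooth_on_scaleR smooth_on_add smooth_on_const
        \<theta> \<theta>c M PG)
qed

lemma \<Gamma>_so: "transpose (\<Gamma> m c) ** \<eta> + \<eta> ** \<Gamma> m c = 0"
  by (simp add: vec_eq_iff forall_4 matrix_matrix_mult_def transpose_def sum_4 \<eta>_def \<Gamma>_def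
      G1_def G2_def G3_def G4_def row4_nth)

lemma \<omega>_differentiable: "m \<in> M \<Longrightarrow> (\<lambda>m. \<omega> m c) differentiable (at m)"
  by (rule smooth_on_differentiable[OF \<omega>_smooth])

lemmas explicit_blk = P_def \<Gamma>_def matrix_vector_mult_def sum_4 \<theta>_def \<eta>_def row4_nth Pmat_def
   G1_def G2_def G3_def G4_def axis_def A_def vec_eq_iff forall_4

text \<open>The coordinate components of \<open>\<omega>\<close>, expanded.\<close>
lemma \<omega>_1:
  "\<omega> m 1 = blk
    0 (row4 (q 0 1 0 m / 2 - q 0 0 0 m * q 0 0 2 m / 8 - q 0 1 1 m * m $ 3 / 3
      + q 0 1 2 m * m $ 3 * m $ 3 / 12 + q 1 0 2 m * m $ 3 / 12
      + q 0 0 0 m * q 0 0 3 m * m $ 3 / 12) (q 0 0 2 m / 8 - q 0 0 3 m * m $ 3 / 12)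
      (q 0 1 1 m / 3 - q 1 0 2 m / 12 - q 0 0 0 m * q 0 0 3 m / 6
      - q 0 0 2 m * q 0 0 2 m * m $ 3 / 16 - q 0 1 2 m * m $ 3 / 3
      + q 0 1 3 m * m $ 3 * m $ 3 / 6 + q 1 0 3 m * m $ 3 / 6
      + q 0 0 0 m * q 0 0 4 m * m $ 3 / 6 + q 0 0 1 m * q 0 0 3 m * m $ 3 / 6) (q 0 0 1 m / 6
      - q 0 0 2 m * m $ 3 / 24)) 0
    (row4 1 (- q 0 0 0 m) (- m $ 3) (2 * q 0 0 1 m / 3 - q 0 0 2 m * m $ 3 / 6))
    (row4
      (row4 (2 * q 0 0 1 m / 3 - q 0 0 2 m * m $ 3 / 6) 0 (q 0 0 2 m / 4
        - q 0 0 3 m * m $ 3 / 6) (- 1 / 2))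
      (row4 0 (- 2 * q 0 0 1 m / 3 + q 0 0 2 m * m $ 3 / 6) (- q 0 1 0 m
        + q 0 0 0 m * q 0 0 2 m / 4 + 2 * q 0 1 1 m * m $ 3 / 3 - q 0 1 2 m * m $ 3 * m $ 3 / 6
        - q 1 0 2 m * m $ 3 / 6 - q 0 0 0 m * q 0 0 3 m * m $ 3 / 6) (- q 0 0 0 m / 2))
      (row4 (- q 0 0 0 m / 2) (- 1 / 2) 0 0)
      (row4 (- q 0 1 0 m + q 0 0 0 m * q 0 0 2 m / 4 + 2 * q 0 1 1 m * m $ 3 / 3
        - q 0 1 2 m * m $ 3 * m $ 3 / 6 - q 1 0 2 m * m $ 3 / 6
        - q 0 0 0 m * q 0 0 3 m * m $ 3 / 6) (q 0 0 2 m / 4 - q 0 0 3 m * m $ 3 / 6) 0 0))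
    (row4 (q 0 0 2 m / 8 - q 0 0 3 m * m $ 3 / 12) (q 0 1 0 m / 2 - q 0 0 0 m * q 0 0 2 m / 8
      - q 0 1 1 m * m $ 3 / 3 + q 0 1 2 m * m $ 3 * m $ 3 / 12 + q 1 0 2 m * m $ 3 / 12
      + q 0 0 0 m * q 0 0 3 m * m $ 3 / 12) (- q 0 0 1 m / 6 + q 0 0 2 m * m $ 3 / 24)
      (- q 0 1 1 m / 3 + q 1 0 2 m / 12 + q 0 0 0 m * q 0 0 3 m / 6
      + q 0 0 2 m * q 0 0 2 m * m $ 3 / 16 + q 0 1 2 m * m $ 3 / 3
      - q 0 1 3 m * m $ 3 * m $ 3 / 6 - q 1 0 3 m * m $ 3 / 6
      - q 0 0 0 m * q 0 0 4 m * m $ 3 / 6 - q 0 0 1 m * q 0 0 3 m * m $ 3 / 6)) 0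
    (row4 (- q 0 0 0 m) 1 (- 2 * q 0 0 1 m / 3 + q 0 0 2 m * m $ 3 / 6) (m $ 3)) 0"
  unfolding \<omega>_def blk_eq_iff by (simp add: explicit_blk) (simp add: field_simps)?

lemma \<omega>_2:
  "\<omega> m 2 = blk
    0 (row4 (q 0 1 1 m / 3 - q 1 0 2 m / 12 - q 0 0 0 m * q 0 0 3 m / 12
      - q 0 1 2 m * m $ 3 / 12) (q 0 0 3 m / 12) (q 0 0 2 m * q 0 0 2 m / 16 + q 0 1 2 m / 4
      - q 1 0 3 m / 6 - q 0 0 0 m * q 0 0 4 m / 6 - q 0 0 1 m * q 0 0 3 m / 6
      - q 0 1 3 m * m $ 3 / 6) (q 0 0 2 m / 24)) 0
    (row4 0 0 1 (q 0 0 2 m / 6))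
    (row4
      (row4 (q 0 0 2 m / 6) 0 (q 0 0 3 m / 6) 0)
      (row4 0 (- q 0 0 2 m / 6) (- 2 * q 0 1 1 m / 3 + q 1 0 2 m / 6 + q 0 0 0 m * q 0 0 3 m / 6
        + q 0 1 2 m * m $ 3 / 6) 0)
      (row4 0 0 0 0)
      (row4 (- 2 * q 0 1 1 m / 3 + q 1 0 2 m / 6 + q 0 0 0 m * q 0 0 3 m / 6
        + q 0 1 2 m * m $ 3 / 6) (q 0 0 3 m / 6) 0 0))
    (row4 (q 0 0 3 m / 12) (q 0 1 1 m / 3 - q 1 0 2 m / 12 - q 0 0 0 m * q 0 0 3 m / 12
      - q 0 1 2 m * m $ 3 / 12) (- q 0 0 2 m / 24) (- q 0 0 2 m * q 0 0 2 m / 16 - q 0 1 2 m / 4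
      + q 1 0 3 m / 6 + q 0 0 0 m * q 0 0 4 m / 6 + q 0 0 1 m * q 0 0 3 m / 6
      + q 0 1 3 m * m $ 3 / 6)) 0
    (row4 0 0 (- q 0 0 2 m / 6) (- 1)) 0"
  unfolding \<omega>_def blk_eq_iff by (simp add: explicit_blk) (simp add: field_simps)?

lemma \<omega>_3:
  "\<omega> m 3 = blk
    0 (row4 (q 0 0 2 m / 8) 0 (q 0 0 3 m / 12) 0) 0
    (row4 0 1 0 0)
    (row4
      (row4 0 0 0 0)
      (row4 0 0 (- q 0 0 2 m / 4) (1 / 2))
      (row4 (1 / 2) 0 0 0)
      (row4 (- q 0 0 2 m / 4) 0 0 0))
    (row4 0 (q 0 0 2 m / 8) 0 (- q 0 0 3 m / 12)) 0
    (row4 1 0 0 0) 0"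
  unfolding \<omega>_def blk_eq_iff by (simp add: explicit_blk) (simp add: field_simps)?

lemma \<omega>_4:
  "\<omega> m 4 = blk
    0 (row4 0 0 0 (i / 6)) 0
    (row4 0 0 0 (2 * i / 3))
    (row4
      (row4 (- i / 3) 0 0 0)
      (row4 0 (i / 3) 0 0)
      (row4 0 0 0 0)
      (row4 0 0 0 0))
    (row4 0 0 (- i / 6) 0) 0
    (row4 0 0 (- 2 * i / 3) 0) 0"
  unfolding \<omega>_def blk_eq_iff by (simp add: explicit_blk) (simp add: field_simps)?

lemma pd_3_W1:
  assumes "m \<in> M"
  shows "pd 3 W1 m =
    2 * q 0 2 1 m - 2 * q 1 1 2 m + q 2 0 3 m - q 0 0 0 m * q 0 1 3 m
      + 2 * q 0 0 0 m * q 1 0 4 m + q 0 0 0 m * q 0 0 0 m * q 0 0 5 m + q 0 0 1 m * q 1 0 3 m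
      + q 0 0 2 m * q 0 1 1 m - q 0 0 2 m * q 1 0 2 m - 2 * q 0 0 3 m * q 0 1 0 m
      + q 0 0 3 m * q 1 0 1 m + q 0 0 4 m * q 1 0 0 m - 2 * q 0 2 2 m * m $ 3
      + q 0 2 3 m * m $ 3 * m $ 3 + 2 * q 1 1 3 m * m $ 3
      + 2 * q 0 0 0 m * q 0 0 1 m * q 0 0 4 m + 2 * q 0 0 0 m * q 0 1 4 m * m $ 3
      + q 0 0 1 m * q 0 1 3 m * m $ 3 - q 0 0 2 m * q 0 1 2 m * m $ 3
      + q 0 0 3 m * q 0 1 1 m * m $ 3 + q 0 0 4 m * q 0 1 0 m * m $ 3"
  unfolding W1_def[abs_def] using assms
  by (simp add: pd_simps del: One_nat_def) (simp add: algebra_simps)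

lemmas curv_simps = all_six forall_4 curvature_form_nth[OF \<omega>_differentiable]
  matrix_matrix_mult_def sum_six sum_4 \<omega>_1 \<omega>_2 \<omega>_3 \<omega>_4 blk_nth row4_nth
  wedge_def \<theta>_def N1_def N2_def Y1_def Y2_def V1_def V2_def matrix_vector_mult_def \<eta>_def

text \<open>Every entry is an identity of polynomials in \<open>p\<close> and the derivatives of \<open>Q\<close>.\<close>
lemma
  assumes m: "m \<in> M"
  shows curvature_12: "curvature_form \<omega> m 1 2 =
      wedge (\<theta> m $ 1) (\<theta> m $ 3) 1 2 *\<^sub>R N1 m + wedge (\<theta> m $ 2) (\<theta> m $ 3) 1 2 *\<^sub>R N2 m"
    and curvature_13: "curvature_form \<omega> m 1 3 =
      wedge (\<theta> m $ 1) (\<theta> m $ 3) 1 3 *\<^sub>R N1 m + wedge (\<theta> m $ 2) (\<theta> m $ 3) 1 3 *\<^sub>R N2 m"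
    and curvature_14: "curvature_form \<omega> m 1 4 =
      wedge (\<theta> m $ 1) (\<theta> m $ 3) 1 4 *\<^sub>R N1 m + wedge (\<theta> m $ 2) (\<theta> m $ 3) 1 4 *\<^sub>R N2 m"
    and curvature_23: "curvature_form \<omega> m 2 3 =
      wedge (\<theta> m $ 1) (\<theta> m $ 3) 2 3 *\<^sub>R N1 m + wedge (\<theta> m $ 2) (\<theta> m $ 3) 2 3 *\<^sub>R N2 m"
    and curvature_24: "curvature_form \<omega> m 2 4 =
      wedge (\<theta> m $ 1) (\<theta> m $ 3) 2 4 *\<^sub>R N1 m + wedge (\<theta> m $ 2) (\<theta> m $ 3) 2 4 *\<^sub>R N2 m"
    and curvature_34: "curvature_form \<omega> m 3 4 =
      wedge (\<theta> m $ 1) (\<theta> m $ 3) 3 4 *\<^sub>R N1 m + wedge (\<theta> m $ 2) (\<theta> m $ 3) 3 4 *\<^sub>R N2 m"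
  by (subst vec_eq_iff, subst vec_eq_iff, simp add: m curv_simps del: One_nat_def;
      (simp add: m pd_simps pd_3_W1 W1_def del: One_nat_def)?; (simp add: field_simps)?)+

lemma curvature_\<omega>:
  assumes m: "m \<in> M"
  shows "curvature_form \<omega> m a b =
    wedge (\<theta> m $ 1) (\<theta> m $ 3) a b *\<^sub>R N1 m + wedge (\<theta> m $ 2) (\<theta> m $ 3) a b *\<^sub>R N2 m"
proof (induction a b rule: antisym_4_cases)
  case (1 a b)
  have "curvature_form \<omega> m b a = - curvature_form \<omega> m a b"
    by (simp add: curvature_form_def)
  moreover have "wedge \<alpha> \<beta> b a = - wedge \<alpha> \<beta> a b" for \<alpha> \<beta>
    by (simp add: wedge_def)
  ultimately show ?case using 1 by simp
next
  case (2 a)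
  then show ?case by (simp add: curvature_form_def wedge_def)
qed (fact curvature_34[OF m] curvature_24[OF m] curvature_14[OF m] curvature_23[OF m]
    curvature_13[OF m] curvature_12[OF m])+

text \<open>Normality: the contraction of the middle block of the curvature vanishes.\<close>
lemma trace_free:
  assumes W: "W = (\<lambda>a b. wedge (\<theta> m $ 1) (\<theta> m $ 3) a b *\<^sub>R V1 m + wedge (\<theta> m $ 2) (\<theta> m $ 3) a b *\<^sub>R V2 m)"
  shows "(\<Sum>a\<in>UNIV. (E m ** W a d ** \<theta> m) $ a $ b) = 0"
proof -
  have "\<forall>b d. (\<Sum>a\<in>UNIV. (E m ** W a d ** \<theta> m) $ a $ b) = 0"
    unfolding forall_4 using i_nz
    by (simp add: W sum_4 matrix_matrix_mult_def wedge_def E_def \<theta>_def V1_def V2_def row4_nth)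
       (simp add: field_simps)?
  then show ?thesis by blast
qed

end

text \<open>A member of the conformal class, and a sign \<open>s\<close> for the orientation (not yet restricted).\<close>
locale fefferman_conformal = fefferman +
  fixes \<rho> :: "real^4 \<Rightarrow> real" and s :: real
  assumes \<rho>_smooth: "smooth_on M \<rho>" and \<rho>_nz: "\<And>m. m \<in> M \<Longrightarrow> \<rho> m \<noteq> 0"
begin

text \<open>The two null two-forms that carry the curvature.\<close>
abbreviation \<sigma>1 :: "real^4 \<Rightarrow> 4 \<Rightarrow> 4 \<Rightarrow> real" where
  "\<sigma>1 m \<equiv> wedge (\<theta> m $ 1) (\<theta> m $ 3)"

abbreviation \<sigma>2 :: "real^4 \<Rightarrow> 4 \<Rightarrow> 4 \<Rightarrow> real" where
  "\<sigma>2 m \<equiv> wedge (\<theta> m $ 2) (\<theta> m $ 3)"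

sublocale nc: normal_connection M \<theta> E \<eta> \<rho> P \<Gamma>
  "\<lambda>m a b. \<sigma>1 m a b *\<^sub>R Y1 m + \<sigma>2 m a b *\<^sub>R Y2 m"
  "\<lambda>m a b. \<sigma>1 m a b *\<^sub>R (\<eta> *v Y1 m) + \<sigma>2 m a b *\<^sub>R (\<eta> *v Y2 m)"
  "\<lambda>m a b. \<sigma>1 m a b *\<^sub>R V1 m + \<sigma>2 m a b *\<^sub>R V2 m" \<omega>
proof (unfold_locales)
  fix m a b assume m: "m \<in> M"
  show "curvature_form \<omega> m a b = blk 0 (\<sigma>1 m a b *\<^sub>R Y1 m + \<sigma>2 m a b *\<^sub>R Y2 m) 0 0
    (\<sigma>1 m a b *\<^sub>R V1 m + \<sigma>2 m a b *\<^sub>R V2 m) (\<sigma>1 m a b *\<^sub>R (\<eta> *v Y1 m) + \<sigma>2 m a b *\<^sub>R (\<eta> *v Y2 m)) 0 0 0"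
    unfolding curvature_\<omega>[OF m] N1_def N2_def by (simp add: blk_scaleR blk_add)
qed (rule \<omega>_def M \<theta>_smooth E_smooth E_\<theta> \<eta>_sym \<eta>_sq \<omega>_smooth \<rho>_smooth \<Gamma>_so trace_free[OF refl] | simp add: \<rho>_nz)+

lemma contact_form_\<theta>: "contact_form m = \<theta> m $ 3" and form_dx_\<theta>: "form_dx = \<theta> m $ 1"
  by (simp_all add: vec_eq_iff forall_4 contact_form_def \<theta>_def row4_nth axis_def)

lemma fefferman_metric_eq:
  assumes m: "m \<in> M"
  shows "fefferman_metric i \<rho> Q m = nc.g m"
  unfolding nc.g_def
  by (simp add: vec_eq_iff forall_4 fefferman_metric_def Let_def jet_q[OF m] sym_prod_def
      contact_form_def axis_def matrix_matrix_mult_def transpose_def sum_4 \<theta>_def \<eta>_def row4_nth)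
     (simp add: field_simps)?

lemma signature:
  assumes m: "m \<in> M"
  shows "has_signature_2_2 (nc.g m)"
proof -
  \<comment> \<open>The columns are \<open>e\<^sub>1 + e\<^sub>2\<close>, \<open>e\<^sub>3 - e\<^sub>4\<close>, \<open>e\<^sub>1 - e\<^sub>2\<close>, \<open>e\<^sub>3 + e\<^sub>4\<close> in the dual frame.\<close>
  define C :: "real^4^4" where
    "C = row4 (row4 1 0 1 0) (row4 1 0 (-1) 0) (row4 0 1 0 1) (row4 0 (-1) 0 1)"
  define D :: "real^4^4" where
    "D = (\<chi> a b. if a = b then (if a = 1 \<or> a = 2 then 1 else - 1) else 0)"
  define B where "B = inverse (\<rho> m * sqrt 2) *\<^sub>R (E m ** C)"
  have C: "transpose C ** \<eta> ** C = 2 *\<^sub>R D"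
    by (simp add: C_def D_def vec_eq_iff forall_4 matrix_matrix_mult_def transpose_def sum_4 \<eta>_def row4_nth)
  have D: "D ** D = mat 1"
    by (simp add: D_def vec_eq_iff forall_4 matrix_matrix_mult_def mat_def sum_4)
  have "transpose (E m ** C) ** (transpose (\<theta> m) ** \<eta> ** \<theta> m) ** (E m ** C)
      = transpose C ** (transpose (E m) ** transpose (\<theta> m)) ** \<eta> ** (\<theta> m ** E m) ** C"
    by (simp add: matrix_transpose_mul matrix_mul_assoc)
  also have "\<dots> = 2 *\<^sub>R D"
    by (simp add: nc.E_\<theta>_transpose[OF m] nc.\<theta>_E[OF m] C)
  finally have B: "transpose B ** nc.g m ** B = D"
    using \<rho>_nz[OF m] by (simp add: B_def nc.g_def transpose_scalar matrix_bilinear_simps power2_eq_square field_simps)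
  then have "(D ** transpose B ** nc.g m) ** B = mat 1"
    using D by (simp flip: matrix_mul_assoc)
  then have "invertible B"
    using matrix_left_right_inverse unfolding invertible_def by blast
  then show ?thesis unfolding has_signature_2_2_def using B D_def by blast
qed

end

section \<open>The Hodge star\<close>

lemma det_4:
  "det (A::'a::comm_ring_1^4^4) =
     A$1$1 * (A$2$2 * (A$3$3 * A$4$4 - A$3$4 * A$4$3) - A$2$3 * (A$3$2 * A$4$4 - A$3$4 * A$4$2) + A$2$4 * (A$3$2 * A$4$3 - A$3$3 * A$4$2))
   - A$1$2 * (A$2$1 * (A$3$3 * A$4$4 - A$3$4 * A$4$3) - A$2$3 * (A$3$1 * A$4$4 - A$3$4 * A$4$1) + A$2$4 * (A$3$1 * A$4$3 - A$3$3 * A$4$1))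
   + A$1$3 * (A$2$1 * (A$3$2 * A$4$4 - A$3$4 * A$4$2) - A$2$2 * (A$3$1 * A$4$4 - A$3$4 * A$4$1) + A$2$4 * (A$3$1 * A$4$2 - A$3$2 * A$4$1))
   - A$1$4 * (A$2$1 * (A$3$2 * A$4$3 - A$3$3 * A$4$2) - A$2$2 * (A$3$1 * A$4$3 - A$3$3 * A$4$1) + A$2$3 * (A$3$1 * A$4$2 - A$3$2 * A$4$1))"
proof -
  have f1234: "finite {2::4, 3, 4}" "1 \<notin> {2::4, 3, 4}" by auto
  have f234: "finite {3::4, 4}" "2 \<notin> {3::4, 4}" by auto
  have f34: "finite {4::4}" "3 \<notin> {4::4}" by auto
  show ?thesis
    unfolding det_def UNIV_4
    unfolding sum_over_permutations_insert[OF f1234]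
    unfolding sum_over_permutations_insert[OF f234]
    unfolding sum_over_permutations_insert[OF f34]
    unfolding permutes_sing
    by (simp add: sign_swap_id permutation_swap_id sign_compose sign_id swap_id_eq permutation_compose)
       (simp add: algebra_simps)
qed

lemma axis_nth_4:
  "(axis 1 1 :: real^4) $ 1 = 1" "(axis 1 1 :: real^4) $ 2 = 0" "(axis 1 1 :: real^4) $ 3 = 0" "(axis 1 1 :: real^4) $ 4 = 0"
  "(axis 2 1 :: real^4) $ 1 = 0" "(axis 2 1 :: real^4) $ 2 = 1" "(axis 2 1 :: real^4) $ 3 = 0" "(axis 2 1 :: real^4) $ 4 = 0"
  "(axis 3 1 :: real^4) $ 1 = 0" "(axis 3 1 :: real^4) $ 2 = 0" "(axis 3 1 :: real^4) $ 3 = 1" "(axis 3 1 :: real^4) $ 4 = 0"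
  "(axis 4 1 :: real^4) $ 1 = 0" "(axis 4 1 :: real^4) $ 2 = 0" "(axis 4 1 :: real^4) $ 3 = 0" "(axis 4 1 :: real^4) $ 4 = 1"
  by (simp_all add: axis_def)

text \<open>The two-form with components \<open>1/2 \<epsilon>\<^sub>a\<^sub>b\<^sub>c\<^sub>d (u \<and> v)\<^sup>c\<^sup>d\<close>.\<close>
definition dual_bivector :: "real^4 \<Rightarrow> real^4 \<Rightarrow> real^4^4" where
  "dual_bivector u v = row4
    (row4 0 (u$3 * v$4 - u$4 * v$3) (u$4 * v$2 - u$2 * v$4) (u$2 * v$3 - u$3 * v$2))
    (row4 (u$4 * v$3 - u$3 * v$4) 0 (u$1 * v$4 - u$4 * v$1) (u$3 * v$1 - u$1 * v$3))
    (row4 (u$2 * v$4 - u$4 * v$2) (u$4 * v$1 - u$1 * v$4) 0 (u$1 * v$2 - u$2 * v$1))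
    (row4 (u$3 * v$2 - u$2 * v$3) (u$1 * v$3 - u$3 * v$1) (u$2 * v$1 - u$1 * v$2) 0)"

lemma perm_symbol_dual_bivector: "perm_symbol a b c d = dual_bivector (axis c 1) (axis d 1) $ a $ b"
proof -
  have "\<forall>a b. perm_symbol a b c d = dual_bivector (axis c 1) (axis d 1) $ a $ b"
    unfolding forall_4 perm_symbol_def det_4 dual_bivector_def row4_nth
    by (simp add: axis_nth_4 vec_lambda_beta)
  then show ?thesis by blast
qed

lemma sum_axis_nth: "(\<Sum>c\<in>UNIV. axis c 1 $ k * u $ c) = u $ k" for u :: "real^'n::finite"
  by (simp add: axis_def if_distrib[of "\<lambda>x. x * _"] cong: if_cong)

lemma sum_perm_symbol:
  "(\<Sum>c\<in>UNIV. \<Sum>d\<in>UNIV. perm_symbol a b c d * (u $ c * v $ d)) = dual_bivector u v $ a $ b"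
proof -
  have *: "(\<Sum>c\<in>UNIV. \<Sum>d\<in>UNIV. (axis c 1 $ k * axis d 1 $ l - axis c 1 $ k' * axis d 1 $ l') * (u $ c * v $ d))
      = u $ k * v $ l - u $ k' * v $ l'" for k l k' l' :: 4
  proof -
    have "(\<Sum>c\<in>UNIV. \<Sum>d\<in>UNIV. (axis c 1 $ k * axis d 1 $ l - axis c 1 $ k' * axis d 1 $ l') * (u $ c * v $ d))
      = (\<Sum>c\<in>UNIV. axis c 1 $ k * u $ c) * (\<Sum>d\<in>UNIV. axis d 1 $ l * v $ d)
      - (\<Sum>c\<in>UNIV. axis c 1 $ k' * u $ c) * (\<Sum>d\<in>UNIV. axis d 1 $ l' * v $ d)"
      unfolding sum_product sum_subtractf[symmetric] by (intro sum.cong refl) (simp add: algebra_simps)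
    then show ?thesis by (simp only: sum_axis_nth)
  qed
  have "\<forall>a b. (\<Sum>c\<in>UNIV. \<Sum>d\<in>UNIV. perm_symbol a b c d * (u $ c * v $ d)) = dual_bivector u v $ a $ b"
    unfolding forall_4 perm_symbol_dual_bivector unfolding dual_bivector_def row4_nth * by simp
  then show ?thesis by blast
qed

lemma sum_raise:
  "(\<Sum>c\<in>UNIV. \<Sum>d\<in>UNIV. \<Sum>e\<in>UNIV. \<Sum>f\<in>UNIV. (k * T c d * Gi $ c $ e * Gi $ d $ f) * wedge \<alpha> \<beta> e f)
    = k * ((\<Sum>c\<in>UNIV. \<Sum>d\<in>UNIV. T c d * ((Gi *v \<alpha>) $ c * (Gi *v \<beta>) $ d))
       - (\<Sum>c\<in>UNIV. \<Sum>d\<in>UNIV. T c d * ((Gi *v \<beta>) $ c * (Gi *v \<alpha>) $ d)))"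
proof -
  have "(\<Sum>e\<in>UNIV. \<Sum>f\<in>UNIV. (k * T c d * Gi $ c $ e * Gi $ d $ f) * wedge \<alpha> \<beta> e f)
    = k * (T c d * ((Gi *v \<alpha>) $ c * (Gi *v \<beta>) $ d) - T c d * ((Gi *v \<beta>) $ c * (Gi *v \<alpha>) $ d))" for c d
  proof -
    have "(\<Sum>e\<in>UNIV. \<Sum>f\<in>UNIV. (k * T c d * Gi $ c $ e * Gi $ d $ f) * wedge \<alpha> \<beta> e f) =
      (\<Sum>e\<in>UNIV. \<Sum>f\<in>UNIV. k * T c d * ((Gi $ c $ e * \<alpha> $ e) * (Gi $ d $ f * \<beta> $ f))
        - k * T c d * ((Gi $ c $ e * \<beta> $ e) * (Gi $ d $ f * \<alpha> $ f)))"
      by (intro sum.cong refl) (simp add: wedge_def algebra_simps)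
    also have "\<dots> = k * T c d * ((\<Sum>e\<in>UNIV. Gi $ c $ e * \<alpha> $ e) * (\<Sum>f\<in>UNIV. Gi $ d $ f * \<beta> $ f))
        - k * T c d * ((\<Sum>e\<in>UNIV. Gi $ c $ e * \<beta> $ e) * (\<Sum>f\<in>UNIV. Gi $ d $ f * \<alpha> $ f))"
      by (simp only: sum_subtractf sum_distrib_left[symmetric] sum_distrib_right[symmetric])
    finally
    show ?thesis by (simp add: matrix_vector_mult_def algebra_simps)
  qed
  then show ?thesis by (simp add: sum_subtractf flip: sum_distrib_left)
qed

lemma star_wedge:
  "star s G (wedge \<alpha> \<beta>) a b =
    s * sqrt \<bar>det G\<bar> * dual_bivector (matrix_inv G *v \<alpha>) (matrix_inv G *v \<beta>) $ a $ b"
proof -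
  have "dual_bivector u v $ a $ b - dual_bivector v u $ a $ b = 2 * dual_bivector u v $ a $ b" for u v
  proof -
    have "\<forall>a b. dual_bivector u v $ a $ b - dual_bivector v u $ a $ b = 2 * dual_bivector u v $ a $ b"
      unfolding forall_4 dual_bivector_def row4_nth by (simp add: algebra_simps)
    then show ?thesis by blast
  qed
  then show ?thesis
    unfolding star_def real_scaleR_def
    by (simp only: sum_raise sum_perm_symbol)
qed

text \<open>The inner product that a metric with inverse \<open>Gi\<close> induces on two-forms.\<close>
definition form_inner :: "real^4^4 \<Rightarrow> (4 \<Rightarrow> 4 \<Rightarrow> real) \<Rightarrow> (4 \<Rightarrow> 4 \<Rightarrow> real) \<Rightarrow> real" where
  "form_inner Gi S F = (1/2) * (\<Sum>c\<in>UNIV. \<Sum>d\<in>UNIV. \<Sum>e\<in>UNIV. \<Sum>f\<in>UNIV.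
     S c d * Gi $ c $ e * Gi $ d $ f * F e f)"

lemma weyl_endo_product:
  "weyl_endo G (\<lambda>a b c d. k * S a b * S c d) F = (\<lambda>a b. k * form_inner (matrix_inv G) S F * S a b)"
  by (intro ext) (simp add: weyl_endo_def form_inner_def sum_distrib_left mult_ac)

lemma form_inner_scale: "form_inner Gi S (\<lambda>a b. k * F a b) = k * form_inner Gi S F"
  by (simp add: form_inner_def sum_distrib_left mult_ac)

lemma form_inner_wedge:
  "form_inner Gi (wedge \<alpha> \<beta>) (wedge \<gamma> \<delta>) =
    (\<alpha> \<bullet> (Gi *v \<gamma>)) * (\<beta> \<bullet> (Gi *v \<delta>)) - (\<alpha> \<bullet> (Gi *v \<delta>)) * (\<beta> \<bullet> (Gi *v \<gamma>))"
proof -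
  have *: "(\<Sum>c\<in>UNIV. \<Sum>d\<in>UNIV. wedge \<alpha> \<beta> c d * (u $ c * v $ d)) = (\<alpha> \<bullet> u) * (\<beta> \<bullet> v) - (\<beta> \<bullet> u) * (\<alpha> \<bullet> v)" for u v
    unfolding inner_vec_def sum_product sum_subtractf[symmetric]
    by (intro sum.cong refl) (simp add: wedge_def algebra_simps)
  show ?thesis
    unfolding form_inner_def using sum_raise[of 1 "wedge \<alpha> \<beta>" Gi \<gamma> \<delta>]
    unfolding * by (simp only: mult_1_left) (simp add: algebra_simps)
qed

context fefferman_conformal begin

lemma raise_\<theta>:
  assumes m: "m \<in> M"
  shows "matrix_inv (nc.g m) *v (\<theta> m $ \<mu>) = inverse ((\<rho> m)\<^sup>2) *\<^sub>R (E m *v (\<eta> *v axis \<mu> 1))"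
proof -
  have "\<theta> m $ \<mu> = transpose (\<theta> m) *v axis \<mu> 1"
    by (simp add: vec_eq_iff matrix_vector_axis_nth transpose_def del: transpose_matrix_vector)
  then have "transpose (E m) *v (\<theta> m $ \<mu>) = axis \<mu> 1"
    using nc.E_\<theta>_transpose[OF m] by (simp add: matrix_vector_mul_assoc del: transpose_matrix_vector)
  then show ?thesis
    by (simp add: nc.matrix_inv_g[OF m] nc.ginv_def matrix_vector_simps
        del: transpose_matrix_vector flip: matrix_vector_mul_assoc)
qed

lemma inner_\<theta>:
  assumes m: "m \<in> M"
  shows "(\<theta> m $ \<mu>) \<bullet> (matrix_inv (nc.g m) *v (\<theta> m $ \<nu>)) = inverse ((\<rho> m)\<^sup>2) * \<eta> $ \<mu> $ \<nu>"
proof -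
  have "(\<theta> m $ \<mu>) \<bullet> (E m *v v) = v $ \<mu>" for v
  proof -
    have "(\<theta> m $ \<mu>) \<bullet> (E m *v v) = (\<theta> m *v (E m *v v)) $ \<mu>"
      by (simp add: matrix_vector_mult_def[of "\<theta> m"] inner_vec_def)
    then show ?thesis by (simp add: matrix_vector_mul_assoc nc.\<theta>_E[OF m])
  qed
  then show ?thesis by (simp add: raise_\<theta>[OF m] matrix_vector_axis_nth)
qed

text \<open>
  The self-duality of \<open>\<theta>\<^sup>1 \<and> \<theta>\<^sup>3\<close> fixes the sign and size of the volume form, and hence the
  star of the other two-forms.
\<close>
lemma star_\<theta>:
  assumes m: "m \<in> M" and sd: "star s (nc.g m) (\<sigma>1 m) = \<sigma>1 m"
  shows "star s (nc.g m) (\<sigma>2 m) = (\<lambda>a b. - \<sigma>2 m a b)"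
    and "star s (nc.g m) (wedge (\<theta> m $ 2) (\<theta> m $ 4)) = wedge (\<theta> m $ 2) (\<theta> m $ 4)"
    and "star s (nc.g m) (wedge (\<theta> m $ 1) (\<theta> m $ 4)) = (\<lambda>a b. - wedge (\<theta> m $ 1) (\<theta> m $ 4) a b)"
proof -
  define k where "k = s * sqrt \<bar>det (nc.g m)\<bar> * inverse ((\<rho> m)\<^sup>2) * inverse ((\<rho> m)\<^sup>2)"
  have dual_scale: "dual_bivector (x *\<^sub>R u) (y *\<^sub>R v) $ a $ b = x * y * dual_bivector u v $ a $ b" for x y u v a b
  proof -
    have "\<forall>a b. dual_bivector (x *\<^sub>R u) (y *\<^sub>R v) $ a $ b = x * y * dual_bivector u v $ a $ b"
      unfolding forall_4 dual_bivector_def row4_nth by (simp add: algebra_simps)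
    then show ?thesis by blast
  qed
  have st: "star s (nc.g m) (wedge (\<theta> m $ \<mu>) (\<theta> m $ \<nu>)) a b =
      k * dual_bivector (E m *v (\<eta> *v axis \<mu> 1)) (E m *v (\<eta> *v axis \<nu> 1)) $ a $ b" for \<mu> \<nu> a b
    by (simp add: star_wedge raise_\<theta>[OF m] dual_scale k_def)
  note expl = dual_bivector_def row4_nth matrix_vector_mult_def sum_4 E_def \<eta>_def axis_nth_4 wedge_def \<theta>_def
  have "k * dual_bivector (E m *v (\<eta> *v axis 1 1)) (E m *v (\<eta> *v axis 3 1)) $ 1 $ 2 = \<sigma>1 m 1 2"
    using fun_cong[OF fun_cong[OF sd, of 1], of 2] by (simp only: st)
  then have k: "k = - 2 / 3 * i"
    using i_nz by (simp add: expl field_simps)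
  have "\<forall>a b. star s (nc.g m) (\<sigma>2 m) a b = - \<sigma>2 m a b"
    unfolding forall_4 st k using i_nz by (simp add: expl) (simp add: field_simps)?
  then show "star s (nc.g m) (\<sigma>2 m) = (\<lambda>a b. - \<sigma>2 m a b)" by blast
  have "\<forall>a b. star s (nc.g m) (wedge (\<theta> m $ 2) (\<theta> m $ 4)) a b = wedge (\<theta> m $ 2) (\<theta> m $ 4) a b"
    unfolding forall_4 st k using i_nz by (simp add: expl) (simp add: field_simps)?
  then show "star s (nc.g m) (wedge (\<theta> m $ 2) (\<theta> m $ 4)) = wedge (\<theta> m $ 2) (\<theta> m $ 4)" by blast
  have "\<forall>a b. star s (nc.g m) (wedge (\<theta> m $ 1) (\<theta> m $ 4)) a b = - wedge (\<theta> m $ 1) (\<theta> m $ 4) a b"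
    unfolding forall_4 st k using i_nz by (simp add: expl) (simp add: field_simps)?
  then show "star s (nc.g m) (wedge (\<theta> m $ 1) (\<theta> m $ 4)) = (\<lambda>a b. - wedge (\<theta> m $ 1) (\<theta> m $ 4) a b)" by blast
qed

end

section \<open>Locality of the curvature\<close>

context
  fixes M :: "(real^4) set" and g g' :: "real^4 \<Rightarrow> real^4^4"
  assumes M: "open M" and eq: "\<And>m. m \<in> M \<Longrightarrow> g m = g' m"
begin

lemma christoffel_cong: "m \<in> M \<Longrightarrow> christoffel g m a b c = christoffel g' m a b c"
proof -
  assume m: "m \<in> M"
  have "pd d (\<lambda>m. g m $ a $ b) m = pd d (\<lambda>m. g' m $ a $ b) m" for a b d
    by (rule pd_cong[OF M m]) (simp add: eq)
  then show ?thesis by (simp add: christoffel_def eq[OF m])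
qed

lemma riemann_cong: "m \<in> M \<Longrightarrow> riemann g m a b c d = riemann g' m a b c d"
proof -
  assume m: "m \<in> M"
  have "pd e (\<lambda>m. christoffel g m a b c) m = pd e (\<lambda>m. christoffel g' m a b c) m" for a b c e
    by (rule pd_cong[OF M m]) (rule christoffel_cong)
  then show ?thesis by (simp add: riemann_def christoffel_cong[OF m])
qed

lemma scalar_curv_cong: "m \<in> M \<Longrightarrow> scalar_curv g m = scalar_curv g' m"
  by (simp add: scalar_curv_def ricci_def riemann_cong eq)

lemma weyl_cong: "m \<in> M \<Longrightarrow> weyl g m a b c d = weyl g' m a b c d"
  by (simp add: weyl_def ricci_def riemann_cong scalar_curv_cong eq)

lemma conf_conn_cong: "m \<in> M \<Longrightarrow> conf_conn g \<eta> \<theta> m c = conf_conn g' \<eta> \<theta> m c"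
  by (simp add: conf_conn_blk blk_eq_iff P_form_def lc_form_def schouten_def ricci_def
      riemann_cong scalar_curv_cong christoffel_cong eq)

end

lemma smooth_on_cov_ext_deriv:
  assumes "open M" "\<And>c. smooth_on M (\<lambda>m. \<omega> m c)" "\<And>a b. smooth_on M (\<lambda>m. \<Phi> m a b)"
  shows "smooth_on M (\<lambda>m. cov_ext_deriv \<omega> \<Phi> m a b c)"
  unfolding cov_ext_deriv_def
  by (intro smooth_on_add smooth_on_diff smooth_on_matrix_mult assms
      smooth_on_pd[OF assms(3)])

lemma star_scaleR: "star s G (\<lambda>a b. F a b *\<^sub>R X) a b = star s G F a b *\<^sub>R X"
  by (rule star_linear) (simp add: linear_iff scaleR_left_distrib)

lemma half_sum_diff:
  fixes A B :: "'a::real_vector"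
  shows "(1/2) *\<^sub>R ((A + B) + (A - B)) = A" "(1/2) *\<^sub>R ((A + B) - (A - B)) = B"
proof -
  have "(A + B) + (A - B) = A + A" "(A + B) - (A - B) = B + B" by simp_all
  then show "(1/2) *\<^sub>R ((A + B) + (A - B)) = A" "(1/2) *\<^sub>R ((A + B) - (A - B)) = B"
    by (simp_all only: scaleR_half_double)
qed

text \<open>The square of a null two-form that pairs nontrivially with some form is of type N.\<close>
lemma petrov_type_N_product:
  assumes "k \<noteq> 0" "F \<in> V" "form_inner (matrix_inv G) S F \<noteq> 0" "form_inner (matrix_inv G) S S = 0" "S a b \<noteq> 0"
  shows "petrov_type_N_on V G (\<lambda>a b c d. k * S a b * S c d)"
  unfolding petrov_type_N_on_def weyl_endo_product form_inner_scale
proof (intro conjI bexI[of _ F] ballI)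
  show "(\<lambda>a b. k * form_inner (matrix_inv G) S F * S a b) \<noteq> (\<lambda>a b. 0)"
    using assms by (metis mult_eq_0_iff)
qed (use assms in auto)

lemma wedge_two_form: "wedge \<alpha> \<beta> \<in> two_forms"
  by (simp add: two_forms_def wedge_def)

text \<open>The orientation is the one in which \<open>dx \<and> (dy - p dx)\<close> is self-dual.\<close>
locale fefferman_oriented = fefferman_conformal +
  assumes orientation: "\<And>m. m \<in> M \<Longrightarrow> star s (fefferman_metric i \<rho> Q m) (\<sigma>1 m) = \<sigma>1 m"
begin

abbreviation g :: "real^4 \<Rightarrow> real^4^4" where
  "g \<equiv> fefferman_metric i \<rho> Q"

abbreviation W2 :: "real^4 \<Rightarrow> real" where
  "W2 \<equiv> q 0 0 4"

lemma star_\<sigma>: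
  assumes "m \<in> M"
  shows "star s (g m) (\<sigma>1 m) = \<sigma>1 m" "star s (g m) (\<sigma>2 m) = (\<lambda>a b. - \<sigma>2 m a b)"
  using orientation[OF assms] star_\<theta>[OF assms] fefferman_metric_eq[OF assms] by simp_all

lemma \<sigma>_values: "\<sigma>1 m 1 2 = 1" "\<sigma>2 m 3 2 = 1"
  by (simp_all add: wedge_def \<theta>_def row4_nth)

section \<open>The Weyl tensor\<close>

lemma weyl_eq:
  assumes m: "m \<in> M"
  shows "weyl g m a b c d = (\<rho> m)\<^sup>2 * W1 m / 6 * \<sigma>1 m a b * \<sigma>1 m c d + (\<rho> m)\<^sup>2 * W2 m / 6 * \<sigma>2 m a b * \<sigma>2 m c d"
proof -
  have "nc.g m ** E m = (\<rho> m)\<^sup>2 *\<^sub>R (transpose (\<theta> m) ** \<eta> ** (\<theta> m ** E m))"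
    by (simp add: nc.g_def matrix_bilinear_simps matrix_mul_assoc)
  then have gE: "nc.g m ** E m = (\<rho> m)\<^sup>2 *\<^sub>R (transpose (\<theta> m) ** \<eta>)"
    by (simp add: nc.\<theta>_E[OF m])
  have V: "(transpose (\<theta> m) ** \<eta> ** V1 m ** \<theta> m) $ a $ b = W1 m / 6 * \<sigma>1 m a b"
    "(transpose (\<theta> m) ** \<eta> ** V2 m ** \<theta> m) $ a $ b = W2 m / 6 * \<sigma>2 m a b"
    by (simp_all add: matrix_matrix_mult_def transpose_def sum_4 \<eta>_def V1_def V2_def row4_nth wedge_def algebra_simps)
  have "weyl g m a b c d = weyl nc.g m a b c d"
    by (rule weyl_cong[OF M fefferman_metric_eq m])
  also have "\<dots> = (nc.g m ** E m ** (\<sigma>1 m c d *\<^sub>R V1 m + \<sigma>2 m c d *\<^sub>R V2 m) ** \<theta> m) $ a $ b"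
    by (rule nc.weyl_g[OF m])
  also have "\<dots> = (\<rho> m)\<^sup>2 * (\<sigma>1 m c d * (transpose (\<theta> m) ** \<eta> ** V1 m ** \<theta> m) $ a $ b
      + \<sigma>2 m c d * (transpose (\<theta> m) ** \<eta> ** V2 m ** \<theta> m) $ a $ b)"
    by (simp add: gE matrix_bilinear_simps algebra_simps)
  finally show ?thesis unfolding V by (simp add: algebra_simps)
qed

lemma star_weyl:
  assumes m: "m \<in> M"
  shows "star s (g m) (weyl g m a b) c d =
    (\<rho> m)\<^sup>2 * W1 m / 6 * \<sigma>1 m a b * \<sigma>1 m c d - (\<rho> m)\<^sup>2 * W2 m / 6 * \<sigma>2 m a b * \<sigma>2 m c d"
proof -
  have *: "weyl g m a b = (\<lambda>c d. \<sigma>1 m c d *\<^sub>R ((\<rho> m)\<^sup>2 * W1 m / 6 * \<sigma>1 m a b) + \<sigma>2 m c d *\<^sub>R ((\<rho> m)\<^sup>2 * W2 m / 6 * \<sigma>2 m a b))"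
    by (intro ext) (simp add: weyl_eq[OF m] mult_ac)
  show ?thesis
    unfolding * star_add star_scaleR star_\<sigma>[OF m] by (simp add: mult_ac)
qed

lemma weyl_sd_eq: "m \<in> M \<Longrightarrow> weyl_sd s g m = (\<lambda>a b c d. (\<rho> m)\<^sup>2 * W1 m / 6 * \<sigma>1 m a b * \<sigma>1 m c d)"
  and weyl_asd_eq: "m \<in> M \<Longrightarrow> weyl_asd s g m = (\<lambda>a b c d. (\<rho> m)\<^sup>2 * W2 m / 6 * \<sigma>2 m a b * \<sigma>2 m c d)"
  by (intro ext; simp add: weyl_sd_def weyl_asd_def sd_part_def asd_part_def star_weyl weyl_eq)+

lemma petrov_sd:
  assumes m: "m \<in> M"
  shows "petrov_type_N_on (sd_forms s (g m)) (g m) (weyl_sd s g m) \<or> weyl_sd s g m = (\<lambda>a b c d. 0)"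
proof (cases "W1 m = 0")
  case False
  have "petrov_type_N_on (sd_forms s (g m)) (g m) (\<lambda>a b c d. (\<rho> m)\<^sup>2 * W1 m / 6 * \<sigma>1 m a b * \<sigma>1 m c d)"
  proof (rule petrov_type_N_product[where a = 1 and b = 2])
    \<comment> \<open>the self-dual null form dual to \<open>\<theta>\<^sup>1 \<and> \<theta>\<^sup>3\<close>\<close>
    show "wedge (\<theta> m $ 2) (\<theta> m $ 4) \<in> sd_forms s (g m)"
      using star_\<theta>[OF m] star_\<sigma>[OF m] by (simp add: sd_forms_def wedge_two_form fefferman_metric_eq[OF m])
  qed (use False \<rho>_nz[OF m] \<sigma>_values in \<open>simp_all add: fefferman_metric_eq[OF m] form_inner_wedge inner_\<theta>[OF m], simp_all add: \<eta>_def row4_nth\<close>)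
  then show ?thesis by (simp add: weyl_sd_eq[OF m])
qed (simp add: weyl_sd_eq[OF m])

lemma petrov_asd:
  assumes m: "m \<in> M"
  shows "petrov_type_N_on (asd_forms s (g m)) (g m) (weyl_asd s g m) \<or> weyl_asd s g m = (\<lambda>a b c d. 0)"
proof (cases "W2 m = 0")
  case False
  have "petrov_type_N_on (asd_forms s (g m)) (g m) (\<lambda>a b c d. (\<rho> m)\<^sup>2 * W2 m / 6 * \<sigma>2 m a b * \<sigma>2 m c d)"
  proof (rule petrov_type_N_product[where a = 3 and b = 2])
    \<comment> \<open>the anti-self-dual null form dual to \<open>\<theta>\<^sup>2 \<and> \<theta>\<^sup>3\<close>\<close>
    show "wedge (\<theta> m $ 1) (\<theta> m $ 4) \<in> asd_forms s (g m)"
      using star_\<theta>[OF m] star_\<sigma>[OF m] by (simp add: asd_forms_def wedge_two_form fefferman_metric_eq[OF m])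
  qed (use False \<rho>_nz[OF m] \<sigma>_values in \<open>simp_all add: fefferman_metric_eq[OF m] form_inner_wedge inner_\<theta>[OF m], simp_all add: \<eta>_def row4_nth\<close>)
  then show ?thesis by (simp add: weyl_asd_eq[OF m])
qed (simp add: weyl_asd_eq[OF m])

lemma inv_R_eq: "m \<in> M \<Longrightarrow> inv_R i \<rho> Q m = - (exp (2 * i * m $ 4) / (6 * i^2 * \<rho> m ^ 4)) * W1 m"
  and inv_R_bar_eq: "m \<in> M \<Longrightarrow> inv_R_bar i \<rho> Q m = - (exp (- (2 * i * m $ 4)) / (6 * i^2 * \<rho> m ^ 4)) * W2 m"
  by (simp_all add: inv_R_def inv_R_bar_def W1_eq jet_q)

lemma inv_R_zero_iff: "m \<in> M \<Longrightarrow> inv_R i \<rho> Q m = 0 \<longleftrightarrow> W1 m = 0"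
  and inv_R_bar_zero_iff: "m \<in> M \<Longrightarrow> inv_R_bar i \<rho> Q m = 0 \<longleftrightarrow> W2 m = 0"
  by (simp_all add: inv_R_eq inv_R_bar_eq i_nz \<rho>_nz)

lemma \<sigma>_smooth: "smooth_on M (\<lambda>m. wedge (\<theta> m $ \<mu>) (\<theta> m $ \<nu>) a b)"
  unfolding wedge_def by (intro smooth_on_diff smooth_on_mult smooth_on_vec_nth M \<theta>_smooth)

lemma proportional_sd: "proportional_on M (weyl_sd s g) (inv_R i \<rho> Q)"
  unfolding proportional_on_def
proof (intro exI conjI ballI allI)
  let ?T = "\<lambda>m a b c d. - (i * i * \<rho> m ^ 6) * exp (- (2 * i) * m $ 4) * \<sigma>1 m a b * \<sigma>1 m c d"
  show "smooth_on M (\<lambda>m. ?T m a b c d)" for a b c d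
    by (intro smooth_on_mult smooth_on_minus smooth_on_power smooth_on_exp smooth_on_const smooth_on_coord
        \<sigma>_smooth \<rho>_smooth M)
  fix m assume m: "m \<in> M"
  have "?T m 1 2 1 2 \<noteq> 0" using i_nz \<rho>_nz[OF m] by (simp add: \<sigma>_values)
  then show "?T m \<noteq> (\<lambda>a b c d. 0)" by metis
  show "weyl_sd s g m a b c d = inv_R i \<rho> Q m * ?T m a b c d" for a b c d
    using i_nz \<rho>_nz[OF m]
    by (simp add: weyl_sd_eq[OF m] inv_R_eq[OF m] exp_minus field_simps power2_eq_square eval_nat_numeral)
qed

lemma proportional_asd: "proportional_on M (weyl_asd s g) (inv_R_bar i \<rho> Q)"
  unfolding proportional_on_def
proof (intro exI conjI ballI allI)
  let ?T = "\<lambda>m a b c d. - (i * i * \<rho> m ^ 6) * exp ((2 * i) * m $ 4) * \<sigma>2 m a b * \<sigma>2 m c d"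
  show "smooth_on M (\<lambda>m. ?T m a b c d)" for a b c d
    by (intro smooth_on_mult smooth_on_minus smooth_on_power smooth_on_exp smooth_on_const smooth_on_coord
        \<sigma>_smooth \<rho>_smooth M)
  fix m assume m: "m \<in> M"
  have "?T m 3 2 3 2 \<noteq> 0" using i_nz \<rho>_nz[OF m] by (simp add: \<sigma>_values)
  then show "?T m \<noteq> (\<lambda>a b c d. 0)" by metis
  show "weyl_asd s g m a b c d = inv_R_bar i \<rho> Q m * ?T m a b c d" for a b c d
    using i_nz \<rho>_nz[OF m]
    by (simp add: weyl_asd_eq[OF m] inv_R_bar_eq[OF m] exp_minus field_simps power2_eq_square eval_nat_numeral)
qed


section \<open>The Baston--Mason conditions\<close>

text \<open>The Hodge dual of the curvature of \<open>\<omega>\<close>.\<close>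
definition \<Psi> :: "real^4 \<Rightarrow> 4 \<Rightarrow> 4 \<Rightarrow> real^six^six" where
  "\<Psi> m a b = \<sigma>1 m a b *\<^sub>R N1 m - \<sigma>2 m a b *\<^sub>R N2 m"

lemma N_smooth: "smooth_on M N1" "smooth_on M N2"
proof -
  have W: "smooth_on M (\<lambda>m. W1 m / k)" "smooth_on M (\<lambda>m. - W1 m / k)" "smooth_on M (\<lambda>m. - pd 3 W1 m / k)" for k
    unfolding divide_inverse
    by (intro smooth_on_mult smooth_on_minus smooth_on_const W1_smooth
        smooth_on_pd[OF W1_smooth] M)+
  have q: "smooth_on M (\<lambda>m. q a b c m / k)" for a b c k
    unfolding divide_inverse by (intro smooth_on_mult smooth_on_const q_smooth M)
  have Y: "smooth_on M Y1" "smooth_on M V1" "smooth_on M V2"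
    unfolding Y1_def[abs_def] V1_def[abs_def] V2_def[abs_def]
    by (intro smooth_on_row4 smooth_on_const W q M)+
  have Y2: "smooth_on M Y2"
    unfolding Y2_def[abs_def]
    by (intro smooth_on_row4 smooth_on_const smooth_on_divide smooth_on_mult smooth_on_minus smooth_on_add
        smooth_on_coord q_smooth M) simp_all
  show "smooth_on M N1" "smooth_on M N2"
    unfolding N1_def[abs_def] N2_def[abs_def]
    by (intro smooth_on_blk smooth_on_const smooth_on_matrix_vector Y Y2 M)+
qed

lemma \<Psi>_smooth: "smooth_on M (\<lambda>m. \<Psi> m a b)"
  unfolding \<Psi>_def by (intro smooth_on_diff smooth_on_scaleR \<sigma>_smooth N_smooth M)

text \<open>
  With the basis vectors numbered \<open>0, ..., 5\<close>, the null subspace spanned by \<open>e\<^sub>0/2 - e\<^sub>4\<close>, \<open>e\<^sub>1\<close>,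
  \<open>e\<^sub>3/2 + e\<^sub>5\<close> is invariant, and \<open>N\<^sub>1\<close> and \<open>N\<^sub>2\<close> act on it as strictly upper triangular
  matrices with one of the two entries above the diagonal equal to a multiple of \<open>w\<^sub>1\<close> and \<open>w\<^sub>2\<close>,
  respectively.  The corner entries, which contain the derivatives of \<open>w\<^sub>1\<close> and \<open>w\<^sub>2\<close>, are central
  and drop out.
\<close>
lemma N_commutator:
  "N1 m ** N2 m - N2 m ** N1 m =
    (W1 m * W2 m) *\<^sub>R blk 0 (row4 0 0 (- 1 / 36) 0) 0 0 0 (row4 0 0 0 (1 / 36)) 0 0 0"
proof -
  have "\<forall>X Y. (N1 m ** N2 m - N2 m ** N1 m) $ X $ Y =
    ((W1 m * W2 m) *\<^sub>R blk 0 (row4 0 0 (- 1 / 36) 0) 0 0 0 (row4 0 0 0 (1 / 36)) 0 0 0) $ X $ Y"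
    unfolding all_six forall_4
    by (simp add: N1_def N2_def blk_nth matrix_matrix_mult_def sum_six sum_4 Y1_def Y2_def V1_def V2_def
        row4_nth matrix_vector_mult_def \<eta>_def)
  then show ?thesis by (simp add: vec_eq_iff)
qed

text \<open>The vanishing has to hold on an open set, as \<open>N\<^sub>1\<close> and \<open>N\<^sub>2\<close> also contain derivatives.\<close>
lemma N1_zero:
  assumes S: "open S" "m \<in> S" and W1: "\<And>m. m \<in> S \<Longrightarrow> W1 m = 0"
  shows "N1 m = 0"
proof -
  have "pd 3 W1 m = pd 3 (\<lambda>m. 0) m"
    by (rule pd_cong[OF S W1])
  then have "Y1 m = 0" "V1 m = 0"
    by (simp_all add: Y1_def V1_def W1[OF S(2)] pd_const vec_eq_iff forall_4 row4_nth)
  then show ?thesis by (simp add: N1_def blk_zero)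
qed

lemma N2_zero:
  assumes S: "open S" "S \<subseteq> M" "m \<in> S" and W2: "\<And>m. m \<in> S \<Longrightarrow> W2 m = 0"
  shows "N2 m = 0"
proof -
  have m: "m \<in> M" using S by blast
  have "pd k W2 m = 0" for k
    using pd_cong[OF S(1,3) W2, where k = k] by (simp add: pd_const)
  then have "q 1 0 4 m = 0" "q 0 1 4 m = 0" "q 0 0 5 m = 0"
    using pd_q[OF m, of 0 0 4] by simp_all
  then have "Y2 m = 0" "V2 m = 0"
    using W2[OF S(3)] by (simp_all add: Y2_def V2_def vec_eq_iff forall_4 row4_nth)
  then show ?thesis by (simp add: N2_def blk_zero)
qed

text \<open>
  Suppose that the expression is nonzero at a point, hence near it.  Where \<open>w\<^sub>2\<close> is nonzero,
  \<open>w\<^sub>1\<close> vanishes on an open set, \<open>\<Psi>\<close> is minus the curvature there, and the Bianchi identity is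
  contradicted.  So \<open>w\<^sub>2\<close> vanishes near the point, \<open>\<Psi>\<close> is the curvature itself, and the Bianchi
  identity is contradicted again.
\<close>
lemma bach_flat:
  assumes W: "\<And>m. m \<in> M \<Longrightarrow> W1 m * W2 m = 0" and m: "m \<in> M"
  shows "cov_ext_deriv \<omega> \<Psi> m a b c = 0"
proof (rule ccontr)
  let ?B = "\<lambda>m. cov_ext_deriv \<omega> \<Psi> m a b c"
  assume "?B m \<noteq> 0"
  have "smooth_on M ?B"
    by (rule smooth_on_cov_ext_deriv[OF M \<omega>_smooth \<Psi>_smooth])
  then have "continuous_on M ?B" by (rule smooth_on_continuous_on)
  then have "open (?B -` (- {0}) \<inter> M)"
    using continuous_open_vimage continuous_on_open_vimage[OF M] by blast
  define S where "S = ?B -` (- {0}) \<inter> M"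
  have S: "open S" "S \<subseteq> M" "m \<in> S" "\<And>n. n \<in> S \<Longrightarrow> ?B n \<noteq> 0"
    using \<open>open _\<close> \<open>?B m \<noteq> 0\<close> m by (auto simp: S_def)
  have bianchi: "cov_ext_deriv \<omega> (curvature_form \<omega>) n a b c = 0" if "n \<in> M" for n
    by (rule bianchi_identity[OF M that \<omega>_smooth])
  have W2: "W2 n = 0" if n: "n \<in> S" for n
  proof (rule ccontr)
    assume "W2 n \<noteq> 0"
    have "continuous_on M W2" using smooth_on_continuous_on[OF q_smooth] by simp
    then have "open (W2 -` (- {0}) \<inter> M)"
      using continuous_on_open_vimage[OF M] by blast
    define T where "T = W2 -` (- {0}) \<inter> M"
    have T: "open T" "n \<in> T" "T \<subseteq> M" "\<And>k. k \<in> T \<Longrightarrow> W2 k \<noteq> 0"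
      using \<open>open (W2 -` (- {0}) \<inter> M)\<close> \<open>W2 n \<noteq> 0\<close> n S by (auto simp: T_def)
    then have "W1 k = 0" if "k \<in> T" for k using W that by fastforce
    then have N1: "N1 k = 0" if "k \<in> T" for k using N1_zero[OF T(1) that] by blast
    have "cov_ext_deriv \<omega> \<Psi> n a b c = cov_ext_deriv \<omega> (\<lambda>m a b. - curvature_form \<omega> m a b) n a b c"
      by (rule cov_ext_deriv_cong[OF T(1,2)]) (use T in \<open>simp add: \<Psi>_def curvature_\<omega> subset_eq N1\<close>)
    also have "\<dots> = - cov_ext_deriv \<omega> (curvature_form \<omega>) n a b c"
    proof (rule cov_ext_deriv_minus)
      fix a b
      have "(\<lambda>m. - \<Psi> m a b) differentiable (at n)"
        using smooth_on_differentiable[OF smooth_on_minus[OF M \<Psi>_smooth]] T by blast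
      then show "(\<lambda>m. curvature_form \<omega> m a b) differentiable (at n)"
        by (rule differentiable_cong[OF T(1,2), rotated]) (use T in \<open>simp add: \<Psi>_def curvature_\<omega> subset_eq N1\<close>)
    qed
    finally show False using S(4)[OF n] bianchi[of n] T by auto
  qed
  then have N2: "N2 k = 0" if "k \<in> S" for k using N2_zero[OF S(1,2) that] by blast
  have "cov_ext_deriv \<omega> \<Psi> m a b c = cov_ext_deriv \<omega> (curvature_form \<omega>) m a b c"
    by (rule cov_ext_deriv_cong[OF S(1,3)]) (use S in \<open>simp add: \<Psi>_def curvature_\<omega> subset_eq N2\<close>)
  then show False using S(3,4) bianchi[OF m] by simp
qed

lemma baston_mason_iff:
  assumes ad: "adapted_coframe M g \<eta>' \<theta>'"
  shows "baston_mason_on M s g \<eta>' \<theta>' \<longleftrightarrow> (\<forall>m\<in>M. W1 m * W2 m = 0)"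
proof -
  \<comment> \<open>\<open>h\<close> carries \<open>\<omega>\<close> to the normal connection in the gauge of the given coframe.\<close>
  define \<Theta> where "\<Theta> = (\<lambda>m. blk 1 0 0 0 (\<theta>' m) 0 0 0 1)"
  define h where "h = (\<lambda>m. \<Theta> m ** nc.K m)"
  define hi where "hi = (\<lambda>m. nc.Kinv m ** blk 1 0 0 0 (matrix_inv (\<theta>' m)) 0 0 0 1)"
  define \<omega>c where "\<omega>c = conf_conn g \<eta>' \<theta>'"
  define \<Omega> where "\<Omega> = curvature_form \<omega>c"
  have sm: "smooth_on M \<theta>'" and inv: "\<And>m. m \<in> M \<Longrightarrow> invertible (\<theta>' m)"
    using ad by (auto simp: adapted_coframe_def)
  have \<Theta>: "smooth_on M \<Theta>" unfolding \<Theta>_def by (intro smooth_on_blk smooth_on_const sm M)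
  have h: "smooth_on M h" unfolding h_def
    by (intro smooth_on_matrix_mult \<Theta> nc.K_smooth M)
  have hi: "smooth_on M hi" unfolding hi_def
    by (intro smooth_on_matrix_mult nc.Kinv_smooth smooth_on_blk smooth_on_const
        smooth_on_matrix_inv sm inv M)
  have hhi: "h m ** hi m = mat 1" if "m \<in> M" for m
  proof -
    have "h m ** hi m = \<Theta> m ** (nc.K m ** nc.Kinv m) ** blk 1 0 0 0 (matrix_inv (\<theta>' m)) 0 0 0 1"
      by (simp add: h_def hi_def matrix_mul_assoc)
    then show ?thesis
      by (simp add: nc.K_Kinv[OF that] \<Theta>_def blk_mult matrix_inv_right[OF inv[OF that]] outer_def
          flip: blk_one zero_vec_def)
  qed
  then have hih: "hi m ** h m = mat 1" if "m \<in> M" for m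
    using that matrix_left_right_inverse by blast
  have ad': "adapted_coframe M nc.g \<eta>' \<theta>'"
    using ad by (simp add: adapted_coframe_def fefferman_metric_eq)
  have "gauge_related M (conf_conn nc.g \<eta>' \<theta>') \<Theta> (coord_conn nc.g)"
    unfolding \<Theta>_def by (rule conf_conn_gauge[OF M ad' nc.g_invertible])
  then have "gauge_related M \<omega>c \<Theta> (coord_conn nc.g)"
    by (simp add: gauge_related_def \<omega>c_def conf_conn_cong[OF M fefferman_metric_eq])
  then have rel: "gauge_related M \<omega>c h \<omega>"
    unfolding h_def
    by (rule gauge_related_trans[OF _ nc.coord_conn_gauge])
       (use smooth_on_differentiable[OF \<Theta>] smooth_on_differentiable[OF nc.K_smooth] in blast)+
  have conj: "X = Y ** hi m" if "X ** h m = Y" "m \<in> M" for X Y m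
    using that hhi by (metis matrix_mul_assoc matrix_mul_rid)
  have \<omega>c_eq: "(h m ** \<omega> m c - pd c h m) ** hi m = \<omega>c m c" if "m \<in> M" for m c
    using rel that by (intro conj[symmetric]) (auto simp: gauge_related_def algebra_simps)
  have \<omega>c: "smooth_on M (\<lambda>m. \<omega>c m c)" for c
  proof (rule smooth_on_cong[OF M \<omega>c_eq])
    show "smooth_on M (\<lambda>m. (h m ** \<omega> m c - pd c h m) ** hi m)"
      by (intro smooth_on_matrix_mult smooth_on_diff smooth_on_pd[OF h]
          h hi \<omega>_smooth M)
  qed
  have \<Omega>: "\<Omega> m a b = \<sigma>1 m a b *\<^sub>R (h m ** N1 m ** hi m) + \<sigma>2 m a b *\<^sub>R (h m ** N2 m ** hi m)"
    if m: "m \<in> M" for m a b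
  proof -
    have "\<Omega> m a b ** h m = h m ** curvature_form \<omega> m a b"
      unfolding \<Omega>_def using smooth_on_differentiable[OF \<omega>c m] smooth_on_differentiable[OF \<omega>_smooth m]
      by (intro curvature_form_gauge[OF M m rel h])
    then have "\<Omega> m a b = h m ** curvature_form \<omega> m a b ** hi m"
      using conj m by blast
    then show ?thesis by (simp add: curvature_\<omega>[OF m] matrix_bilinear_simps)
  qed
  have st: "star s (g m) (\<Omega> m) a b = \<sigma>1 m a b *\<^sub>R (h m ** N1 m ** hi m) - \<sigma>2 m a b *\<^sub>R (h m ** N2 m ** hi m)"
    if m: "m \<in> M" for m a b
  proof -
    have "\<Omega> m = (\<lambda>a b. \<sigma>1 m a b *\<^sub>R (h m ** N1 m ** hi m) + \<sigma>2 m a b *\<^sub>R (h m ** N2 m ** hi m))"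
      by (intro ext \<Omega> m)
    then show ?thesis by (simp add: star_add star_scaleR star_\<sigma>[OF m])
  qed
  have parts: "sd_part s (g m) (\<Omega> m) a b = \<sigma>1 m a b *\<^sub>R (h m ** N1 m ** hi m)"
    "asd_part s (g m) (\<Omega> m) a b = \<sigma>2 m a b *\<^sub>R (h m ** N2 m ** hi m)" if m: "m \<in> M" for m a b
    unfolding sd_part_def asd_part_def st[OF m] \<Omega>[OF m] by (simp_all only: half_sum_diff)
  define C where "C = blk 0 (row4 0 0 (- 1 / 36) 0) 0 0 0 (row4 0 0 0 (1 / 36)) 0 0 0"
  have comm: "sd_part s (g m) (\<Omega> m) a b ** asd_part s (g m) (\<Omega> m) c d
       - asd_part s (g m) (\<Omega> m) c d ** sd_part s (g m) (\<Omega> m) a b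
     = (\<sigma>1 m a b * \<sigma>2 m c d * (W1 m * W2 m)) *\<^sub>R (h m ** C ** hi m)" if m: "m \<in> M" for m a b c d
  proof -
    have X: "(h m ** A ** hi m) ** (h m ** B ** hi m) = h m ** (A ** B) ** hi m" for A B
    proof -
      have "(h m ** A ** hi m) ** (h m ** B ** hi m) = h m ** A ** (hi m ** h m) ** B ** hi m"
        by (simp add: matrix_mul_assoc)
      then show ?thesis by (simp add: hih[OF m] matrix_mul_assoc)
    qed
    have "sd_part s (g m) (\<Omega> m) a b ** asd_part s (g m) (\<Omega> m) c d
       - asd_part s (g m) (\<Omega> m) c d ** sd_part s (g m) (\<Omega> m) a b
      = (\<sigma>1 m a b * \<sigma>2 m c d) *\<^sub>R (h m ** (N1 m ** N2 m - N2 m ** N1 m) ** hi m)"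
      unfolding parts[OF m] by (simp add: matrix_bilinear_simps X scaleR_diff_right mult.commute)
    then show ?thesis unfolding N_commutator C_def[symmetric] by (simp add: matrix_bilinear_simps)
  qed
  show ?thesis
  proof
    assume "baston_mason_on M s g \<eta>' \<theta>'"
    then have bm: "sd_part s (g m) (\<Omega> m) a b ** asd_part s (g m) (\<Omega> m) c d
       - asd_part s (g m) (\<Omega> m) c d ** sd_part s (g m) (\<Omega> m) a b = 0" if "m \<in> M" for m a b c d
      using that unfolding baston_mason_on_def Let_def \<omega>c_def[symmetric] \<Omega>_def[symmetric] by blast
    have *: "(\<sigma>1 m a b * \<sigma>2 m c d * (W1 m * W2 m)) *\<^sub>R (h m ** C ** hi m) = 0" if "m \<in> M" for m a b c d
      by (rule trans[OF comm[OF that, symmetric] bm[OF that]])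
    show "\<forall>m\<in>M. W1 m * W2 m = 0"
    proof
      fix m assume m: "m \<in> M"
      have "h m ** C ** hi m \<noteq> 0"
      proof
        assume 0: "h m ** C ** hi m = 0"
        have "C = (hi m ** h m) ** C ** (hi m ** h m)" by (simp add: hih[OF m])
        also have "\<dots> = hi m ** (h m ** C ** hi m) ** h m" by (simp add: matrix_mul_assoc)
        finally have "C = 0" by (simp add: 0 matrix_bilinear_simps)
        then have "C $ Inl () $ Inr (Inl 3) = 0" by simp
        then show False by (simp add: C_def blk_nth row4_nth)
      qed
      then show "W1 m * W2 m = 0" using *[OF m, of 1 2 3 2] by (simp add: \<sigma>_values)
    qed
  next
    assume W: "\<forall>m\<in>M. W1 m * W2 m = 0"
    have 1: "cov_ext_deriv \<omega>c (\<lambda>m. star s (g m) (\<Omega> m)) m a b c = 0" if m: "m \<in> M" for m a b c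
    proof -
      have st': "star s (g m) (\<Omega> m) a b = h m ** \<Psi> m a b ** hi m" if "m \<in> M" for m a b
        by (simp add: st[OF that] \<Psi>_def matrix_bilinear_simps)
      have "cov_ext_deriv \<omega>c (\<lambda>m. star s (g m) (\<Omega> m)) m a b c ** h m = h m ** cov_ext_deriv \<omega> \<Psi> m a b c"
      proof (rule cov_ext_deriv_gauge[OF M m rel])
        show "star s (g m) (\<Omega> m) a b ** h m = h m ** \<Psi> m a b" if "m \<in> M" for m a b
          by (simp add: st'[OF that] hih[OF that] flip: matrix_mul_assoc)
        have sm\<Psi>: "smooth_on M (\<lambda>m. h m ** \<Psi> m a b ** hi m)" for a b
          by (intro smooth_on_matrix_mult h hi \<Psi>_smooth M)
        show "(\<lambda>m. star s (g m) (\<Omega> m) a b) differentiable (at m)" for a b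
          by (rule differentiable_cong[OF M m st'[symmetric] smooth_on_differentiable[OF sm\<Psi> m]])
        show "h differentiable (at m)" "(\<lambda>m. \<Psi> m a b) differentiable (at m)" for a b
          using smooth_on_differentiable[OF _ m] h \<Psi>_smooth by blast+
      qed
      then have "cov_ext_deriv \<omega>c (\<lambda>m. star s (g m) (\<Omega> m)) m a b c ** h m = 0"
        using bach_flat[OF _ m] W by (simp add: matrix_bilinear_simps)
      from conj[OF this m] show ?thesis by (simp add: matrix_bilinear_simps)
    qed
    show "baston_mason_on M s g \<eta>' \<theta>'"
      unfolding baston_mason_on_def Let_def \<omega>c_def[symmetric] \<Omega>_def[symmetric]
      using 1 comm W by simp
  qed
qed

end

section \<open>Nonsingular points\<close>

lemma product_nonzero_nonsingular:
  assumes M: "open M" and f: "continuous_on M f" and f': "continuous_on M f'"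
    and m: "m \<in> M" and nz: "f m * f' m \<noteq> (0::real)"
  shows "nonsingular_pt f m \<and> nonsingular_pt f' m \<and> \<not> (\<forall>\<^sub>F n in nhds m. f n = 0) \<and> \<not> (\<forall>\<^sub>F n in nhds m. f' n = 0)"
proof -
  have "\<forall>\<^sub>F n in nhds m. h n \<noteq> 0" if "continuous_on M h" "h m \<noteq> 0" for h :: "_ \<Rightarrow> real"
  proof -
    have "open (h -` (- {0}) \<inter> M)" using that continuous_on_open_vimage[OF M] by blast
    then show ?thesis using that m by (auto simp: eventually_nhds intro!: exI[of _ "h -` (- {0}) \<inter> M"])
  qed
  then show ?thesis
    using f f' nz eventually_nhds_x_imp_x[of "\<lambda>n. f n = 0" m] eventually_nhds_x_imp_x[of "\<lambda>n. f' n = 0" m]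
    by (auto simp: nonsingular_pt_def)
qed

lemma product_zero_iff_nonsingular:
  fixes f f' :: "real^4 \<Rightarrow> real"
  assumes M: "open M" and f: "continuous_on M f" and f': "continuous_on M f'"
  shows "(\<forall>m\<in>M. f m * f' m = 0) \<longleftrightarrow>
    (\<forall>m\<in>M. nonsingular_pt f m \<and> nonsingular_pt f' m \<longrightarrow>
      (\<forall>\<^sub>F n in nhds m. f n = 0) \<or> (\<forall>\<^sub>F n in nhds m. f' n = 0))" (is "?L \<longleftrightarrow> ?R")
proof
  assume L: ?L
  show ?R
  proof (intro ballI impI)
    fix m assume m: "m \<in> M" and ns: "nonsingular_pt f m \<and> nonsingular_pt f' m"
    have "\<forall>\<^sub>F n in nhds m. n \<in> M" using M m by (rule eventually_nhds_in_open)
    then have "\<forall>\<^sub>F n in nhds m. f n * f' n = 0" by eventually_elim (use L in blast)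
    then show "(\<forall>\<^sub>F n in nhds m. f n = 0) \<or> (\<forall>\<^sub>F n in nhds m. f' n = 0)"
      using ns unfolding nonsingular_pt_def by (auto elim: eventually_elim2)
  qed
next
  assume ?R
  then show ?L using product_nonzero_nonsingular[OF M f f'] by blast
qed

lemma product_zero_iff_connected:
  fixes f f' :: "real^4 \<Rightarrow> real"
  assumes M: "open M" "connected M" and ns: "\<And>m. m \<in> M \<Longrightarrow> nonsingular_pt f m"
  shows "(\<forall>m\<in>M. f m * f' m = 0) \<longleftrightarrow> (\<forall>m\<in>M. f m = 0) \<or> (\<forall>m\<in>M. f' m = 0)"
proof -
  have "(\<forall>m\<in>M. f m = 0) \<or> (\<forall>m\<in>M. f m \<noteq> 0)"
  proof (rule ccontr)
    assume neg: "\<not> ?thesis"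
    define A where "A = {m. \<forall>\<^sub>F n in nhds m. f n = 0}"
    define B where "B = {m. \<forall>\<^sub>F n in nhds m. f n \<noteq> 0}"
    have "open A" "open B"
      by (auto simp: A_def B_def open_subopen[of "{m. _ m}"] eventually_nhds)
    moreover have "M \<subseteq> A \<union> B" using ns by (auto simp: A_def B_def nonsingular_pt_def)
    moreover have z: "m \<in> A \<Longrightarrow> f m = 0" "m \<in> B \<Longrightarrow> f m \<noteq> 0" for m
      using eventually_nhds_x_imp_x unfolding A_def B_def by blast+
    moreover have "A \<inter> M \<noteq> {}" "B \<inter> M \<noteq> {}" using neg z \<open>M \<subseteq> A \<union> B\<close> by blast+
    ultimately show False using connectedD[OF M(2), of A B] by blast
  qed
  then show ?thesis by auto
qed

section \<open>Fefferman metrics\<close>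

theorem proposition1:
  fixes i :: real and s :: real
    and M :: "(real^4) set"
    and Q :: "real^3 \<Rightarrow> real"
    and \<rho> :: "real^4 \<Rightarrow> real"
  defines "g \<equiv> fefferman_metric i \<rho> Q"
    and "R \<equiv> inv_R i \<rho> Q"
    and "R_bar \<equiv> inv_R_bar i \<rho> Q"
  assumes i_nonzero: "i \<noteq> 0"
    and M_open: "open M"
    and Q_smooth: "smooth_on (jet ` M) Q"
    and rho_smooth: "smooth_on M \<rho>"
    and rho_nonzero: "\<And>m. m \<in> M \<Longrightarrow> \<rho> m \<noteq> 0"
    and orientation: "s = 1 \<or> s = - 1"
      "\<And>m. m \<in> M \<Longrightarrow> wedge form_dx (contact_form m) \<in> sd_forms s (g m)"
  shows
    "(\<forall>m\<in>M. has_signature_2_2 (g m)) \<and>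
     (\<forall>m\<in>M.
        (petrov_type_N_on (sd_forms s (g m)) (g m) (weyl_sd s g m)
           \<or> weyl_sd s g m = (\<lambda>a b c d. 0)) \<and>
        (petrov_type_N_on (asd_forms s (g m)) (g m) (weyl_asd s g m)
           \<or> weyl_asd s g m = (\<lambda>a b c d. 0))) \<and>
     proportional_on M (weyl_sd s g) R \<and>
     proportional_on M (weyl_asd s g) R_bar \<and>
     (\<forall>\<eta> \<theta>. adapted_coframe M g \<eta> \<theta> \<longrightarrow>
        (baston_mason_on M s g \<eta> \<theta> \<longleftrightarrow>
           (\<forall>m\<in>M. nonsingular_pt R m \<and> nonsingular_pt R_bar m \<longrightarrow>
              (\<forall>\<^sub>F n in nhds m. R n = 0) \<or> (\<forall>\<^sub>F n in nhds m. R_bar n = 0))) \<and>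
        (connected M \<and> (\<forall>m\<in>M. nonsingular_pt R m \<and> nonsingular_pt R_bar m) \<longrightarrow>
           (baston_mason_on M s g \<eta> \<theta> \<longleftrightarrow>
              (\<forall>m\<in>M. R m = 0) \<or> (\<forall>m\<in>M. R_bar m = 0))))"
proof -
  interpret fc: fefferman_conformal i M Q \<rho> s
    by unfold_locales (fact i_nonzero M_open Q_smooth rho_smooth | rule rho_nonzero)+
  interpret fefferman_oriented i M Q \<rho> s
  proof
    fix m assume "m \<in> M"
    then show "star s (fefferman_metric i \<rho> Q m) (fc.\<sigma>1 m) = fc.\<sigma>1 m"
      using orientation(2)[of m] unfolding g_def fc.contact_form_\<theta> fc.form_dx_\<theta>[of m] by (simp add: sd_forms_def)
  qed
  have cont: "continuous_on M R" "continuous_on M R_bar"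
  proof -
    have e: "continuous_on M \<rho>" "continuous_on M fc.W1" "continuous_on M (fc.q 0 0 4)"
      using smooth_on_continuous_on rho_smooth fc.W1_smooth fc.q_smooth[of 0 0 4] by auto
    have "continuous_on M (\<lambda>m. - (exp (2 * i * m $ 4) / (6 * i^2 * \<rho> m ^ 4)) * fc.W1 m)"
      "continuous_on M (\<lambda>m. - (exp (- (2 * i * m $ 4)) / (6 * i^2 * \<rho> m ^ 4)) * fc.q 0 0 4 m)"
      using i_nonzero rho_nonzero by (intro continuous_intros e; simp)+
    then show "continuous_on M R" "continuous_on M R_bar"
      unfolding R_def R_bar_def by (simp_all add: inv_R_eq inv_R_bar_eq cong: continuous_on_cong)
  qed
  have R: "(\<forall>m\<in>M. fc.W1 m * fc.q 0 0 4 m = 0) \<longleftrightarrow> (\<forall>m\<in>M. R m * R_bar m = 0)"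
    unfolding R_def R_bar_def by (simp add: inv_R_zero_iff inv_R_bar_zero_iff)
  have sig: "\<forall>m\<in>M. has_signature_2_2 (g m)"
    using fc.signature fc.fefferman_metric_eq by (simp add: g_def)
  have bm: "baston_mason_on M s g \<eta> \<theta> \<longleftrightarrow> (\<forall>m\<in>M. R m * R_bar m = 0)" if "adapted_coframe M g \<eta> \<theta>" for \<eta> \<theta>
    using baston_mason_iff[of \<eta> \<theta>] that R by (simp add: g_def)
  show ?thesis
    using sig petrov_sd petrov_asd proportional_sd proportional_asd bm
      product_zero_iff_nonsingular[OF M_open cont] product_zero_iff_connected[OF M_open, of R R_bar]
    unfolding g_def R_def R_bar_def by auto
qed

end
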